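(* Let $\mathcal{K}$ be a field, $\Gamma\leq\mathbb{R}$ an additive subgroup, $\Lambda=\Lambda^{\mathcal{K},\Gamma}$, and let $(C_*,\partial,\ell)$ be a Floer-type complex over $\Lambda$ with dual complex $(C_*^\vee,\delta,\ell^* )$. For all $k\in\mathbb{Z}$, denote by $\tilde{\mathcal{B}}_{C,k}$ the degree-$k$ verbose barcode of $(C_*,\partial,\ell)$. Then the degree-$k$ verbose barcode of $(C_*^\vee,\delta,\ell^* )$ is given by the multiset $$\tilde{\mathcal{B}}_{C^\vee,k}=\{([-a],\infty)\mid([a],\infty)\in\tilde{\mathcal{B}}_{C,-k}\}\cup\{([-a-L],L)\mid L<\infty\text{ and }([a],L)\in\tilde{\mathcal{B}}_{C,-k-1}\}.$$
   Context: **Novikov field.** $\Lambda=\Lambda^{\mathcal{K},\Gamma}$ is the field of formal sums $\sum_{g\in\Gamma}a_gT^g$ with $a_g\in\mathcal{K}$ such that for every $C\in\mathbb{R}$ only finitely many $g<C$ have $a_g\neq 0$, with power-series addition and multiplication. Its valuation is $\nu(\sum a_gT^g)=\min\{g\mid a_g\neq 0\}$, $\nu(0)=\infty$. **Orthogonalizable spaces.** A non-Archimedean normed vector space over $\Lambda$ is a pair $(C,\ell)$ with $C$ a $\Lambda$-vector space and $\ell\colon C\to\mathbb{R}\cup\{-\infty\}$ satisfying: $\ell(x)=-\infty$ iff $x=0$; $\ell(\lambda x)=\ell(x)-\nu(\lambda)$; $\ell(x+y)\leq\max\{\ell(x),\ell(y)\}$. A finite ordered collection $(w_1,\dots,w_r)$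 in $C$ is orthogonal if $\ell(\sum_i\lambda_iw_i)=\max_i\ell(\lambda_iw_i)$ for all $\lambda_i\in\Lambda$. An orthogonalizable $\Lambda$-space is a finite-dimensional non-Archimedean normed vector space admitting an orthogonal basis; subspaces (with restricted $\ell$) are again orthogonalizable. **Singular value decomposition.** Let $A\colon C\to D$ be a $\Lambda$-linear map of rank $r$ between orthogonalizable $\Lambda$-spaces. A singular value decomposition of $A$ is a choice of orthogonal ordered bases $(y_1,\dots,y_n)$ for $C$ and $(x_1,\dots,x_m)$ for $D$ such that: $(y_{r+1},\dots,y_n)$ is an orthogonal ordered basis for $\ker A$; $(x_1,\dots,x_r)$ is an orthogonal ordered basis for $\mathrm{Im}\,A$; $Ay_i=x_i$ for $i\leq r$; $\ell_C(y_1)-\ell_D(x_1)\geq\cdots\geq\ell_C(y_r)-\ell_D(x_r)$. **Floer-type complex.** $(C_*,\partial,\ell)$ is a chain complex $C_*=\bigoplus_{k\in\mathbb{Z}}C_k$ of $\Lambda$-vector spaces ($\partial C_k\subset C_{k-1}$, $\partial_k=\partial|_{C_k}$) with a function $\ell$ such that each $(C_k,\ell|_{C_k})$ is orthogonalizable and $\ell(\partial x)\leq\ell(x)$ for $x\in C_k$. **Verbose barcode.** From a singular value decomposition $((y_1,\dots,y_n),(x_1,\dots,x_m))$ of $\partial_{k+1}\colon C_{k+1}\to\ker\partial_k$, with $r=\mathrm{rank}\,\partial_{k+1}$, the degree-$k$ verbose barcode is the multiset of elements of $(\mathbb{R}/\Gamma)\times[0,\infty]$ consisting of $(\ell(x_i)\bmod\Gamma,\ell(y_i)-\ell(x_i))$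 for $i=1,\dots,r$ and $(\ell(x_i)\bmod\Gamma,\infty)$ for $i=r+1,\dots,m$. It does not depend on the choice of singular value decomposition. **Dual complex.** $C_k^\vee$ is the dual $\Lambda$-vector space of $C_{-k}$; $\delta\colon C_k^\vee\to C_{k-1}^\vee$ is the adjoint of $\partial\colon C_{-k+1}\to C_{-k}$; and for $\phi\in C_k^\vee$, $\ell^*(\phi)=\sup_{0\neq x\in C_{-k}}(-\ell(x)-\nu(\phi(x)))$. This is a Floer-type complex over $\Lambda$. In the displayed formula the sets are multisets (counted with multiplicity) and the union adds multiplicities. *)

theory Defs
  imports
    "Jordan_Normal_Form.Missing_VectorSpace"
    "HOL-Library.Extended_Real"
    "HOL-Library.Multiset"
begin

section \<open>The Novikov field\<close>

definition real_subgroup :: "real set \<Rightarrow> bool" where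
  "real_subgroup \<Gamma> \<longleftrightarrow> 0 \<in> \<Gamma> \<and> (\<forall>x\<in>\<Gamma>. \<forall>y\<in>\<Gamma>. x + y \<in> \<Gamma>) \<and> (\<forall>x\<in>\<Gamma>. - x \<in> \<Gamma>)"

text \<open>A formal sum \<open>\<Sum>g. a\<^sub>g T\<^sup>g\<close> is encoded by its coefficient function \<open>g \<mapsto> a\<^sub>g\<close>, extended by
  zero to all of \<open>\<real>\<close>. The sum defining a coefficient of a product is finite on the carrier.\<close>

definition novikov_mult :: "(real \<Rightarrow> 'k::field) \<Rightarrow> (real \<Rightarrow> 'k) \<Rightarrow> real \<Rightarrow> 'k" where
  "novikov_mult a b c = (\<Sum>g\<in>{g. a g \<noteq> 0 \<and> b (c - g) \<noteq> 0}. a g * b (c - g))"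

definition novikov :: "real set \<Rightarrow> (real \<Rightarrow> 'k::field) ring" where
  "novikov \<Gamma> =
    \<lparr>carrier = {a. (\<forall>g. a g \<noteq> 0 \<longrightarrow> g \<in> \<Gamma>) \<and> (\<forall>C. finite {g. g < C \<and> a g \<noteq> 0})},
     mult = novikov_mult,
     one = (\<lambda>g. if g = 0 then 1 else 0),
     zero = (\<lambda>g. 0),
     add = (\<lambda>a b g. a g + b g)\<rparr>"

definition nu :: "(real \<Rightarrow> 'k::field) \<Rightarrow> ereal" where
  "nu a = (if a = (\<lambda>g. 0) then \<infinity> else ereal (LEAST g. a g \<noteq> 0))"

subsection \<open>The ring of Novikov series is a field\<close>

text \<open>Not needed to state anything below, but it shows that the vector-space structures over
  \<open>novikov \<Gamma>\<close> used there, whose locale assumes a field, make sense for every subgroup \<open>\<Gamma>\<close>.\<close>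

definition left_finite :: "(real \<Rightarrow> 'k::field) \<Rightarrow> bool" where
  "left_finite a \<longleftrightarrow> (\<forall>C. finite {g. g < C \<and> a g \<noteq> 0})"

lemma left_finite_bounded_below:
  assumes "left_finite a"
  obtains m where "\<And>g. a g \<noteq> 0 \<Longrightarrow> m \<le> g"
proof (cases "\<exists>h. a h \<noteq> 0")
  case False
  then show ?thesis using that by blast
next
  case True
  then obtain h where h: "a h \<noteq> 0" by blast
  let ?F = "insert h {g. g < h \<and> a g \<noteq> 0}"
  have fin: "finite ?F" using assms by (simp add: left_finite_def)
  show ?thesis
  proof (rule that[of "Min ?F"])
    fix g assume g: "a g \<noteq> 0"
    show "Min ?F \<le> g"
    proof (cases "g < h")
      case True
      then show ?thesis using fin g by (intro Min_le) auto
    next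
      case False
      have "Min ?F \<le> h" using fin by (intro Min_le) auto
      then show ?thesis using False by linarith
    qed
  qed
qed

lemma left_finite_atMost:
  assumes "left_finite a"
  shows "finite {g. g \<le> C \<and> a g \<noteq> 0}"
proof (rule finite_subset)
  show "finite {g. g < C + 1 \<and> a g \<noteq> 0}" using assms by (simp add: left_finite_def)
qed auto

lemma finite_convolution_support:
  assumes "left_finite a" "left_finite b"
  shows "finite {g. a g \<noteq> 0 \<and> b (c - g) \<noteq> 0}"
proof -
  obtain m where m: "\<And>g. b g \<noteq> 0 \<Longrightarrow> m \<le> g" using left_finite_bounded_below[OF assms(2)] by blast
  have "{g. a g \<noteq> 0 \<and> b (c - g) \<noteq> 0} \<subseteq> {g. g \<le> c - m \<and> a g \<noteq> 0}"
    using m by (auto simp: le_diff_eq add.commute dest!: m)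
  then show ?thesis using left_finite_atMost[OF assms(1)] finite_subset by blast
qed

lemma novikov_mult_superset:
  assumes "finite F" and "\<And>g. a g \<noteq> 0 \<Longrightarrow> b (c - g) \<noteq> 0 \<Longrightarrow> g \<in> F"
  shows "novikov_mult a b c = (\<Sum>g\<in>F. a g * b (c - g))"
  unfolding novikov_mult_def
  by (rule sum.mono_neutral_left) (use assms in auto)

lemma novikov_mult_commute: "novikov_mult a b = novikov_mult b a"
proof
  fix c
  show "novikov_mult a b c = novikov_mult b a c"
    unfolding novikov_mult_def
    by (rule sum.reindex_bij_witness[of _ "\<lambda>g. c - g" "\<lambda>g. c - g"]) (auto simp: mult.commute)
qed

lemma novikov_mult_nonzeroE:
  assumes "novikov_mult a b c \<noteq> 0"
  obtains g where "a g \<noteq> 0" "b (c - g) \<noteq> 0"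
proof -
  have "{g. a g \<noteq> 0 \<and> b (c - g) \<noteq> 0} \<noteq> {}"
    using assms unfolding novikov_mult_def by (metis sum.empty)
  then show ?thesis using that by blast
qed

lemma novikov_mult_distrib_right:
  assumes "left_finite a" "left_finite b" "left_finite d"
  shows "novikov_mult (\<lambda>g. a g + b g) d c = novikov_mult a d c + novikov_mult b d c"
proof -
  let ?F = "{g. a g \<noteq> 0 \<and> d (c - g) \<noteq> 0} \<union> {g. b g \<noteq> 0 \<and> d (c - g) \<noteq> 0}"
  have fin: "finite ?F" using finite_convolution_support assms by blast
  have "novikov_mult (\<lambda>g. a g + b g) d c = (\<Sum>g\<in>?F. (a g + b g) * d (c - g))"
    by (rule novikov_mult_superset[OF fin]) auto
  moreover have "novikov_mult a d c = (\<Sum>g\<in>?F. a g * d (c - g))"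
    by (rule novikov_mult_superset[OF fin]) auto
  moreover have "novikov_mult b d c = (\<Sum>g\<in>?F. b g * d (c - g))"
    by (rule novikov_mult_superset[OF fin]) auto
  ultimately show ?thesis by (simp add: sum.distrib distrib_right)
qed

lemma left_finite_novikov_mult:
  assumes "left_finite a" "left_finite b"
  shows "left_finite (novikov_mult a b)"
  unfolding left_finite_def
proof
  fix C
  obtain m where m: "\<And>g. a g \<noteq> 0 \<Longrightarrow> m \<le> g" using left_finite_bounded_below[OF assms(1)] by blast
  obtain n where n: "\<And>g. b g \<noteq> 0 \<Longrightarrow> n \<le> g" using left_finite_bounded_below[OF assms(2)] by blast
  let ?A = "{g. g \<le> C - n \<and> a g \<noteq> 0}" and ?B = "{g. g \<le> C - m \<and> b g \<noteq> 0}"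
  have "{c. c < C \<and> novikov_mult a b c \<noteq> 0} \<subseteq> (\<lambda>(x, y). x + y) ` (?A \<times> ?B)"
  proof
    fix c assume "c \<in> {c. c < C \<and> novikov_mult a b c \<noteq> 0}"
    then have c: "c < C" "novikov_mult a b c \<noteq> 0" by auto
    from c(2) obtain g where g: "a g \<noteq> 0" "b (c - g) \<noteq> 0" by (rule novikov_mult_nonzeroE)
    have "m \<le> g" "n \<le> c - g" using m n g by auto
    then have "(g, c - g) \<in> ?A \<times> ?B" using g c by auto
    then show "c \<in> (\<lambda>(x, y). x + y) ` (?A \<times> ?B)" by force
  qed
  then show "finite {c. c < C \<and> novikov_mult a b c \<noteq> 0}"
    using left_finite_atMost[OF assms(1)] left_finite_atMost[OF assms(2)]
    by (meson finite_SigmaI finite_imageI finite_subset)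
qed

lemma novikov_mult_assoc:
  assumes "left_finite a" "left_finite b" "left_finite d"
  shows "novikov_mult (novikov_mult a b) d = novikov_mult a (novikov_mult b d)"
proof
  fix x
  obtain m where m: "\<And>g. a g \<noteq> 0 \<Longrightarrow> m \<le> g" using left_finite_bounded_below[OF assms(1)] by blast
  obtain n where n: "\<And>g. b g \<noteq> 0 \<Longrightarrow> n \<le> g" using left_finite_bounded_below[OF assms(2)] by blast
  obtain p where p: "\<And>g. d g \<noteq> 0 \<Longrightarrow> p \<le> g" using left_finite_bounded_below[OF assms(3)] by blast
  define F where "F = {g. g \<le> x - n - p \<and> a g \<noteq> 0}"
  define H where "H = {g. g \<le> x - m - n \<and> d g \<noteq> 0}"
  have fin: "finite F" "finite H"
    using left_finite_atMost assms by (auto simp: F_def H_def)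
  have "novikov_mult (novikov_mult a b) d x = novikov_mult d (novikov_mult a b) x"
    by (simp add: novikov_mult_commute)
  also have "\<dots> = (\<Sum>k\<in>H. d k * novikov_mult a b (x - k))"
  proof (rule novikov_mult_superset[OF fin(2)])
    fix k assume k: "d k \<noteq> 0" "novikov_mult a b (x - k) \<noteq> 0"
    from k(2) obtain g where g: "a g \<noteq> 0" "b (x - k - g) \<noteq> 0" by (rule novikov_mult_nonzeroE)
    have "m \<le> g" "n \<le> x - k - g" using m n g by auto
    then show "k \<in> H" using k by (auto simp: H_def)
  qed
  also have "\<dots> = (\<Sum>k\<in>H. d k * (\<Sum>g\<in>F. a g * b (x - k - g)))"
  proof (rule sum.cong[OF refl])
    fix k assume k: "k \<in> H"
    have "novikov_mult a b (x - k) = (\<Sum>g\<in>F. a g * b (x - k - g))"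
    proof (rule novikov_mult_superset[OF fin(1)])
      fix g assume g: "a g \<noteq> 0" "b (x - k - g) \<noteq> 0"
      have "n \<le> x - k - g" "p \<le> k" using n p g k by (auto simp: H_def)
      then show "g \<in> F" using g by (auto simp: F_def)
    qed
    then show "d k * novikov_mult a b (x - k) = d k * (\<Sum>g\<in>F. a g * b (x - k - g))" by simp
  qed
  also have "\<dots> = (\<Sum>k\<in>H. \<Sum>g\<in>F. a g * (d k * b (x - g - k)))"
    by (simp add: sum_distrib_left algebra_simps)
  also have "\<dots> = (\<Sum>g\<in>F. \<Sum>k\<in>H. a g * (d k * b (x - g - k)))"
    by (rule sum.swap)
  also have "\<dots> = (\<Sum>g\<in>F. a g * novikov_mult d b (x - g))"
  proof (rule sum.cong[OF refl])
    fix g assume g: "g \<in> F"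
    have "novikov_mult d b (x - g) = (\<Sum>k\<in>H. d k * b (x - g - k))"
    proof (rule novikov_mult_superset[OF fin(2)])
      fix k assume k: "d k \<noteq> 0" "b (x - g - k) \<noteq> 0"
      have "n \<le> x - g - k" "m \<le> g" using n m g k by (auto simp: F_def)
      then show "k \<in> H" using k by (auto simp: H_def)
    qed
    then show "(\<Sum>k\<in>H. a g * (d k * b (x - g - k))) = a g * novikov_mult d b (x - g)"
      by (simp add: sum_distrib_left)
  qed
  also have "\<dots> = novikov_mult a (novikov_mult d b) x"
  proof (rule novikov_mult_superset[OF fin(1), symmetric])
    fix g assume g: "a g \<noteq> 0" "novikov_mult d b (x - g) \<noteq> 0"
    from g(2) obtain k where k: "d k \<noteq> 0" "b (x - g - k) \<noteq> 0" by (rule novikov_mult_nonzeroE)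
    have "p \<le> k" "n \<le> x - g - k" using p n k by auto
    then show "g \<in> F" using g by (auto simp: F_def)
  qed
  finally show "novikov_mult (novikov_mult a b) d x = novikov_mult a (novikov_mult b d) x"
    by (simp add: novikov_mult_commute[of b d])
qed

lemma carrier_novikov:
  "a \<in> carrier (novikov \<Gamma>) \<longleftrightarrow> left_finite a \<and> (\<forall>g. a g \<noteq> 0 \<longrightarrow> g \<in> \<Gamma>)"
  by (auto simp: novikov_def left_finite_def)

lemma novikov_sel:
  "mult (novikov \<Gamma>) = novikov_mult" "one (novikov \<Gamma>) = (\<lambda>g. if g = 0 then 1 else 0)"
  "zero (novikov \<Gamma>) = (\<lambda>g. 0)" "add (novikov \<Gamma>) = (\<lambda>a b g. a g + b g)"
  by (simp_all add: novikov_def)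

lemma left_finite_single: "left_finite (\<lambda>g. if g = m then c else 0)"
  unfolding left_finite_def by (auto intro: finite_subset[of _ "{m}"])

lemma left_finite_add:
  assumes "left_finite a" "left_finite b"
  shows "left_finite (\<lambda>g. a g + b g)"
  unfolding left_finite_def
proof
  fix C
  have "{g. g < C \<and> a g + b g \<noteq> 0} \<subseteq> {g. g < C \<and> a g \<noteq> 0} \<union> {g. g < C \<and> b g \<noteq> 0}" by auto
  then show "finite {g. g < C \<and> a g + b g \<noteq> 0}"
    using assms unfolding left_finite_def by (meson finite_Un finite_subset)
qed

lemma novikov_mult_single:
  "novikov_mult (\<lambda>g. if g = m then c else 0) b x = c * b (x - m)"
  by (subst novikov_mult_superset[of "{m}"]) (auto split: if_splits)

lemma novikov_mult_closed:
  assumes "real_subgroup \<Gamma>" "a \<in> carrier (novikov \<Gamma>)" "b \<in> carrier (novikov \<Gamma>)"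
  shows "novikov_mult a b \<in> carrier (novikov \<Gamma>)"
  unfolding carrier_novikov
proof (intro conjI allI impI)
  show "left_finite (novikov_mult a b)"
    using assms left_finite_novikov_mult by (auto simp: carrier_novikov)
  fix c assume "novikov_mult a b c \<noteq> 0"
  then obtain g where "a g \<noteq> 0" "b (c - g) \<noteq> 0" by (rule novikov_mult_nonzeroE)
  then have "g \<in> \<Gamma>" "c - g \<in> \<Gamma>" using assms by (auto simp: carrier_novikov)
  then have "g + (c - g) \<in> \<Gamma>" using assms(1) unfolding real_subgroup_def by blast
  then show "c \<in> \<Gamma>" by simp
qed

lemma cring_novikov:
  assumes "real_subgroup \<Gamma>"
  shows "cring (novikov \<Gamma> :: (real \<Rightarrow> 'k::field) ring)"
proof (rule cringI)
  show "abelian_group (novikov \<Gamma> :: (real \<Rightarrow> 'k) ring)"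
  proof (rule abelian_groupI)
    fix a :: "real \<Rightarrow> 'k" assume a: "a \<in> carrier (novikov \<Gamma>)"
    show "\<exists>b\<in>carrier (novikov \<Gamma>). b \<oplus>\<^bsub>novikov \<Gamma>\<^esub> a = \<zero>\<^bsub>novikov \<Gamma>\<^esub>"
      by (rule bexI[of _ "\<lambda>g. - a g"]) (use a in \<open>auto simp: novikov_def\<close>)
    fix b :: "real \<Rightarrow> 'k" assume b: "b \<in> carrier (novikov \<Gamma>)"
    have "left_finite (\<lambda>g. a g + b g)"
      using a b left_finite_add by (auto simp: carrier_novikov)
    then show "a \<oplus>\<^bsub>novikov \<Gamma>\<^esub> b \<in> carrier (novikov \<Gamma>)"
      using a b unfolding carrier_novikov novikov_sel by (metis add.right_neutral add_0)
  qed (auto simp: novikov_def add_ac)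
  show "comm_monoid (novikov \<Gamma> :: (real \<Rightarrow> 'k) ring)"
  proof (rule comm_monoidI)
    show "\<one>\<^bsub>novikov \<Gamma>\<^esub> \<in> carrier (novikov \<Gamma> :: (real \<Rightarrow> 'k) ring)"
      using assms by (auto simp: carrier_novikov novikov_sel left_finite_single real_subgroup_def)
    fix a b :: "real \<Rightarrow> 'k"
    show "a \<otimes>\<^bsub>novikov \<Gamma>\<^esub> b = b \<otimes>\<^bsub>novikov \<Gamma>\<^esub> a"
      by (simp add: novikov_sel novikov_mult_commute)
    show "\<one>\<^bsub>novikov \<Gamma>\<^esub> \<otimes>\<^bsub>novikov \<Gamma>\<^esub> a = a"
      by (simp add: novikov_sel fun_eq_iff novikov_mult_single)
  next
    fix a b :: "real \<Rightarrow> 'k"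
    assume a: "a \<in> carrier (novikov \<Gamma>)" and b: "b \<in> carrier (novikov \<Gamma>)"
    then show "a \<otimes>\<^bsub>novikov \<Gamma>\<^esub> b \<in> carrier (novikov \<Gamma>)"
      unfolding novikov_sel by (rule novikov_mult_closed[OF assms])
    fix d :: "real \<Rightarrow> 'k"
    assume "d \<in> carrier (novikov \<Gamma>)"
    with a b show "a \<otimes>\<^bsub>novikov \<Gamma>\<^esub> b \<otimes>\<^bsub>novikov \<Gamma>\<^esub> d =
        a \<otimes>\<^bsub>novikov \<Gamma>\<^esub> (b \<otimes>\<^bsub>novikov \<Gamma>\<^esub> d)"
      unfolding novikov_sel carrier_novikov by (intro novikov_mult_assoc) auto
  qed
  fix a b d :: "real \<Rightarrow> 'k"
  assume "a \<in> carrier (novikov \<Gamma>)" "b \<in> carrier (novikov \<Gamma>)" "d \<in> carrier (novikov \<Gamma>)"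
  then show "(a \<oplus>\<^bsub>novikov \<Gamma>\<^esub> b) \<otimes>\<^bsub>novikov \<Gamma>\<^esub> d =
      a \<otimes>\<^bsub>novikov \<Gamma>\<^esub> d \<oplus>\<^bsub>novikov \<Gamma>\<^esub> b \<otimes>\<^bsub>novikov \<Gamma>\<^esub> d"
    by (simp add: novikov_sel carrier_novikov fun_eq_iff novikov_mult_distrib_right)
qed

text \<open>If \<open>u\<close> has positive valuation, then \<open>1 - u\<close> is inverted by the geometric series; its partial
  sums stabilise in every degree.\<close>

lemma novikov_geometric:
  fixes u :: "real \<Rightarrow> 'k::field"
  assumes \<Gamma>: "real_subgroup \<Gamma>" and u: "u \<in> carrier (novikov \<Gamma>)"
    and pos: "0 < \<delta>" "\<And>g. u g \<noteq> 0 \<Longrightarrow> \<delta> \<le> g"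
  obtains b where "b \<in> carrier (novikov \<Gamma>)"
    "b = (\<lambda>g. (if g = 0 then 1 else 0) + novikov_mult u b g)"
proof -
  interpret cring "novikov \<Gamma> :: (real \<Rightarrow> 'k) ring" using cring_novikov[OF \<Gamma>] .
  define B where "B = rec_nat (\<lambda>g. 0) (\<lambda>n c. (\<lambda>g. (if g = 0 then 1 else 0) + novikov_mult u c g))"
  have B0: "B 0 = (\<lambda>g. 0)" and BS: "B (Suc n) = (\<lambda>g. (if g = 0 then 1 else 0) + novikov_mult u (B n) g)" for n
    by (simp_all add: B_def)
  have carr: "B n \<in> carrier (novikov \<Gamma>)" for n
  proof (induction n)
    case 0
    then show ?case using zero_closed by (simp add: B0 novikov_sel)
  next
    case (Suc n)
    have "\<one>\<^bsub>novikov \<Gamma>\<^esub> \<oplus>\<^bsub>novikov \<Gamma>\<^esub> u \<otimes>\<^bsub>novikov \<Gamma>\<^esub> B n \<in> carrier (novikov \<Gamma>)"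
      using Suc u by simp
    then show ?case by (simp add: BS novikov_sel)
  qed
  have local: "novikov_mult u c x = novikov_mult u d x"
    if "\<And>y. y \<le> x - \<delta> \<Longrightarrow> c y = d y" for c d x
    unfolding novikov_mult_def
  proof (rule sum.cong)
    have eq: "c (x - g) = d (x - g)" if "u g \<noteq> 0" for g
      using pos(2)[OF that] by (intro \<open>\<And>y. y \<le> x - \<delta> \<Longrightarrow> c y = d y\<close>) simp
    then show "{g. u g \<noteq> 0 \<and> c (x - g) \<noteq> 0} = {g. u g \<noteq> 0 \<and> d (x - g) \<noteq> 0}" by auto
    show "u g * c (x - g) = u g * d (x - g)" if "g \<in> {g. u g \<noteq> 0 \<and> d (x - g) \<noteq> 0}" for g
      using eq that by auto
  qed
  have next_eq: "B (Suc n) x = B n x" if "x < real n * \<delta>" for n x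
    using that
  proof (induction n arbitrary: x)
    case 0
    have "novikov_mult u (B 0) x = 0" by (simp add: B0 novikov_mult_def)
    then show ?case using 0 by (simp add: BS B0)
  next
    case (Suc n)
    have "novikov_mult u (B (Suc n)) x = novikov_mult u (B n) x"
      by (rule local, rule Suc.IH) (use Suc.prems pos in \<open>auto simp: algebra_simps\<close>)
    then show ?case unfolding BS[of "Suc n"] BS[of n] by simp
  qed
  have stable: "B n x = B m x" if "x < real m * \<delta>" "m \<le> n" for m n x
    using that(2)
  proof (induction n rule: dec_induct)
    case (step n)
    have "real m * \<delta> \<le> real n * \<delta>" using step pos by simp
    then show ?case using step that(1) next_eq[of x n] by simp
  qed simp
  define N where "N x = (LEAST n. x < real n * \<delta>)" for x
  have ex: "\<exists>n. x < real n * \<delta>" for x using reals_Archimedean3[OF pos(1)] by blast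
  have N: "x < real (N x) * \<delta>" for x unfolding N_def by (rule LeastI_ex[OF ex])
  define b where "b x = B (N x) x" for x
  have b_eq: "b x = B n x" if "x < real n * \<delta>" for n x
  proof -
    have "N x \<le> n" unfolding N_def by (rule Least_le) (rule that)
    then show ?thesis unfolding b_def using stable[OF N] by metis
  qed
  show ?thesis
  proof (rule that[of b])
    show "b \<in> carrier (novikov \<Gamma>)"
      unfolding carrier_novikov left_finite_def
    proof (intro conjI allI impI)
      fix C
      obtain n where n: "C < real n * \<delta>" using ex by blast
      have "{g. g < C \<and> b g \<noteq> 0} \<subseteq> {g. g < C \<and> B n g \<noteq> 0}"
        using b_eq[of _ n] n by fastforce
      then show "finite {g. g < C \<and> b g \<noteq> 0}"
        using carr[of n] finite_subset by (auto simp: carrier_novikov left_finite_def)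
    next
      fix g assume "b g \<noteq> 0"
      then show "g \<in> \<Gamma>" using carr by (auto simp: b_def carrier_novikov)
    qed
    show "b = (\<lambda>g. (if g = 0 then 1 else 0) + novikov_mult u b g)"
    proof
      fix x
      have lt: "x < real (Suc (N x)) * \<delta>" using N[of x] pos by (simp add: algebra_simps)
      have "novikov_mult u b x = novikov_mult u (B (N x)) x"
        by (rule local, rule b_eq) (use N[of x] pos in linarith)
      then show "b x = (if x = 0 then 1 else 0) + novikov_mult u b x"
        using b_eq[OF lt] by (simp add: BS)
    qed
  qed
qed

theorem field_novikov:
  assumes \<Gamma>: "real_subgroup \<Gamma>"
  shows "field (novikov \<Gamma> :: (real \<Rightarrow> 'k::field) ring)"
proof -
  let ?L = "novikov \<Gamma> :: (real \<Rightarrow> 'k) ring"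
  interpret cring ?L using cring_novikov[OF \<Gamma>] .
  have one_nz: "\<one>\<^bsub>?L\<^esub> \<noteq> \<zero>\<^bsub>?L\<^esub>" by (auto simp: novikov_sel fun_eq_iff)
  have inverse: "\<exists>b\<in>carrier ?L. a \<otimes>\<^bsub>?L\<^esub> b = \<one>\<^bsub>?L\<^esub>"
    if a: "a \<in> carrier ?L" "a \<noteq> \<zero>\<^bsub>?L\<^esub>" for a
  proof -
    obtain h where h: "a h \<noteq> 0" using a(2) by (auto simp: novikov_sel)
    have lf: "left_finite a" using a by (simp add: carrier_novikov)
    define m where "m = Min {g. g \<le> h \<and> a g \<noteq> 0}"
    have fin: "finite {g. g \<le> h \<and> a g \<noteq> 0}" by (rule left_finite_atMost[OF lf])
    have "m \<in> {g. g \<le> h \<and> a g \<noteq> 0}" unfolding m_def using fin h by (intro Min_in) auto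
    then have m: "m \<le> h" "a m \<noteq> 0" by auto
    have m_le: "m \<le> g" if "a g \<noteq> 0" for g
    proof (cases "g \<le> h")
      case True
      then show ?thesis unfolding m_def using fin that by (intro Min_le) auto
    qed (use m in linarith)
    define S where "S = insert (m + 1) {g. g \<le> m + 1 \<and> g \<noteq> m \<and> a g \<noteq> 0}"
    have finS: "finite S"
      unfolding S_def using left_finite_atMost[OF lf, of "m + 1"] by (auto elim: rev_finite_subset)
    define \<delta> where "\<delta> = Min S - m"
    have "Min S \<in> S" using finS by (intro Min_in) (auto simp: S_def)
    then have \<delta>: "0 < \<delta>" using m_le by (force simp: S_def \<delta>_def)
    have gap: "m + \<delta> \<le> g" if "a g \<noteq> 0" "g \<noteq> m" for g
    proof (cases "g \<le> m + 1")
      case True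
      then have "Min S \<le> g" using finS that by (intro Min_le) (auto simp: S_def)
      then show ?thesis by (simp add: \<delta>_def)
    next
      case False
      have "Min S \<le> m + 1" using finS by (intro Min_le) (auto simp: S_def)
      then show ?thesis using False by (simp add: \<delta>_def)
    qed
    define e :: "real \<Rightarrow> 'k" where "e = (\<lambda>g. if g = - m then inverse (a m) else 0)"
    have "m \<in> \<Gamma>" using a m by (auto simp: carrier_novikov)
    then have e: "e \<in> carrier ?L"
      using \<Gamma> left_finite_single by (auto simp: carrier_novikov e_def real_subgroup_def)
    define u where "u = \<one>\<^bsub>?L\<^esub> \<ominus>\<^bsub>?L\<^esub> (e \<otimes>\<^bsub>?L\<^esub> a)"
    have u: "u \<in> carrier ?L" using e a by (simp add: u_def)
    have split: "u \<oplus>\<^bsub>?L\<^esub> (e \<otimes>\<^bsub>?L\<^esub> a) = \<one>\<^bsub>?L\<^esub>"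
      using e a by (simp add: u_def minus_eq a_assoc l_neg)
    have "u g + inverse (a m) * a (g + m) = (if g = 0 then 1 else 0)" for g
      using fun_cong[OF split, of g] by (simp add: novikov_sel e_def novikov_mult_single)
    then have u_eq: "u g = (if g = 0 then 1 else 0) - inverse (a m) * a (g + m)" for g
      by (metis add_diff_cancel_right')
    have "\<delta> \<le> g" if "u g \<noteq> 0" for g
    proof (cases "g = 0")
      case True
      then show ?thesis using that m by (simp add: u_eq)
    next
      case False
      then have "a (g + m) \<noteq> 0" using that by (auto simp: u_eq)
      then show ?thesis using gap[of "g + m"] False by simp
    qed
    with \<Gamma> u \<delta> obtain b where b: "b \<in> carrier ?L"
      and "b = (\<lambda>g. (if g = 0 then 1 else 0) + novikov_mult u b g)"
      by (rule novikov_geometric)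
    then have b_eq: "b = \<one>\<^bsub>?L\<^esub> \<oplus>\<^bsub>?L\<^esub> u \<otimes>\<^bsub>?L\<^esub> b" by (simp add: novikov_sel)
    have "u \<otimes>\<^bsub>?L\<^esub> b \<oplus>\<^bsub>?L\<^esub> (e \<otimes>\<^bsub>?L\<^esub> a) \<otimes>\<^bsub>?L\<^esub> b = b"
      using split u e a b by (metis l_distr l_one m_closed)
    then have "u \<otimes>\<^bsub>?L\<^esub> b \<oplus>\<^bsub>?L\<^esub> (e \<otimes>\<^bsub>?L\<^esub> a) \<otimes>\<^bsub>?L\<^esub> b = u \<otimes>\<^bsub>?L\<^esub> b \<oplus>\<^bsub>?L\<^esub> \<one>\<^bsub>?L\<^esub>"
      using b_eq a_comm u b by (metis m_closed one_closed)
    then have "(e \<otimes>\<^bsub>?L\<^esub> a) \<otimes>\<^bsub>?L\<^esub> b = \<one>\<^bsub>?L\<^esub>"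
      by (simp add: novikov_sel fun_eq_iff)
    then have "a \<otimes>\<^bsub>?L\<^esub> (e \<otimes>\<^bsub>?L\<^esub> b) = \<one>\<^bsub>?L\<^esub>"
      using e a b by (metis m_assoc m_comm)
    then show ?thesis using e b by blast
  qed
  show ?thesis
  proof (rule cring_fieldI)
    show "Units ?L = carrier ?L - {\<zero>\<^bsub>?L\<^esub>}"
    proof
      show "Units ?L \<subseteq> carrier ?L - {\<zero>\<^bsub>?L\<^esub>}"
        using one_nz by (auto simp: Units_def)
      show "carrier ?L - {\<zero>\<^bsub>?L\<^esub>} \<subseteq> Units ?L"
      proof
        fix a assume "a \<in> carrier ?L - {\<zero>\<^bsub>?L\<^esub>}"
        then obtain b where "b \<in> carrier ?L" "a \<otimes>\<^bsub>?L\<^esub> b = \<one>\<^bsub>?L\<^esub>" "a \<in> carrier ?L"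
          using inverse by blast
        then show "a \<in> Units ?L" unfolding Units_def using m_comm by fastforce
      qed
    qed
  qed
qed

section \<open>Orthogonalizable spaces\<close>

definition nonarch_normed_space ::
  "real set \<Rightarrow> (real \<Rightarrow> 'k::field, 'c) module \<Rightarrow> ('c \<Rightarrow> ereal) \<Rightarrow> bool" where
  "nonarch_normed_space \<Gamma> V l \<longleftrightarrow>
     vectorspace (novikov \<Gamma>) V \<and>
     (\<forall>x\<in>carrier V. l x \<noteq> \<infinity>) \<and>
     (\<forall>x\<in>carrier V. l x = -\<infinity> \<longleftrightarrow> x = \<zero>\<^bsub>V\<^esub>) \<and>
     (\<forall>a\<in>carrier (novikov \<Gamma>). \<forall>x\<in>carrier V. l (a \<odot>\<^bsub>V\<^esub> x) = l x - nu a) \<and>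
     (\<forall>x\<in>carrier V. \<forall>y\<in>carrier V. l (x \<oplus>\<^bsub>V\<^esub> y) \<le> max (l x) (l y))"

text \<open>The supremum over an empty index set is \<open>-\<infinity>\<close>, the value of \<open>\<ell>\<close> at the empty sum, so the
  empty collection is orthogonal; over a non-empty index set the supremum is a maximum.\<close>

definition orthogonal_list ::
  "real set \<Rightarrow> (real \<Rightarrow> 'k::field, 'c) module \<Rightarrow> ('c \<Rightarrow> ereal) \<Rightarrow> 'c list \<Rightarrow> bool" where
  "orthogonal_list \<Gamma> V l ws \<longleftrightarrow>
     set ws \<subseteq> carrier V \<and>
     (\<forall>a. (\<forall>i<length ws. a i \<in> carrier (novikov \<Gamma>)) \<longrightarrow>
        l (\<Oplus>\<^bsub>V\<^esub>i\<in>{..<length ws}. a i \<odot>\<^bsub>V\<^esub> ws ! i)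
          = (SUP i\<in>{..<length ws}. l (a i \<odot>\<^bsub>V\<^esub> ws ! i)))"

definition orthogonal_basis ::
  "real set \<Rightarrow> (real \<Rightarrow> 'k::field, 'c) module \<Rightarrow> ('c \<Rightarrow> ereal) \<Rightarrow> 'c list \<Rightarrow> bool" where
  "orthogonal_basis \<Gamma> V l ws \<longleftrightarrow>
     distinct ws \<and> vectorspace.basis (novikov \<Gamma>) V (set ws) \<and> orthogonal_list \<Gamma> V l ws"

definition orthogonalizable ::
  "real set \<Rightarrow> (real \<Rightarrow> 'k::field, 'c) module \<Rightarrow> ('c \<Rightarrow> ereal) \<Rightarrow> bool" where
  "orthogonalizable \<Gamma> V l \<longleftrightarrow>
     nonarch_normed_space \<Gamma> V l \<and> vectorspace.fin_dim (novikov \<Gamma>) V \<and>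
     (\<exists>ws. orthogonal_basis \<Gamma> V l ws)"

section \<open>Singular value decompositions\<close>

definition linear_rank ::
  "real set \<Rightarrow> (real \<Rightarrow> 'k::field, 'c) module \<Rightarrow> (real \<Rightarrow> 'k, 'd) module \<Rightarrow> ('c \<Rightarrow> 'd) \<Rightarrow> nat" where
  "linear_rank \<Gamma> C D A = vectorspace.dim (novikov \<Gamma>) (D\<lparr>carrier := mod_hom.im C A\<rparr>)"

definition is_svd ::
  "real set \<Rightarrow> (real \<Rightarrow> 'k::field, 'c) module \<Rightarrow> ('c \<Rightarrow> ereal) \<Rightarrow>
   (real \<Rightarrow> 'k, 'd) module \<Rightarrow> ('d \<Rightarrow> ereal) \<Rightarrow> ('c \<Rightarrow> 'd) \<Rightarrow> 'c list \<Rightarrow> 'd list \<Rightarrow> bool" where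
  "is_svd \<Gamma> C lC D lD A ys xs \<longleftrightarrow>
     (let r = linear_rank \<Gamma> C D A in
        orthogonal_basis \<Gamma> C lC ys \<and>
        orthogonal_basis \<Gamma> D lD xs \<and>
        orthogonal_basis \<Gamma> (C\<lparr>carrier := mod_hom.ker C D A\<rparr>) lC (drop r ys) \<and>
        orthogonal_basis \<Gamma> (D\<lparr>carrier := mod_hom.im C A\<rparr>) lD (take r xs) \<and>
        (\<forall>i<r. A (ys ! i) = xs ! i) \<and>
        (\<forall>i j. i \<le> j \<and> j < r \<longrightarrow> lC (ys ! j) - lD (xs ! j) \<le> lC (ys ! i) - lD (xs ! i)))"

section \<open>Floer-type complexes and verbose barcodes\<close>

text \<open>A graded space \<open>\<Oplus>\<^sub>k C\<^sub>k\<close> is given by its family of homogeneous parts; only the restrictions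
  of \<open>\<partial>\<close> and \<open>\<ell>\<close> to the homogeneous parts matter. \<open>bdry X k\<close> is \<open>\<partial>\<^sub>k : C\<^sub>k \<rightarrow> C\<^sub>k\<^sub>-\<^sub>1\<close>.\<close>

record ('k, 'c) filtered_complex =
  chains :: "int \<Rightarrow> (real \<Rightarrow> 'k, 'c) module"
  bdry :: "int \<Rightarrow> 'c \<Rightarrow> 'c"
  filt :: "int \<Rightarrow> 'c \<Rightarrow> ereal"

definition floer_type_complex ::
  "real set \<Rightarrow> ('k::field, 'c) filtered_complex \<Rightarrow> bool" where
  "floer_type_complex \<Gamma> X \<longleftrightarrow>
     (\<forall>k. orthogonalizable \<Gamma> (chains X k) (filt X k)) \<and>
     (\<forall>k. linear_map (novikov \<Gamma>) (chains X k) (chains X (k - 1)) (bdry X k)) \<and>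
     (\<forall>k. \<forall>x\<in>carrier (chains X k). bdry X (k - 1) (bdry X k x) = \<zero>\<^bsub>chains X (k - 2)\<^esub>) \<and>
     (\<forall>k. \<forall>x\<in>carrier (chains X k). filt X (k - 1) (bdry X k x) \<le> filt X k x)"

definition cycles :: "('k::field, 'c) filtered_complex \<Rightarrow> int \<Rightarrow> (real \<Rightarrow> 'k, 'c) module" where
  "cycles X k = (chains X k)
     \<lparr>carrier := mod_hom.ker (chains X k) (chains X (k - 1)) (bdry X k)\<rparr>"

text \<open>An element of \<open>(\<real>/\<Gamma>) \<times> [0,\<infinity>]\<close> is a pair of a coset of \<open>\<Gamma>\<close> and an extended real.\<close>

definition real_coset :: "real set \<Rightarrow> real \<Rightarrow> real set" where
  "real_coset \<Gamma> a = (\<lambda>g. a + g) ` \<Gamma>"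

definition svd_barcode ::
  "real set \<Rightarrow> ('c \<Rightarrow> ereal) \<Rightarrow> ('d \<Rightarrow> ereal) \<Rightarrow> nat \<Rightarrow> 'c list \<Rightarrow> 'd list \<Rightarrow>
   (real set \<times> ereal) multiset" where
  "svd_barcode \<Gamma> lC lD r ys xs =
     image_mset
       (\<lambda>i. (real_coset \<Gamma> (real_of_ereal (lD (xs ! i))),
             if i < r then lC (ys ! i) - lD (xs ! i) else \<infinity>))
       (mset_set {..<length xs})"

text \<open>A description is used because the multiset is the same for all singular value
  decompositions.\<close>

definition verbose_barcode ::
  "real set \<Rightarrow> ('k::field, 'c) filtered_complex \<Rightarrow> int \<Rightarrow> (real set \<times> ereal) multiset" where
  "verbose_barcode \<Gamma> X k =
     (THE B. \<exists>ys xs.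
        is_svd \<Gamma> (chains X (k + 1)) (filt X (k + 1)) (cycles X k) (filt X k) (bdry X (k + 1)) ys xs \<and>
        B = svd_barcode \<Gamma> (filt X (k + 1)) (filt X k)
              (linear_rank \<Gamma> (chains X (k + 1)) (cycles X k) (bdry X (k + 1))) ys xs)"

section \<open>The dual complex\<close>

definition regular_module :: "('a, 'm) ring_scheme \<Rightarrow> ('a, 'a) module" where
  "regular_module R =
    \<lparr>carrier = carrier R, mult = mult R, one = one R, zero = zero R, add = add R, smult = mult R\<rparr>"

text \<open>Functionals are made undefined outside the carrier, so that equality of functionals is
  equality on the space.\<close>

definition dual_space ::
  "real set \<Rightarrow> (real \<Rightarrow> 'k::field, 'c) module \<Rightarrow> (real \<Rightarrow> 'k, 'c \<Rightarrow> real \<Rightarrow> 'k) module" where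
  "dual_space \<Gamma> V = (ring.func_space (novikov \<Gamma>) (carrier V))
     \<lparr>carrier := LinearCombinations.module_hom (novikov \<Gamma>) V (regular_module (novikov \<Gamma>)) \<inter> extensional (carrier V)\<rparr>"

definition dual_filt ::
  "(real \<Rightarrow> 'k::field, 'c) module \<Rightarrow> ('c \<Rightarrow> ereal) \<Rightarrow> ('c \<Rightarrow> real \<Rightarrow> 'k) \<Rightarrow> ereal" where
  "dual_filt V l \<phi> = (SUP x\<in>carrier V - {\<zero>\<^bsub>V\<^esub>}. - l x - nu (\<phi> x))"

definition dual_complex ::
  "real set \<Rightarrow> ('k::field, 'c) filtered_complex \<Rightarrow> ('k, 'c \<Rightarrow> real \<Rightarrow> 'k) filtered_complex" where
  "dual_complex \<Gamma> X =
    \<lparr>chains = (\<lambda>k. dual_space \<Gamma> (chains X (- k))),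
     bdry = (\<lambda>k \<phi>. \<lambda>x\<in>carrier (chains X (- k + 1)). \<phi> (bdry X (- k + 1) x)),
     filt = (\<lambda>k. dual_filt (chains X (- k)) (filt X (- k)))\<rparr>"

text \<open>The classes \<open>[-a]\<close> and \<open>[-a-L]\<close> are obtained by applying \<open>a \<mapsto> -a\<close> and \<open>a \<mapsto> -a-L\<close> to
  every element of the coset \<open>[a]\<close>; since \<open>\<Gamma> = -\<Gamma>\<close>, the image is again a coset.\<close>

definition dual_infinite_bar :: "real set \<times> ereal \<Rightarrow> real set \<times> ereal" where
  "dual_infinite_bar = (\<lambda>(c, L). ((\<lambda>a. - a) ` c, \<infinity>))"

definition dual_finite_bar :: "real set \<times> ereal \<Rightarrow> real set \<times> ereal" where
  "dual_finite_bar = (\<lambda>(c, L). ((\<lambda>a. - a - real_of_ereal L) ` c, L))"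

end

theory Submission
  imports Defs
begin

text \<open>Gaussian elimination whose pivots have least filtration gap produces singular value
  decompositions, and counting leading coefficients over the coefficient field shows that their
  barcode is unique, so a barcode may be read off any of them. Write \<open>j = -k\<close> and choose
  decompositions of \<open>\<partial>\<^sub>j\<^sub>+\<^sub>1\<close>, \<open>\<partial>\<^sub>j\<close> and \<open>\<partial>\<^sub>j\<^sub>-\<^sub>1\<close>. The basis of \<open>ker \<partial>\<^sub>j\<close> from the first, together
  with the vectors of the second that \<open>\<partial>\<^sub>j\<close> does not kill, is an orthogonal basis of \<open>C\<^sub>j\<close>; likewise
  one degree lower. The dual bases are orthogonal for \<open>\<ell>\<^sup>*\<close> with negated norms, and they decompose
  the adjoint of \<open>\<partial>\<^sub>j\<close>: a pair \<open>\<partial> y = x\<close> becomes \<open>\<delta> x\<^sup>* = y\<^sup>*\<close>, and a cycle that bounds nothing becomes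
  a cocycle that bounds nothing.\<close>

subsection \<open>Linear combinations of families\<close>

text \<open>The value group \<open>\<Gamma>\<close> may be dense or trivial, so norms can be neither
  discretised nor moved freely. Hence pivots are ranked by the gap itself, and uniqueness is proved
  for one coset of \<open>\<Gamma>\<close> and one bound on the gap at a time: monomials move all
  vectors of the coset to a common level, where only leading coefficients matter.

  The codomain of a differential is a space of cycles, whose orthogonal basis has to be produced by
  a preliminary elimination one degree lower. On the dual side it is a space of cocycles: these
  vanish on boundaries, so coordinates along bounding cycles must drop out, and the decomposition of
  \<open>\<partial>\<close> one degree up is what identifies them. The decomposition one degree down
  completes a basis of cycles to a basis of the whole chain space.

  The adjoint swaps source and target while dual norms are negated. So the gap \<open>L\<close> of a
  pair survives, but the left endpoint becomes minus the norm of \<open>y\<close>, that is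
  \<open>- a - L\<close>.

  Families over arbitrary index sets replace ordered bases: one index can then name both members of
  a pair, and bases are merged by disjoint sums.\<close>

definition lin_comb :: "('a, 'c, 'm) module_scheme \<Rightarrow> ('i \<Rightarrow> 'a) \<Rightarrow> ('i \<Rightarrow> 'c) \<Rightarrow> 'i set \<Rightarrow> 'c" where
  "lin_comb V a w I = (\<Oplus>\<^bsub>V\<^esub>i\<in>I. a i \<odot>\<^bsub>V\<^esub> w i)"

context Module.module
begin

lemma lin_comb_closed [simp, intro]:
  "a \<in> I \<rightarrow> carrier R \<Longrightarrow> w \<in> I \<rightarrow> carrier M \<Longrightarrow> lin_comb M a w I \<in> carrier M"
  unfolding lin_comb_def by (rule finsum_closed) auto

lemma lin_comb_empty [simp]: "lin_comb M a w {} = \<zero>\<^bsub>M\<^esub>"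
  by (simp add: lin_comb_def)

lemma lin_comb_infinite: "infinite I \<Longrightarrow> lin_comb M a w I = \<zero>\<^bsub>M\<^esub>"
  unfolding lin_comb_def by (rule finsum_infinite)

lemma lin_comb_insert:
  assumes "finite I" "i \<notin> I" "a \<in> insert i I \<rightarrow> carrier R" "w \<in> insert i I \<rightarrow> carrier M"
  shows "lin_comb M a w (insert i I) = a i \<odot>\<^bsub>M\<^esub> w i \<oplus>\<^bsub>M\<^esub> lin_comb M a w I"
  unfolding lin_comb_def using assms by (subst finsum_insert) auto

lemma lin_comb_remove:
  assumes "finite I" "i \<in> I" "a \<in> I \<rightarrow> carrier R" "w \<in> I \<rightarrow> carrier M"
  shows "lin_comb M a w I = a i \<odot>\<^bsub>M\<^esub> w i \<oplus>\<^bsub>M\<^esub> lin_comb M a w (I - {i})"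
proof -
  have "insert i (I - {i}) = I" using assms by auto
  then show ?thesis using lin_comb_insert[of "I - {i}" i a w] assms by simp
qed

lemma lin_comb_cong:
  assumes "I = J" "\<And>i. i \<in> J \<Longrightarrow> a i = b i" "\<And>i. i \<in> J \<Longrightarrow> v i = w i"
    "b \<in> J \<rightarrow> carrier R" "w \<in> J \<rightarrow> carrier M"
  shows "lin_comb M a v I = lin_comb M b w J"
  unfolding lin_comb_def using assms by (intro finsum_cong') auto

lemma lin_comb_add:
  assumes "a \<in> I \<rightarrow> carrier R" "b \<in> I \<rightarrow> carrier R" "w \<in> I \<rightarrow> carrier M"
  shows "lin_comb M (\<lambda>i. a i \<oplus>\<^bsub>R\<^esub> b i) w I = lin_comb M a w I \<oplus>\<^bsub>M\<^esub> lin_comb M b w I"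
proof -
  have "lin_comb M (\<lambda>i. a i \<oplus>\<^bsub>R\<^esub> b i) w I =
      (\<Oplus>\<^bsub>M\<^esub>i\<in>I. a i \<odot>\<^bsub>M\<^esub> w i \<oplus>\<^bsub>M\<^esub> b i \<odot>\<^bsub>M\<^esub> w i)"
    unfolding lin_comb_def using assms by (intro finsum_cong') (auto simp: smult_l_distr Pi_iff)
  also have "\<dots> = lin_comb M a w I \<oplus>\<^bsub>M\<^esub> lin_comb M b w I"
    unfolding lin_comb_def using assms by (intro finsum_addf) auto
  finally show ?thesis .
qed

lemma lin_comb_smult:
  assumes "c \<in> carrier R" "a \<in> I \<rightarrow> carrier R" "w \<in> I \<rightarrow> carrier M"
  shows "lin_comb M (\<lambda>i. c \<otimes>\<^bsub>R\<^esub> a i) w I = c \<odot>\<^bsub>M\<^esub> lin_comb M a w I"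
proof -
  have "lin_comb M (\<lambda>i. c \<otimes>\<^bsub>R\<^esub> a i) w I = (\<Oplus>\<^bsub>M\<^esub>i\<in>I. c \<odot>\<^bsub>M\<^esub> (a i \<odot>\<^bsub>M\<^esub> w i))"
    unfolding lin_comb_def using assms by (intro finsum_cong') (auto simp: smult_assoc1 Pi_iff)
  also have "\<dots> = c \<odot>\<^bsub>M\<^esub> lin_comb M a w I"
    unfolding lin_comb_def
    using assms by (cases "finite I") (auto simp: finsum_smult_ldistr Pi_iff)
  finally show ?thesis .
qed

lemma lin_comb_mono_neutral:
  assumes "finite I" "J \<subseteq> I" "a \<in> I \<rightarrow> carrier R" "w \<in> I \<rightarrow> carrier M"
    "\<And>i. i \<in> I - J \<Longrightarrow> a i \<odot>\<^bsub>M\<^esub> w i = \<zero>\<^bsub>M\<^esub>"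
  shows "lin_comb M a w I = lin_comb M a w J"
  unfolding lin_comb_def
  by (rule M.add.finprod_mono_neutral_cong_right) (use assms in \<open>auto simp: Pi_iff subset_iff\<close>)

lemma lin_comb_zero:
  assumes "\<And>i. i \<in> I \<Longrightarrow> a i \<odot>\<^bsub>M\<^esub> w i = \<zero>\<^bsub>M\<^esub>"
  shows "lin_comb M a w I = \<zero>\<^bsub>M\<^esub>"
  unfolding lin_comb_def using assms by (rule M.add.finprod_one_eqI)

lemma lin_comb_single:
  assumes "finite I" "i \<in> I" "w \<in> I \<rightarrow> carrier M"
  shows "lin_comb M (\<lambda>j. if j = i then \<one>\<^bsub>R\<^esub> else \<zero>\<^bsub>R\<^esub>) w I = w i"
proof -
  have wi: "w i \<in> carrier M" using assms by auto
  have "lin_comb M (\<lambda>j. if j = i then \<one>\<^bsub>R\<^esub> else \<zero>\<^bsub>R\<^esub>) w I =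
      lin_comb M (\<lambda>j. if j = i then \<one>\<^bsub>R\<^esub> else \<zero>\<^bsub>R\<^esub>) w {i}"
    by (rule lin_comb_mono_neutral) (use assms in \<open>auto simp: Pi_iff\<close>)
  then show ?thesis using wi lin_comb_insert[of "{}" i "\<lambda>j. if j = i then \<one>\<^bsub>R\<^esub> else \<zero>\<^bsub>R\<^esub>" w] by simp
qed

lemma lin_comb_reindex:
  assumes "inj_on h I" "a \<in> h ` I \<rightarrow> carrier R" "w \<in> h ` I \<rightarrow> carrier M"
  shows "lin_comb M a w (h ` I) = lin_comb M (a \<circ> h) (w \<circ> h) I"
  unfolding lin_comb_def using assms by (subst M.add.finprod_reindex) auto

lemma lin_comb_Un_disjoint:
  assumes "finite I" "finite J" "I \<inter> J = {}" "a \<in> I \<union> J \<rightarrow> carrier R" "w \<in> I \<union> J \<rightarrow> carrier M"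
  shows "lin_comb M a w (I \<union> J) = lin_comb M a w I \<oplus>\<^bsub>M\<^esub> lin_comb M a w J"
  unfolding lin_comb_def using assms by (intro finsum_Un_disjoint) auto

lemma lin_comb_submodule:
  assumes N: "submodule R N M" and "a \<in> I \<rightarrow> carrier R" "w \<in> I \<rightarrow> N"
  shows "lin_comb (M\<lparr>carrier := N\<rparr>) a w I = lin_comb M a w I"
proof (cases "finite I")
  case True
  interpret N: Module.module R "M\<lparr>carrier := N\<rparr>" using submodule_is_module[OF N] .
  have sub: "N \<subseteq> carrier M" using N by (rule submodule.subset)
  show ?thesis using True assms(2,3)
  proof (induction I)
    case (insert i I)
    moreover have "lin_comb M a w (insert i I) = a i \<odot>\<^bsub>M\<^esub> w i \<oplus>\<^bsub>M\<^esub> lin_comb M a w I"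
      using insert sub by (intro lin_comb_insert) auto
    ultimately show ?case using N.lin_comb_insert[of I i a w] by simp
  qed (use N.lin_comb_empty[of a w] in simp)
next
  case False
  \<comment> \<open>Over an infinite index set both sums take the default value zero, which the
    submodule shares with \<open>M\<close>.\<close>
  then show ?thesis by (simp add: lin_comb_def finsum_def finprod_def)
qed

end

lemma (in mod_hom) hom_lin_comb:
  assumes "a \<in> I \<rightarrow> carrier R" "w \<in> I \<rightarrow> carrier M"
  shows "f (lin_comb M a w I) = lin_comb N a (\<lambda>i. f (w i)) I"
proof (cases "finite I")
  case True
  then show ?thesis using assms
  proof (induction I)
    case (insert i I)
    then have c: "a i \<odot>\<^bsub>M\<^esub> w i \<in> carrier M" "lin_comb M a w I \<in> carrier M" "w i \<in> carrier M"
      by (auto intro!: M.lin_comb_closed)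
    have "f (lin_comb M a w (insert i I)) = a i \<odot>\<^bsub>N\<^esub> f (w i) \<oplus>\<^bsub>N\<^esub> f (lin_comb M a w I)"
      using insert c by (subst M.lin_comb_insert) auto
    also have "\<dots> = lin_comb N a (\<lambda>i. f (w i)) (insert i I)"
      using insert by (subst N.lin_comb_insert) (auto simp: Pi_iff)
    finally show ?case .
  qed simp
next
  case False
  then show ?thesis by (simp add: M.lin_comb_infinite N.lin_comb_infinite)
qed

subsection \<open>The valuation\<close>

lemma nu_zero [simp]: "nu (\<lambda>g. 0) = \<infinity>"
  by (simp add: nu_def)

lemma nu_eq_infinity_iff: "nu a = \<infinity> \<longleftrightarrow> a = (\<lambda>g. 0)"
  by (simp add: nu_def)

text \<open>The reals are not well-ordered, so \<open>LEAST\<close> needs an attained minimum. It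
  exists because the support below any of its points \<open>h\<close> is finite.\<close>

lemma nu_nonzeroE:
  assumes "a \<in> carrier (novikov \<Gamma>)" "a \<noteq> (\<lambda>g. 0)"
  obtains m where "m \<in> \<Gamma>" "nu a = ereal m" "a m \<noteq> 0" "\<And>g. a g \<noteq> 0 \<Longrightarrow> m \<le> g"
proof -
  obtain h where h: "a h \<noteq> 0" using assms(2) by auto
  have lf: "left_finite a" using assms by (simp add: carrier_novikov)
  let ?S = "{g. g \<le> h \<and> a g \<noteq> 0}"
  have fin: "finite ?S" by (rule left_finite_atMost[OF lf])
  have m: "Min ?S \<in> ?S" using fin h by (intro Min_in) auto
  have le: "Min ?S \<le> g" if "a g \<noteq> 0" for g
  proof (cases "g \<le> h")
    case True
    then show ?thesis using fin that by (intro Min_le) auto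
  qed (use m in auto)
  have "(LEAST g. a g \<noteq> 0) = Min ?S"
    using m le by (intro Least_equality) auto
  then have "nu a = ereal (Min ?S)" using assms(2) by (simp add: nu_def)
  then show ?thesis using that m le assms(1) by (auto simp: carrier_novikov)
qed

lemma nu_eqI:
  assumes "a m \<noteq> 0" "\<And>g. a g \<noteq> 0 \<Longrightarrow> m \<le> g"
  shows "nu a = ereal m"
proof -
  have "(LEAST g. a g \<noteq> 0) = m" using assms by (intro Least_equality) auto
  then show ?thesis using assms(1) by (auto simp: nu_def)
qed

lemma nu_not_minf [simp]: "nu a \<noteq> -\<infinity>"
  by (simp add: nu_def)

lemma le_nuI:
  assumes "a \<in> carrier (novikov \<Gamma>)" "\<And>g. a g \<noteq> 0 \<Longrightarrow> t \<le> ereal g"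
  shows "t \<le> nu a"
proof (cases "a = (\<lambda>g. 0)")
  case False
  then obtain m where "nu a = ereal m" "a m \<noteq> 0" using nu_nonzeroE[OF assms(1)] by metis
  then show ?thesis using assms(2) by simp
qed simp

lemma nu_le:
  assumes "a \<in> carrier (novikov \<Gamma>)" "a g \<noteq> 0"
  shows "nu a \<le> ereal g"
proof -
  have "a \<noteq> (\<lambda>g. 0)" using assms(2) by auto
  then show ?thesis using nu_nonzeroE[OF assms(1)] assms(2) by (metis ereal_less_eq(3))
qed

lemma nu_add_ge:
  assumes "a \<in> carrier (novikov \<Gamma>)" "b \<in> carrier (novikov \<Gamma>)" "(\<lambda>g. a g + b g) \<in> carrier (novikov \<Gamma>)"
  shows "min (nu a) (nu b) \<le> nu (\<lambda>g. a g + b g)"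
proof (rule le_nuI[OF assms(3)])
  fix g assume "a g + b g \<noteq> 0"
  then have "a g \<noteq> 0 \<or> b g \<noteq> 0" by auto
  then show "min (nu a) (nu b) \<le> ereal g" using nu_le assms by (metis min.coboundedI1 min.coboundedI2)
qed

text \<open>In degree \<open>m + n\<close> the convolution consists of the single product of the two
  leading coefficients, which is nonzero in a field.\<close>

lemma nu_mult:
  assumes a: "a \<in> carrier (novikov \<Gamma>)" and b: "b \<in> carrier (novikov \<Gamma>)"
  shows "nu (novikov_mult a b) = nu a + nu b"
proof (cases "a = (\<lambda>g. 0) \<or> b = (\<lambda>g. 0)")
  case True
  then have "novikov_mult a b = (\<lambda>g. 0)" by (auto simp: novikov_mult_def)
  then show ?thesis using True by auto
next
  case False
  obtain m where m: "nu a = ereal m" "a m \<noteq> 0" "\<And>g. a g \<noteq> 0 \<Longrightarrow> m \<le> g"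
    using nu_nonzeroE[OF a] False by metis
  obtain n where n: "nu b = ereal n" "b n \<noteq> 0" "\<And>g. b g \<noteq> 0 \<Longrightarrow> n \<le> g"
    using nu_nonzeroE[OF b] False by metis
  have "nu (novikov_mult a b) = ereal (m + n)"
  proof (rule nu_eqI)
    have "novikov_mult a b (m + n) = (\<Sum>g\<in>{m}. a g * b (m + n - g))"
    proof (rule novikov_mult_superset)
      fix g assume "a g \<noteq> 0" "b (m + n - g) \<noteq> 0"
      then have "m \<le> g" "n \<le> m + n - g" using m n by auto
      then show "g \<in> {m}" by auto
    qed simp
    then show "novikov_mult a b (m + n) \<noteq> 0" using m n by simp
    fix g assume "novikov_mult a b g \<noteq> 0"
    then obtain h where "a h \<noteq> 0" "b (g - h) \<noteq> 0" by (rule novikov_mult_nonzeroE)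
    then show "m + n \<le> g" using m(3)[of h] n(3)[of "g - h"] by simp
  qed
  then show ?thesis using m n by simp
qed

lemma nu_single: "c \<noteq> 0 \<Longrightarrow> nu (\<lambda>g. if g = m then c else 0) = ereal m"
  by (rule nu_eqI) (auto split: if_splits)

lemma single_closed: "m \<in> \<Gamma> \<Longrightarrow> (\<lambda>g. if g = m then c else 0) \<in> carrier (novikov \<Gamma>)"
  by (auto simp: carrier_novikov left_finite_single)

lemma nu_one [simp]: "nu \<one>\<^bsub>novikov \<Gamma>\<^esub> = 0"
  using nu_single[of 1 0] by (simp add: novikov_sel zero_ereal_def)

subsection \<open>Orthogonal families\<close>

locale novikov_normed_space =
  vectorspace "novikov \<Gamma>" V for \<Gamma> :: "real set" and V :: "(real \<Rightarrow> 'k::field, 'c) module" +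
  fixes l :: "'c \<Rightarrow> ereal"
  assumes subgroup: "real_subgroup \<Gamma>"
    and normed: "nonarch_normed_space \<Gamma> V l"
begin

abbreviation \<Lambda> :: "(real \<Rightarrow> 'k) set" where "\<Lambda> \<equiv> carrier (novikov \<Gamma>)"

lemma norm_finite: "x \<in> carrier V \<Longrightarrow> l x \<noteq> \<infinity>"
  and norm_eq_minf_iff: "x \<in> carrier V \<Longrightarrow> l x = -\<infinity> \<longleftrightarrow> x = \<zero>\<^bsub>V\<^esub>"
  and norm_smult: "a \<in> \<Lambda> \<Longrightarrow> x \<in> carrier V \<Longrightarrow> l (a \<odot>\<^bsub>V\<^esub> x) = l x - nu a"
  and norm_add_le: "x \<in> carrier V \<Longrightarrow> y \<in> carrier V \<Longrightarrow> l (x \<oplus>\<^bsub>V\<^esub> y) \<le> max (l x) (l y)"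
  using normed by (auto simp: nonarch_normed_space_def)

lemma norm_zero [simp]: "l \<zero>\<^bsub>V\<^esub> = -\<infinity>"
  using norm_eq_minf_iff M.zero_closed by blast

lemma norm_realE:
  assumes "x \<in> carrier V" "x \<noteq> \<zero>\<^bsub>V\<^esub>"
  obtains r where "l x = ereal r"
  using assms norm_finite norm_eq_minf_iff by (cases "l x") auto

lemma norm_lin_comb_le:
  assumes "finite I" "a \<in> I \<rightarrow> \<Lambda>" "w \<in> I \<rightarrow> carrier V" "\<And>i. i \<in> I \<Longrightarrow> l (a i \<odot>\<^bsub>V\<^esub> w i) \<le> t"
  shows "l (lin_comb V a w I) \<le> t"
  using assms
proof (induction I)
  case (insert i I)
  then have IH: "l (lin_comb V a w I) \<le> t" by auto
  have "l (lin_comb V a w (insert i I)) \<le> max (l (a i \<odot>\<^bsub>V\<^esub> w i)) (l (lin_comb V a w I))"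
    using insert.prems insert.hyps by (subst lin_comb_insert) (auto intro!: norm_add_le)
  also have "\<dots> \<le> t" using IH insert.prems by auto
  finally show ?case .
qed simp

text \<open>The bound on \<open>t\<close> from below covers the empty sum, whose norm is
  \<open>-\<infinity>\<close>.\<close>

lemma norm_lin_comb_less:
  assumes "finite I" "a \<in> I \<rightarrow> \<Lambda>" "w \<in> I \<rightarrow> carrier V" "\<And>i. i \<in> I \<Longrightarrow> l (a i \<odot>\<^bsub>V\<^esub> w i) < t"
    and "-\<infinity> < t"
  shows "l (lin_comb V a w I) < t"
  using assms
proof (induction I)
  case (insert i I)
  then have IH: "l (lin_comb V a w I) < t" by auto
  have "l (lin_comb V a w (insert i I)) \<le> max (l (a i \<odot>\<^bsub>V\<^esub> w i)) (l (lin_comb V a w I))"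
    using insert.prems insert.hyps by (subst lin_comb_insert) (auto intro!: norm_add_le)
  also have "\<dots> < t" using IH insert.prems by auto
  finally show ?case .
qed simp

lemma zero_nov: "\<zero>\<^bsub>novikov \<Gamma>\<^esub> = (\<lambda>g. 0 :: 'k)"
  by (simp add: novikov_sel)

lemma norm_smult_mono:
  assumes "a \<in> \<Lambda>" "x \<in> carrier V" "y \<in> carrier V" "l x \<le> l y"
  shows "l (a \<odot>\<^bsub>V\<^esub> x) \<le> l (a \<odot>\<^bsub>V\<^esub> y)"
  using assms by (simp add: norm_smult ereal_minus_mono)

lemma smult_eq_zero_iff:
  assumes "a \<in> \<Lambda>" "x \<in> carrier V"
  shows "a \<odot>\<^bsub>V\<^esub> x = \<zero>\<^bsub>V\<^esub> \<longleftrightarrow> a = \<zero>\<^bsub>novikov \<Gamma>\<^esub> \<or> x = \<zero>\<^bsub>V\<^esub>"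
proof -
  have "a = \<zero>\<^bsub>novikov \<Gamma>\<^esub>" if z: "a \<odot>\<^bsub>V\<^esub> x = \<zero>\<^bsub>V\<^esub>" and nz: "x \<noteq> \<zero>\<^bsub>V\<^esub>"
  proof -
    obtain r where r: "l x = ereal r" using norm_realE[OF assms(2) nz] .
    have "l x - nu a = -\<infinity>" using z norm_smult[OF assms] by simp
    then have "nu a = \<infinity>" using r by (cases "nu a") auto
    then show ?thesis by (simp add: nu_eq_infinity_iff zero_nov)
  qed
  then show ?thesis using assms by auto
qed

text \<open>The square of \<open>-1\<close> is \<open>1\<close>, so twice its valuation is
  zero.\<close>

lemma norm_neg: "x \<in> carrier V \<Longrightarrow> l (\<ominus>\<^bsub>V\<^esub> x) = l x"
proof -
  assume x: "x \<in> carrier V"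
  have "nu (\<ominus>\<^bsub>novikov \<Gamma>\<^esub> \<one>\<^bsub>novikov \<Gamma>\<^esub> :: real \<Rightarrow> 'k) = 0"
  proof -
    let ?m = "\<ominus>\<^bsub>novikov \<Gamma>\<^esub> \<one>\<^bsub>novikov \<Gamma>\<^esub> :: real \<Rightarrow> 'k"
    have "?m \<otimes>\<^bsub>novikov \<Gamma>\<^esub> ?m = \<one>\<^bsub>novikov \<Gamma>\<^esub>" using R.l_minus R.r_minus by auto
    moreover have "nu (novikov_mult ?m ?m) = nu ?m + nu ?m" by (rule nu_mult[where \<Gamma>=\<Gamma>]) auto
    ultimately have "nu ?m + nu ?m = 0" by (simp add: novikov_sel(1))
    then show ?thesis by (cases "nu ?m") auto
  qed
  then have "l ((\<ominus>\<^bsub>novikov \<Gamma>\<^esub> \<one>\<^bsub>novikov \<Gamma>\<^esub>) \<odot>\<^bsub>V\<^esub> x) = l x"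
    using x norm_smult by (simp add: minus_ereal_def)
  then show ?thesis using x by (simp add: smult_minus_1)
qed

lemma nov_inverse:
  assumes "a \<in> \<Lambda>" "a \<noteq> \<zero>\<^bsub>novikov \<Gamma>\<^esub>"
  obtains b where "b \<in> \<Lambda>" "b \<otimes>\<^bsub>novikov \<Gamma>\<^esub> a = \<one>\<^bsub>novikov \<Gamma>\<^esub>"
  using assms field_Units by (metis R.Units_l_inv_ex DiffI insertE empty_iff)

end

text \<open>Only one half of the orthogonality equation is recorded, the other half being the
  ultrametric inequality. Linear independence is implicit: with nonzero vectors, the recorded
  inequality forces all coefficients of a vanishing combination to be zero.\<close>

definition orth_basis ::
  "real set \<Rightarrow> (real \<Rightarrow> 'k::field, 'c) module \<Rightarrow> ('c \<Rightarrow> ereal) \<Rightarrow> 'i set \<Rightarrow> ('i \<Rightarrow> 'c) \<Rightarrow> bool" where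
  "orth_basis \<Gamma> V l I w \<longleftrightarrow> finite I \<and> w \<in> I \<rightarrow> carrier V \<and> (\<forall>i\<in>I. w i \<noteq> \<zero>\<^bsub>V\<^esub>) \<and>
     (\<forall>a\<in>I \<rightarrow> carrier (novikov \<Gamma>). \<forall>i\<in>I. l (a i \<odot>\<^bsub>V\<^esub> w i) \<le> l (lin_comb V a w I)) \<and>
     (\<forall>v\<in>carrier V. \<exists>a\<in>I \<rightarrow> carrier (novikov \<Gamma>). v = lin_comb V a w I)"

lemma (in Module.module) lin_comb_pair:
  assumes "finite I" "j \<in> I" "k \<in> I" "j \<noteq> k" "p \<in> carrier R" "q \<in> carrier R" "w \<in> I \<rightarrow> carrier M"
  shows "lin_comb M (\<lambda>i. if i = k then p else if i = j then q else \<zero>\<^bsub>R\<^esub>) w I =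
    p \<odot>\<^bsub>M\<^esub> w k \<oplus>\<^bsub>M\<^esub> q \<odot>\<^bsub>M\<^esub> w j"
proof -
  let ?a = "\<lambda>i. if i = k then p else if i = j then q else \<zero>\<^bsub>R\<^esub>"
  have c: "w j \<in> carrier M" "w k \<in> carrier M" using assms by auto
  have "lin_comb M ?a w I = lin_comb M ?a w {k, j}"
    by (rule lin_comb_mono_neutral) (use assms in \<open>auto simp: Pi_iff\<close>)
  also have "\<dots> = p \<odot>\<^bsub>M\<^esub> w k \<oplus>\<^bsub>M\<^esub> q \<odot>\<^bsub>M\<^esub> w j"
    using assms c lin_comb_insert[of "{j}" k ?a w] lin_comb_insert[of "{}" j ?a w] by simp
  finally show ?thesis .
qed

context novikov_normed_space
begin

lemma orth_basis_finite: "orth_basis \<Gamma> V l I w \<Longrightarrow> finite I"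
  and orth_basis_closed: "orth_basis \<Gamma> V l I w \<Longrightarrow> w \<in> I \<rightarrow> carrier V"
  and orth_basis_nonzero: "orth_basis \<Gamma> V l I w \<Longrightarrow> i \<in> I \<Longrightarrow> w i \<noteq> \<zero>\<^bsub>V\<^esub>"
  and orth_basis_le: "orth_basis \<Gamma> V l I w \<Longrightarrow> a \<in> I \<rightarrow> \<Lambda> \<Longrightarrow> i \<in> I \<Longrightarrow>
    l (a i \<odot>\<^bsub>V\<^esub> w i) \<le> l (lin_comb V a w I)"
  by (auto simp: orth_basis_def)

lemma orth_basis_mem: "orth_basis \<Gamma> V l I w \<Longrightarrow> i \<in> I \<Longrightarrow> w i \<in> carrier V"
  by (auto simp: orth_basis_def)

lemma orth_basis_spanE:
  assumes "orth_basis \<Gamma> V l I w" "v \<in> carrier V"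
  obtains a where "a \<in> I \<rightarrow> \<Lambda>" "v = lin_comb V a w I"
  using assms unfolding orth_basis_def by blast

lemma orth_basis_real:
  assumes "orth_basis \<Gamma> V l I w" "i \<in> I"
  shows "l (w i) = ereal (real_of_ereal (l (w i)))"
  using norm_realE[OF orth_basis_mem[OF assms] orth_basis_nonzero[OF assms]]
  by (metis real_of_ereal.simps(1))

text \<open>The zero vector has norm \<open>-\<infinity>\<close>, and by orthogonality this bounds
  every single term.\<close>

lemma orth_basis_coeff_zero:
  assumes "orth_basis \<Gamma> V l I w" "a \<in> I \<rightarrow> \<Lambda>" "lin_comb V a w I = \<zero>\<^bsub>V\<^esub>" "i \<in> I"
  shows "a i = \<zero>\<^bsub>novikov \<Gamma>\<^esub>"
proof -
  have c: "w i \<in> carrier V" "a i \<in> \<Lambda>" using orth_basis_mem assms by auto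
  have "l (a i \<odot>\<^bsub>V\<^esub> w i) \<le> -\<infinity>" using orth_basis_le[OF assms(1,2,4)] assms(3) by simp
  then have "a i \<odot>\<^bsub>V\<^esub> w i = \<zero>\<^bsub>V\<^esub>" using norm_eq_minf_iff[of "a i \<odot>\<^bsub>V\<^esub> w i"] c by auto
  then show ?thesis using smult_eq_zero_iff c orth_basis_nonzero[OF assms(1,4)] by blast
qed

section \<open>Changes of orthogonal basis\<close>

lemma lin_comb_reindex_bij:
  assumes "bij_betw h I' I" "\<And>i. i \<in> I' \<Longrightarrow> w' i = w (h i)" "\<And>i. i \<in> I' \<Longrightarrow> a' i = a (h i)"
    "a \<in> I \<rightarrow> \<Lambda>" "w \<in> I \<rightarrow> carrier V"
  shows "lin_comb V a' w' I' = lin_comb V a w I"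
proof -
  have im: "h ` I' = I" "inj_on h I'" using assms(1) by (auto simp: bij_betw_def)
  have "lin_comb V a' w' I' = lin_comb V (a \<circ> h) (w \<circ> h) I'"
    by (rule lin_comb_cong) (use assms im in auto)
  then show ?thesis using lin_comb_reindex[of h I' a w] im assms by simp
qed

lemma orth_basis_reindex:
  assumes w: "orth_basis \<Gamma> V l I w" and h: "bij_betw h I' I" and eq: "\<And>i. i \<in> I' \<Longrightarrow> w' i = w (h i)"
  shows "orth_basis \<Gamma> V l I' w'"
  unfolding orth_basis_def
proof (intro conjI ballI)
  have hI: "h i \<in> I" if "i \<in> I'" for i using that h by (auto simp: bij_betw_def)
  have cl: "w \<in> I \<rightarrow> carrier V" using orth_basis_closed[OF w] .
  show "finite I'" using orth_basis_finite[OF w] h bij_betw_finite by blast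
  show "w' \<in> I' \<rightarrow> carrier V" using eq hI cl by auto
  show "w' i \<noteq> \<zero>\<^bsub>V\<^esub>" if "i \<in> I'" for i using that eq hI orth_basis_nonzero[OF w] by auto
  show "l (a i \<odot>\<^bsub>V\<^esub> w' i) \<le> l (lin_comb V a w' I')" if a: "a \<in> I' \<rightarrow> \<Lambda>" and i: "i \<in> I'" for a i
  proof -
    let ?b = "\<lambda>j. a (inv_into I' h j)"
    have b: "?b \<in> I \<rightarrow> \<Lambda>" using a h by (auto simp: bij_betw_def intro!: inv_into_into)
    have inv: "?b (h i) = a i" if "i \<in> I'" for i
      using that h by (simp add: bij_betw_def)
    have "lin_comb V a w' I' = lin_comb V ?b w I"
      by (rule lin_comb_reindex_bij[OF h eq _ b cl]) (simp_all add: inv)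
    then show ?thesis using orth_basis_le[OF w b hI[OF i]] inv[OF i] eq[OF i] by simp
  qed
  fix v assume "v \<in> carrier V"
  then obtain a where a: "a \<in> I \<rightarrow> \<Lambda>" "v = lin_comb V a w I" by (rule orth_basis_spanE[OF w])
  have "lin_comb V (a \<circ> h) w' I' = v"
    unfolding a(2) by (rule lin_comb_reindex_bij[OF h eq _ a(1) cl]) simp_all
  then show "\<exists>a\<in>I' \<rightarrow> \<Lambda>. v = lin_comb V a w' I'"
    using a(1) hI by (intro bexI[of _ "a \<circ> h"]) auto
qed

text \<open>The \<open>j\<close>-term dominates the new vector \<open>x\<close>. In a combination
  with coefficients \<open>b\<close> of the new family, the old coefficient at \<open>j\<close> is
  \<open>b j \<otimes> a j\<close>, so the total norm bounds \<open>b j\<close> times every term of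
  \<open>x\<close>. Each remaining term \<open>b i \<odot> w i\<close> is then a difference of two
  vectors within that bound.\<close>

lemma orth_basis_replace:
  assumes w: "orth_basis \<Gamma> V l I w" and j: "j \<in> I" and a: "a \<in> I \<rightarrow> \<Lambda>"
    and aj: "a j \<noteq> \<zero>\<^bsub>novikov \<Gamma>\<^esub>"
    and dom: "\<And>i. i \<in> I \<Longrightarrow> l (a i \<odot>\<^bsub>V\<^esub> w i) \<le> l (a j \<odot>\<^bsub>V\<^esub> w j)"
  shows "orth_basis \<Gamma> V l I (w(j := lin_comb V a w I))"
proof -
  let ?O = "\<zero>\<^bsub>novikov \<Gamma>\<^esub>"
  define x where "x = lin_comb V a w I"
  have cl: "w \<in> I \<rightarrow> carrier V" and fin: "finite I"
    using orth_basis_closed[OF w] orth_basis_finite[OF w] by auto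
  have x: "x \<in> carrier V" using cl a by (auto simp: x_def)
  have cl': "w(j := x) \<in> I \<rightarrow> carrier V" using cl x by auto
  have lc: "lin_comb V b (w(j := x)) I =
      lin_comb V (\<lambda>i. b j \<otimes>\<^bsub>novikov \<Gamma>\<^esub> a i \<oplus>\<^bsub>novikov \<Gamma>\<^esub> (if i = j then ?O else b i)) w I"
    if b: "b \<in> I \<rightarrow> \<Lambda>" for b
  proof -
    have bj: "b j \<in> \<Lambda>" using b j by auto
    have ba: "(\<lambda>i. b j \<otimes>\<^bsub>novikov \<Gamma>\<^esub> a i) \<in> I \<rightarrow> \<Lambda>" using bj a by auto
    have b': "(\<lambda>i. if i = j then ?O else b i) \<in> I \<rightarrow> \<Lambda>" using b by auto
    have "lin_comb V b (w(j := x)) I = b j \<odot>\<^bsub>V\<^esub> x \<oplus>\<^bsub>V\<^esub> lin_comb V b (w(j := x)) (I - {j})"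
      using lin_comb_remove[OF fin j b cl'] by simp
    also have "lin_comb V b (w(j := x)) (I - {j}) = lin_comb V (\<lambda>i. if i = j then ?O else b i) w (I - {j})"
      by (rule lin_comb_cong) (use b cl in \<open>auto simp: Pi_iff\<close>)
    also have "\<dots> = lin_comb V (\<lambda>i. if i = j then ?O else b i) w I"
      by (rule lin_comb_mono_neutral[symmetric]) (use b' cl fin j in \<open>auto simp: Pi_iff\<close>)
    also have "b j \<odot>\<^bsub>V\<^esub> x = lin_comb V (\<lambda>i. b j \<otimes>\<^bsub>novikov \<Gamma>\<^esub> a i) w I"
      unfolding x_def using lin_comb_smult[OF bj a cl] by simp
    finally show ?thesis
      using lin_comb_add[OF ba b' cl] by (simp only:)
  qed
  have lx: "l x \<le> l (a j \<odot>\<^bsub>V\<^esub> w j)"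
    unfolding x_def by (rule norm_lin_comb_le) (use fin a cl dom in auto)
  show ?thesis
    unfolding orth_basis_def x_def[symmetric]
  proof (intro conjI ballI)
    show "(w(j := x)) i \<noteq> \<zero>\<^bsub>V\<^esub>" if "i \<in> I" for i
      using that orth_basis_nonzero[OF w] orth_basis_coeff_zero[OF w a _ j] aj by (auto simp: x_def)
  next
    fix b i assume b: "b \<in> I \<rightarrow> \<Lambda>" and i: "i \<in> I"
    have bc: "b i \<in> \<Lambda>" "b j \<in> \<Lambda>" "a i \<in> \<Lambda>" "a j \<in> \<Lambda>" "w i \<in> carrier V" "w j \<in> carrier V"
      using b a cl i j by auto
    let ?e = "\<lambda>i. b j \<otimes>\<^bsub>novikov \<Gamma>\<^esub> a i \<oplus>\<^bsub>novikov \<Gamma>\<^esub> (if i = j then ?O else b i)"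
    have e: "?e \<in> I \<rightarrow> \<Lambda>" using b a j by (auto simp: Pi_iff)
    let ?N = "l (lin_comb V ?e w I)"
    have j_le: "l (b j \<odot>\<^bsub>V\<^esub> (a j \<odot>\<^bsub>V\<^esub> w j)) \<le> ?N"
      using orth_basis_le[OF w e j] bc by (simp add: smult_assoc1)
    have "l (b i \<odot>\<^bsub>V\<^esub> (w(j := x)) i) \<le> ?N"
    proof (cases "i = j")
      case True
      then show ?thesis
        using norm_smult_mono[OF bc(2) x _ lx] bc j_le by (simp add: order_trans)
    next
      case False
      let ?p = "b j \<odot>\<^bsub>V\<^esub> (a i \<odot>\<^bsub>V\<^esub> w i)"
      have p: "l (\<ominus>\<^bsub>V\<^esub> ?p) \<le> ?N"
        using norm_smult_mono[OF bc(2) _ _ dom[OF i]] bc j_le by (simp add: norm_neg)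
      have "?e i \<odot>\<^bsub>V\<^esub> w i = ?p \<oplus>\<^bsub>V\<^esub> b i \<odot>\<^bsub>V\<^esub> w i"
        using False bc by (simp add: smult_l_distr smult_assoc1)
      then have "b i \<odot>\<^bsub>V\<^esub> w i = \<ominus>\<^bsub>V\<^esub> ?p \<oplus>\<^bsub>V\<^esub> ?e i \<odot>\<^bsub>V\<^esub> w i"
        using bc by (simp add: M.r_neg1)
      then have "l (b i \<odot>\<^bsub>V\<^esub> w i) \<le> max (l (\<ominus>\<^bsub>V\<^esub> ?p)) (l (?e i \<odot>\<^bsub>V\<^esub> w i))"
        using norm_add_le[of "\<ominus>\<^bsub>V\<^esub> ?p" "?e i \<odot>\<^bsub>V\<^esub> w i"] bc False by simp
      also have "\<dots> \<le> ?N" using p orth_basis_le[OF w e i] by simp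
      finally show ?thesis using False by simp
    qed
    then show "l (b i \<odot>\<^bsub>V\<^esub> (w(j := x)) i) \<le> l (lin_comb V b (w(j := x)) I)"
      using lc[OF b] by simp
  next
    fix v assume "v \<in> carrier V"
    then obtain c where c: "c \<in> I \<rightarrow> \<Lambda>" "v = lin_comb V c w I" by (rule orth_basis_spanE[OF w])
    obtain k where k: "k \<in> \<Lambda>" "k \<otimes>\<^bsub>novikov \<Gamma>\<^esub> a j = \<one>\<^bsub>novikov \<Gamma>\<^esub>"
      using nov_inverse[of "a j"] a j aj by auto
    have cj: "c j \<in> \<Lambda>" "a j \<in> \<Lambda>" using a c j by auto
    \<comment> \<open>Solution of the coefficient equations for \<open>c\<close>: \<open>k\<close>
      inverts \<open>a j\<close>, which determines \<open>d j\<close>, and the other entries remove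
      what \<open>x\<close> contributes in position \<open>i\<close>.\<close>
    define d where "d i = (if i = j then c j \<otimes>\<^bsub>novikov \<Gamma>\<^esub> k
      else c i \<ominus>\<^bsub>novikov \<Gamma>\<^esub> (c j \<otimes>\<^bsub>novikov \<Gamma>\<^esub> k) \<otimes>\<^bsub>novikov \<Gamma>\<^esub> a i)" for i
    have d: "d \<in> I \<rightarrow> \<Lambda>" using c(1) a k cj by (auto simp: d_def Pi_iff)
    have "lin_comb V d (w(j := x)) I = lin_comb V c w I"
      unfolding lc[OF d]
    proof (rule lin_comb_cong)
      fix i assume i: "i \<in> I"
      then have ci: "c i \<in> \<Lambda>" "a i \<in> \<Lambda>" using c a by auto
      have r: "p \<oplus>\<^bsub>novikov \<Gamma>\<^esub> (q \<ominus>\<^bsub>novikov \<Gamma>\<^esub> p) = q" if "p \<in> \<Lambda>" "q \<in> \<Lambda>" for p q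
        using that by (metis R.add.inv_solve_right R.minus_eq R.a_comm R.minus_closed)
      show "d j \<otimes>\<^bsub>novikov \<Gamma>\<^esub> a i \<oplus>\<^bsub>novikov \<Gamma>\<^esub> (if i = j then ?O else d i) = c i"
        using ci cj k by (auto simp: d_def R.m_assoc r)
    qed (use c cl in auto)
    then show "\<exists>d\<in>I \<rightarrow> \<Lambda>. v = lin_comb V d (w(j := x)) I" using d c(2) by metis
  qed (use fin cl' in auto)
qed

text \<open>The vectors are changed one at a time. Each change is a replacement in which
  \<open>w k\<close> itself, with coefficient one, is the dominant term; since \<open>w j\<close>
  stays fixed, the changes do not interfere.\<close>

lemma orth_basis_elementary:
  assumes w: "orth_basis \<Gamma> V l I w" and j: "j \<in> I" and c: "c \<in> I \<rightarrow> \<Lambda>"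
    and dom: "\<And>i. i \<in> I - {j} \<Longrightarrow> l (c i \<odot>\<^bsub>V\<^esub> w j) \<le> l (w i)"
  shows "orth_basis \<Gamma> V l I (\<lambda>i. if i = j then w j else w i \<oplus>\<^bsub>V\<^esub> c i \<odot>\<^bsub>V\<^esub> w j)"
proof -
  have cl: "w \<in> I \<rightarrow> carrier V" and fin: "finite I"
    using orth_basis_closed[OF w] orth_basis_finite[OF w] by auto
  have "orth_basis \<Gamma> V l I (\<lambda>i. if i \<in> K then w i \<oplus>\<^bsub>V\<^esub> c i \<odot>\<^bsub>V\<^esub> w j else w i)"
    if "finite K" "K \<subseteq> I - {j}" for K
    using that
  proof (induction K)
    case (insert k K)
    let ?w = "\<lambda>i. if i \<in> K then w i \<oplus>\<^bsub>V\<^esub> c i \<odot>\<^bsub>V\<^esub> w j else w i"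
    have IH: "orth_basis \<Gamma> V l I ?w" using insert by simp
    have k: "k \<in> I" "k \<noteq> j" "k \<notin> K" "j \<notin> K" "c k \<in> \<Lambda>" "w j \<in> carrier V" "w k \<in> carrier V"
      using insert c j cl by auto
    let ?a = "\<lambda>i. if i = k then \<one>\<^bsub>novikov \<Gamma>\<^esub> else if i = j then c k else \<zero>\<^bsub>novikov \<Gamma>\<^esub>"
    have "orth_basis \<Gamma> V l I (?w(k := lin_comb V ?a ?w I))"
    proof (rule orth_basis_replace[OF IH k(1)])
      show "l (?a i \<odot>\<^bsub>V\<^esub> ?w i) \<le> l (?a k \<odot>\<^bsub>V\<^esub> ?w k)" if "i \<in> I" for i
      proof -
        have wi: "?w i \<in> carrier V" using orth_basis_mem[OF IH that] .
        show ?thesis using that k wi dom[of k] by auto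
      qed
    qed (use k in auto)
    moreover have "lin_comb V ?a ?w I = w k \<oplus>\<^bsub>V\<^esub> c k \<odot>\<^bsub>V\<^esub> w j"
      using lin_comb_pair[OF fin j k(1) k(2)[symmetric] _ k(5) orth_basis_closed[OF IH], of "\<one>\<^bsub>novikov \<Gamma>\<^esub>"] k
      by simp
    moreover have "?w(k := w k \<oplus>\<^bsub>V\<^esub> c k \<odot>\<^bsub>V\<^esub> w j) =
        (\<lambda>i. if i \<in> insert k K then w i \<oplus>\<^bsub>V\<^esub> c i \<odot>\<^bsub>V\<^esub> w j else w i)"
      by auto
    ultimately show ?case by simp
  qed (use w in simp)
  then have "orth_basis \<Gamma> V l I (\<lambda>i. if i \<in> I - {j} then w i \<oplus>\<^bsub>V\<^esub> c i \<odot>\<^bsub>V\<^esub> w j else w i)"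
    using fin by blast
  then show ?thesis
    by (rule orth_basis_reindex[where h = id]) auto
qed

section \<open>Orthogonal bases of subspaces\<close>

lemma novikov_normed_subspace:
  assumes "VectorSpace.subspace (novikov \<Gamma>) W V"
  shows "novikov_normed_space \<Gamma> (V\<lparr>carrier := W\<rparr>) l"
proof -
  have sub: "W \<subseteq> carrier V" using assms by (auto simp: VectorSpace.subspace_def dest: LinearCombinations.submodule.subset)
  have vs: "vectorspace (novikov \<Gamma>) (V\<lparr>carrier := W\<rparr>)" by (rule subspace_is_vs[OF assms])
  have "nonarch_normed_space \<Gamma> (V\<lparr>carrier := W\<rparr>) l"
    using sub vs norm_finite norm_eq_minf_iff norm_smult norm_add_le
    by (auto simp: nonarch_normed_space_def subset_iff)
  then show ?thesis
    using vs subgroup by (simp add: novikov_normed_space_def novikov_normed_space_axioms_def)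
qed

text \<open>Padding with zeros lets a combination over part of the indices use the orthogonality of
  the whole family.\<close>

lemma lin_comb_extend:
  assumes "finite I" "Q \<subseteq> I" "a \<in> Q \<rightarrow> \<Lambda>" "w \<in> I \<rightarrow> carrier V"
  shows "lin_comb V a w Q = lin_comb V (\<lambda>i. if i \<in> Q then a i else \<zero>\<^bsub>novikov \<Gamma>\<^esub>) w I"
proof -
  let ?a = "\<lambda>i. if i \<in> Q then a i else \<zero>\<^bsub>novikov \<Gamma>\<^esub>"
  have "lin_comb V ?a w I = lin_comb V ?a w Q"
    by (rule lin_comb_mono_neutral) (use assms in \<open>auto simp: Pi_iff\<close>)
  also have "\<dots> = lin_comb V a w Q"
    by (rule lin_comb_cong) (use assms in auto)
  finally show ?thesis by simp
qed

text \<open>By \<open>vanish\<close>, the expansion of a vector of \<open>W\<close> in the large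
  basis already is an expansion over \<open>Q\<close>. Kernels, images and cocycle spaces are all
  treated this way.\<close>

lemma orth_basis_subspace:
  assumes w: "orth_basis \<Gamma> V l I w" and W: "VectorSpace.subspace (novikov \<Gamma>) W V" and Q: "Q \<subseteq> I" "w \<in> Q \<rightarrow> W"
    and vanish: "\<And>a i. a \<in> I \<rightarrow> \<Lambda> \<Longrightarrow> lin_comb V a w I \<in> W \<Longrightarrow> i \<in> I - Q \<Longrightarrow> a i = \<zero>\<^bsub>novikov \<Gamma>\<^esub>"
  shows "orth_basis \<Gamma> (V\<lparr>carrier := W\<rparr>) l Q w"
  unfolding orth_basis_def
proof (intro conjI ballI)
  have cl: "w \<in> I \<rightarrow> carrier V" and fin: "finite I"
    using orth_basis_closed[OF w] orth_basis_finite[OF w] by auto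
  have sub: "W \<subseteq> carrier V" and sm: "submodule (novikov \<Gamma>) W V"
    using W by (auto simp: VectorSpace.subspace_def dest: LinearCombinations.submodule.subset)
  show "finite Q" using fin Q finite_subset by blast
  show "w i \<noteq> \<zero>\<^bsub>V\<lparr>carrier := W\<rparr>\<^esub>" if "i \<in> Q" for i using that orth_basis_nonzero[OF w] Q by auto
  show "l (a i \<odot>\<^bsub>V\<lparr>carrier := W\<rparr>\<^esub> w i) \<le> l (lin_comb (V\<lparr>carrier := W\<rparr>) a w Q)"
    if a: "a \<in> Q \<rightarrow> \<Lambda>" and i: "i \<in> Q" for a i
  proof -
    let ?a = "\<lambda>i. if i \<in> Q then a i else \<zero>\<^bsub>novikov \<Gamma>\<^esub>"
    have "l (?a i \<odot>\<^bsub>V\<^esub> w i) \<le> l (lin_comb V ?a w I)"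
      by (rule orth_basis_le[OF w]) (use a i Q in auto)
    then show ?thesis
      using lin_comb_submodule[OF sm a Q(2)] lin_comb_extend[OF fin Q(1) a cl] i by simp
  qed
  fix v assume v: "v \<in> carrier (V\<lparr>carrier := W\<rparr>)"
  then have "v \<in> W" "v \<in> carrier V" using sub by auto
  obtain a where a: "a \<in> I \<rightarrow> \<Lambda>" "v = lin_comb V a w I"
    by (rule orth_basis_spanE[OF w \<open>v \<in> carrier V\<close>])
  have "lin_comb V a w I = lin_comb V a w Q"
    by (rule lin_comb_mono_neutral) (use a fin Q cl vanish[OF a(1)] \<open>v \<in> W\<close> in \<open>auto simp: Pi_iff\<close>)
  moreover have "a \<in> Q \<rightarrow> \<Lambda>" using a Q by auto
  ultimately show "\<exists>a\<in>Q \<rightarrow> \<Lambda>. v = lin_comb (V\<lparr>carrier := W\<rparr>) a w Q"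
    using lin_comb_submodule[OF sm _ Q(2)] a(2) by (intro bexI[of _ a]) auto
qed (use Q in auto)

lemma lin_comb_Plus:
  assumes "finite P" "finite K" "a \<in> P <+> K \<rightarrow> \<Lambda>" "w \<in> P \<rightarrow> carrier V" "z \<in> K \<rightarrow> carrier V"
  shows "lin_comb V a (case_sum w z) (P <+> K) = lin_comb V (a \<circ> Inl) w P \<oplus>\<^bsub>V\<^esub> lin_comb V (a \<circ> Inr) z K"
proof -
  have "lin_comb V a (case_sum w z) (P <+> K) =
      lin_comb V a (case_sum w z) (Inl ` P) \<oplus>\<^bsub>V\<^esub> lin_comb V a (case_sum w z) (Inr ` K)"
    unfolding Plus_def by (rule lin_comb_Un_disjoint) (use assms in auto)
  also have "lin_comb V a (case_sum w z) (Inl ` P) = lin_comb V (a \<circ> Inl) (case_sum w z \<circ> Inl) P"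
    by (rule lin_comb_reindex) (use assms in auto)
  also have "lin_comb V a (case_sum w z) (Inr ` K) = lin_comb V (a \<circ> Inr) (case_sum w z \<circ> Inr) K"
    by (rule lin_comb_reindex) (use assms in auto)
  finally show ?thesis by (simp add: comp_def)
qed

text \<open>This glues two decompositions: \<open>P\<close> indexes the vectors that the
  differential does not kill, \<open>z\<close> is a basis of cycles coming from the differential one
  degree up. A combination of \<open>z\<close> can be rewritten in the old vectors of
  \<open>W\<close>, where orthogonality of \<open>w\<close> bounds its norm by that of the total;
  inside \<open>W\<close> the family \<open>z\<close> is orthogonal itself.\<close>

lemma orth_basis_exchange:
  assumes w: "orth_basis \<Gamma> V l I w" and W: "VectorSpace.subspace (novikov \<Gamma>) W V" and P: "P \<subseteq> I"
    and wQ: "orth_basis \<Gamma> (V\<lparr>carrier := W\<rparr>) l (I - P) w"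
    and z: "orth_basis \<Gamma> (V\<lparr>carrier := W\<rparr>) l K z"
  shows "orth_basis \<Gamma> V l (P <+> K) (case_sum w z)"
  unfolding orth_basis_def
proof (intro conjI ballI)
  interpret W: novikov_normed_space \<Gamma> "V\<lparr>carrier := W\<rparr>" l by (rule novikov_normed_subspace[OF W])
  have sub: "W \<subseteq> carrier V" and sm: "submodule (novikov \<Gamma>) W V"
    using W by (auto simp: VectorSpace.subspace_def dest: LinearCombinations.submodule.subset)
  have cl: "w \<in> I \<rightarrow> carrier V" and fin: "finite I" and finK: "finite K" and zcl: "z \<in> K \<rightarrow> W"
    and wcl: "w \<in> I - P \<rightarrow> W"
    using orth_basis_closed[OF w] orth_basis_finite[OF w] W.orth_basis_finite[OF z]
      W.orth_basis_closed[OF z] W.orth_basis_closed[OF wQ] by auto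
  have finP: "finite P" using fin P finite_subset by blast
  have wP: "w \<in> P \<rightarrow> carrier V" using cl P by auto
  have zV: "z \<in> K \<rightarrow> carrier V" using zcl sub by auto
  show "finite (P <+> K)" using finP finK by simp
  show "case_sum w z \<in> P <+> K \<rightarrow> carrier V" using wP zV by auto
  show "case_sum w z i \<noteq> \<zero>\<^bsub>V\<^esub>" if "i \<in> P <+> K" for i
    using that orth_basis_nonzero[OF w] W.orth_basis_nonzero[OF z] P by auto
  have PQ: "P \<union> (I - P) = I" using P by auto
  have split: "lin_comb V e w I = lin_comb V e w P \<oplus>\<^bsub>V\<^esub> lin_comb V e w (I - P)" if "e \<in> I \<rightarrow> \<Lambda>" for e
    using lin_comb_Un_disjoint[of P "I - P" e w, unfolded PQ] that cl finP fin by auto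
  show "l (a i \<odot>\<^bsub>V\<^esub> case_sum w z i) \<le> l (lin_comb V a (case_sum w z) (P <+> K))"
    if a: "a \<in> P <+> K \<rightarrow> \<Lambda>" and i: "i \<in> P <+> K" for a i
  proof -
    have aK: "a \<circ> Inr \<in> K \<rightarrow> \<Lambda>" and aP: "a \<circ> Inl \<in> P \<rightarrow> \<Lambda>" using a by auto
    let ?u = "lin_comb V (a \<circ> Inr) z K"
    have u: "?u = lin_comb (V\<lparr>carrier := W\<rparr>) (a \<circ> Inr) z K" using lin_comb_submodule[OF sm aK zcl] by simp
    have "lin_comb (V\<lparr>carrier := W\<rparr>) (a \<circ> Inr) z K \<in> carrier (V\<lparr>carrier := W\<rparr>)"
      by (rule W.lin_comb_closed) (use aK zcl in auto)
    then obtain b where b: "b \<in> I - P \<rightarrow> \<Lambda>" "?u = lin_comb (V\<lparr>carrier := W\<rparr>) b w (I - P)"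
      using W.orth_basis_spanE[OF wQ] u by metis
    then have ub: "?u = lin_comb V b w (I - P)" using lin_comb_submodule[OF sm b(1) wcl] by simp
    \<comment> \<open>Coefficients of the same vector in the original family \<open>w\<close>, with
      the \<open>z\<close>-part rewritten over \<open>I - P\<close>.\<close>
    let ?e = "\<lambda>i. if i \<in> P then a (Inl i) else b i"
    have e: "?e \<in> I \<rightarrow> \<Lambda>" using b(1) aP by (auto simp: Pi_iff)
    have eP: "lin_comb V ?e w P = lin_comb V (a \<circ> Inl) w P"
      by (rule lin_comb_cong) (use aP wP in auto)
    have eQ: "lin_comb V ?e w (I - P) = lin_comb V b w (I - P)"
      by (rule lin_comb_cong) (use b cl in auto)
    have tot: "lin_comb V a (case_sum w z) (P <+> K) = lin_comb V ?e w I"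
      unfolding split[OF e] eP eQ ub[symmetric] by (rule lin_comb_Plus[OF finP finK a wP zV])
    show ?thesis
    proof (cases i)
      case (Inl p)
      then have p: "p \<in> P" "p \<in> I" using i P by auto
      then show ?thesis using orth_basis_le[OF w e p(2)] tot Inl by simp
    next
      case (Inr k)
      then have k: "k \<in> K" using i by auto
      have "l (a i \<odot>\<^bsub>V\<^esub> case_sum w z i) \<le> l ?u"
        using W.orth_basis_le[OF z aK k] u Inr by simp
      also have "\<dots> \<le> l (lin_comb V ?e w I)"
        unfolding ub
      proof (rule norm_lin_comb_le)
        fix q assume "q \<in> I - P"
        then show "l (b q \<odot>\<^bsub>V\<^esub> w q) \<le> l (lin_comb V ?e w I)" using orth_basis_le[OF w e, of q] by simp
      qed (use fin b cl in auto)
      finally show ?thesis using tot by simp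
    qed
  qed
  fix v assume "v \<in> carrier V"
  then obtain e where e: "e \<in> I \<rightarrow> \<Lambda>" "v = lin_comb V e w I" by (rule orth_basis_spanE[OF w])
  have eQ: "e \<in> I - P \<rightarrow> \<Lambda>" using e by auto
  have "lin_comb (V\<lparr>carrier := W\<rparr>) e w (I - P) \<in> carrier (V\<lparr>carrier := W\<rparr>)"
    by (rule W.lin_comb_closed) (use eQ wcl in auto)
  then obtain b where b: "b \<in> K \<rightarrow> \<Lambda>"
    "lin_comb (V\<lparr>carrier := W\<rparr>) e w (I - P) = lin_comb (V\<lparr>carrier := W\<rparr>) b z K"
    using W.orth_basis_spanE[OF z] by metis
  then have "lin_comb V e w (I - P) = lin_comb V b z K"
    using lin_comb_submodule[OF sm eQ wcl] lin_comb_submodule[OF sm b(1) zcl] by simp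
  moreover have c: "case_sum e b \<in> P <+> K \<rightarrow> \<Lambda>" using e b P by auto
  ultimately have "v = lin_comb V (case_sum e b) (case_sum w z) (P <+> K)"
    using lin_comb_Plus[OF finP finK c wP zV] split[OF e(1)] e(2) by (simp add: comp_def)
  then show "\<exists>a\<in>P <+> K \<rightarrow> \<Lambda>. v = lin_comb V a (case_sum w z) (P <+> K)" using c by blast
qed

end

subsection \<open>Singular value decompositions by elimination\<close>

locale novikov_linear_map =
  C: novikov_normed_space \<Gamma> C lC + D: novikov_normed_space \<Gamma> D lD +
  linear_map "novikov \<Gamma>" C D A
  for \<Gamma> :: "real set" and C :: "(real \<Rightarrow> 'k::field, 'c) module" and lC
    and D :: "(real \<Rightarrow> 'k, 'd) module" and lD and A
begin

abbreviation \<Lambda> :: "(real \<Rightarrow> 'k) set" where "\<Lambda> \<equiv> carrier (novikov \<Gamma>)"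

text \<open>An unordered decomposition: indices in \<open>P\<close> pair \<open>y i\<close> with
  \<open>x i\<close>. That the rest of \<open>y\<close> spans the kernel and that \<open>x\<close>
  over \<open>P\<close> spans the image are consequences; the order of the gaps is restored by
  sorting when lists are formed.\<close>

definition svd_family :: "'i set \<Rightarrow> ('i \<Rightarrow> 'c) \<Rightarrow> 'i set \<Rightarrow> ('i \<Rightarrow> 'd) \<Rightarrow> 'i set \<Rightarrow> bool" where
  "svd_family I y J x P \<longleftrightarrow> orth_basis \<Gamma> C lC I y \<and> orth_basis \<Gamma> D lD J x \<and> P \<subseteq> I \<and> P \<subseteq> J \<and>
     (\<forall>i\<in>P. A (y i) = x i) \<and> (\<forall>i\<in>I - P. A (y i) = \<zero>\<^bsub>D\<^esub>)"

text \<open>Each step takes a matrix entry whose pivot has the least filtration gap. By minimality, the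
  row and column operations that clear its row and column keep both bases orthogonal.\<close>

lemma svd_elimination:
  assumes "orth_basis \<Gamma> C lC I y" "orth_basis \<Gamma> D lD J x" "P \<subseteq> I" "inj_on \<pi> P" "\<pi> ` P \<subseteq> J"
    "\<forall>i\<in>P. A (y i) = x (\<pi> i)" "\<forall>i\<in>I - P. \<exists>m\<in>J \<rightarrow> \<Lambda>. A (y i) = lin_comb D m x (J - \<pi> ` P)"
  shows "\<exists>y x P \<pi>. orth_basis \<Gamma> C lC I y \<and> orth_basis \<Gamma> D lD J x \<and> P \<subseteq> I \<and> inj_on \<pi> P \<and> \<pi> ` P \<subseteq> J \<and>
    (\<forall>i\<in>P. A (y i) = x (\<pi> i)) \<and> (\<forall>i\<in>I - P. A (y i) = \<zero>\<^bsub>D\<^esub>)"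
  using assms
proof (induction "card (I - P)" arbitrary: P \<pi> x y rule: less_induct)
  case less
  note y = less.prems(1) and x = less.prems(2) and P = less.prems(3)
  have finI: "finite I" and finJ: "finite J" and ycl: "y \<in> I \<rightarrow> carrier C" and xcl: "x \<in> J \<rightarrow> carrier D"
    using C.orth_basis_finite[OF y] D.orth_basis_finite[OF x] C.orth_basis_closed[OF y]
      D.orth_basis_closed[OF x] by auto
  show ?case
  proof (cases "\<forall>i\<in>I - P. A (y i) = \<zero>\<^bsub>D\<^esub>")
    case True
    then show ?thesis using less.prems by blast
  next
    case False
    define K where "K = J - \<pi> ` P"
    have KJ: "K \<subseteq> J" and finK: "finite K" using finJ by (auto simp: K_def)
    have xK: "x \<in> K \<rightarrow> carrier D" using xcl KJ by auto
    obtain m where m: "\<And>i. i \<in> I - P \<Longrightarrow> m i \<in> J \<rightarrow> \<Lambda>"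
      "\<And>i. i \<in> I - P \<Longrightarrow> A (y i) = lin_comb D (m i) x K"
      using bchoice[OF less.prems(7)[folded K_def, unfolded Bex_def]] by blast
    define S where "S = {(i, j). i \<in> I - P \<and> j \<in> K \<and> m i j \<noteq> \<zero>\<^bsub>novikov \<Gamma>\<^esub>}"
    have finS: "finite S" by (rule finite_subset[of _ "I \<times> J"]) (use finI finJ KJ in \<open>auto simp: S_def\<close>)
    have "S \<noteq> {}"
    proof
      assume "S = {}"
      have "A (y i) = \<zero>\<^bsub>D\<^esub>" if i: "i \<in> I - P" for i
        unfolding m(2)[OF i]
      proof (rule D.lin_comb_zero)
        fix j assume "j \<in> K"
        then have "m i j = \<zero>\<^bsub>novikov \<Gamma>\<^esub>" "x j \<in> carrier D"
          using \<open>S = {}\<close> i xK unfolding S_def by blast+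
        then show "m i j \<odot>\<^bsub>D\<^esub> x j = \<zero>\<^bsub>D\<^esub>" by simp
      qed
      then show False using False by blast
    qed
    \<comment> \<open>The drop in norm from \<open>y i\<close> to the term
      \<open>m i j \<odot> x j\<close> of its image. On \<open>S\<close> all three quantities are
      finite, so passing to reals loses nothing.\<close>
    define f where "f = (\<lambda>(i, j). real_of_ereal (lC (y i)) - real_of_ereal (lD (x j)) + real_of_ereal (nu (m i j)))"
    obtain i0 j0 where p: "(i0, j0) \<in> S" and pmin: "\<And>i j. (i, j) \<in> S \<Longrightarrow> f (i0, j0) \<le> f (i, j)"
    proof -
      obtain p where "p \<in> S" "\<And>q. q \<in> S \<Longrightarrow> f p \<le> f q"
        using ex_min_if_finite[OF finite_imageI[OF finS], of f] \<open>S \<noteq> {}\<close>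
        by (auto simp: not_less)
      then show ?thesis using that by (metis surj_pair)
    qed
    have i0: "i0 \<in> I" "i0 \<notin> P" "i0 \<in> I - P" and j0: "j0 \<in> K" "j0 \<in> J" and nz: "m i0 j0 \<noteq> \<zero>\<^bsub>novikov \<Gamma>\<^esub>"
      using p KJ by (auto simp: S_def)
    have mcl: "m i j \<in> \<Lambda>" if "i \<in> I - P" "j \<in> J" for i j using m(1)[OF that(1)] that(2) by auto
    have lCy: "\<exists>r. lC (y i) = ereal r" if "i \<in> I" for i
      using C.orth_basis_real[OF y that] by blast
    have lDx: "\<exists>r. lD (x j) = ereal r" if "j \<in> J" for j
      using D.orth_basis_real[OF x that] by blast
    have num: "\<exists>r. nu (m i j) = ereal r" if "(i, j) \<in> S" for i j
    proof -
      have "m i j \<in> \<Lambda>" "m i j \<noteq> (\<lambda>g. 0)" using that mcl KJ by (auto simp: S_def C.zero_nov)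
      then show ?thesis using nu_nonzeroE by metis
    qed
    have y0: "y i0 \<in> carrier C" using ycl i0 by auto
    define a where "a j = (if j \<in> K then m i0 j else \<zero>\<^bsub>novikov \<Gamma>\<^esub>)" for j
    have a: "a \<in> J \<rightarrow> \<Lambda>" using mcl[OF i0(3)] by (auto simp: a_def)
    have Ay0: "A (y i0) = lin_comb D a x J"
      unfolding m(2)[OF i0(3)] a_def
      by (rule D.lin_comb_extend[OF finJ KJ _ xcl]) (use mcl[OF i0(3)] KJ in auto)
    \<comment> \<open>The image of the pivot vector itself becomes a basis vector in place of
      \<open>x j0\<close>. Minimality along row \<open>i0\<close> says that the
      \<open>j0\<close>-term of this image has the largest norm.\<close>
    define x' where "x' = x(j0 := A (y i0))"
    have x': "orth_basis \<Gamma> D lD J x'"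
      unfolding x'_def Ay0
    proof (rule D.orth_basis_replace[OF x j0(2) a])
      show "a j0 \<noteq> \<zero>\<^bsub>novikov \<Gamma>\<^esub>" using nz j0 by (simp add: a_def)
      fix j assume j: "j \<in> J"
      have xj: "x j \<in> carrier D" "x j0 \<in> carrier D" using xcl j j0 by auto
      show "lD (a j \<odot>\<^bsub>D\<^esub> x j) \<le> lD (a j0 \<odot>\<^bsub>D\<^esub> x j0)"
      proof (cases "(i0, j) \<in> S")
        case True
        then have jK: "j \<in> K" by (auto simp: S_def)
        obtain n n0 s s0 where "nu (m i0 j) = ereal n" "nu (m i0 j0) = ereal n0"
          "lD (x j) = ereal s" "lD (x j0) = ereal s0"
          using num[OF True] num[OF p] lDx[OF j] lDx[OF j0(2)] by blast
        then have "lD (x j) - nu (m i0 j) \<le> lD (x j0) - nu (m i0 j0)"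
          using pmin[OF True] by (simp add: f_def)
        then show ?thesis
          using D.norm_smult[OF mcl[OF i0(3) j] xj(1)] D.norm_smult[OF mcl[OF i0(3) j0(2)] xj(2)] jK j0
          by (simp add: a_def)
      next
        case False
        then have "a j = \<zero>\<^bsub>novikov \<Gamma>\<^esub>" using i0 by (auto simp: a_def S_def)
        then show ?thesis using xj by simp
      qed
    qed
    obtain b where b: "b \<in> \<Lambda>" "b \<otimes>\<^bsub>novikov \<Gamma>\<^esub> m i0 j0 = \<one>\<^bsub>novikov \<Gamma>\<^esub>"
      using C.nov_inverse[OF mcl[OF i0(3) j0(2)] nz] .
    have nub: "nu b = - nu (m i0 j0)"
    proof -
      have "nu b + nu (m i0 j0) = 0"
        using nu_mult[OF b(1) mcl[OF i0(3) j0(2)]] b(2) by (simp add: novikov_sel(1))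
      then show ?thesis using num[OF p] by (cases "nu b") (auto simp: add_eq_0_iff2 add_eq_0_iff)
    qed
    \<comment> \<open>The multiple of the pivot vector that clears the entry in column
      \<open>j0\<close>. Minimality along this column bounds its norm by that of \<open>y i\<close>.
      On \<open>P\<close> the coefficient is zero, so finished pairs stay intact.\<close>
    define c where "c i = (if i \<in> I - P then \<ominus>\<^bsub>novikov \<Gamma>\<^esub> m i j0 \<otimes>\<^bsub>novikov \<Gamma>\<^esub> b else \<zero>\<^bsub>novikov \<Gamma>\<^esub>)" for i
    have c: "c i \<in> \<Lambda>" for i using mcl[OF _ j0(2), of i] b by (auto simp: c_def)
    define y' where "y' i = (if i = i0 then y i0 else y i \<oplus>\<^bsub>C\<^esub> c i \<odot>\<^bsub>C\<^esub> y i0)" for i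
    have y': "orth_basis \<Gamma> C lC I y'"
      unfolding y'_def
    proof (rule C.orth_basis_elementary[OF y i0(1)])
      show "c \<in> I \<rightarrow> \<Lambda>" using c by auto
      fix i assume i: "i \<in> I - {i0}"
      show "lC (c i \<odot>\<^bsub>C\<^esub> y i0) \<le> lC (y i)"
      proof (cases "(i, j0) \<in> S")
        case True
        then have iP: "i \<in> I - P" by (auto simp: S_def)
        have mn: "m i j0 \<in> \<Lambda>" using mcl[OF iP j0(2)] .
        have "(\<ominus>\<^bsub>novikov \<Gamma>\<^esub> m i j0 \<otimes>\<^bsub>novikov \<Gamma>\<^esub> b) \<odot>\<^bsub>C\<^esub> y i0 = \<ominus>\<^bsub>C\<^esub> ((m i j0 \<otimes>\<^bsub>novikov \<Gamma>\<^esub> b) \<odot>\<^bsub>C\<^esub> y i0)"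
          using mn b y0 by (simp add: C.smult_l_minus C.R.l_minus)
        then have "lC (c i \<odot>\<^bsub>C\<^esub> y i0) = lC ((m i j0 \<otimes>\<^bsub>novikov \<Gamma>\<^esub> b) \<odot>\<^bsub>C\<^esub> y i0)"
          using iP mn b y0 by (simp add: c_def C.norm_neg)
        also have "\<dots> = lC (y i0) - (nu (m i j0) - nu (m i0 j0))"
          unfolding C.norm_smult[OF C.R.m_closed[OF mn b(1)] y0]
          using nu_mult[OF mn b(1)] nub by (simp add: novikov_sel(1) minus_ereal_def)
        also have "\<dots> \<le> lC (y i)"
        proof -
          obtain n n0 s s0 where "nu (m i j0) = ereal n" "nu (m i0 j0) = ereal n0"
            "lC (y i) = ereal s" "lC (y i0) = ereal s0"
            using num[OF True] num[OF p] lCy[of i] lCy[OF i0(1)] i by blast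
          then show ?thesis using pmin[OF True] by (simp add: f_def)
        qed
        finally show ?thesis .
      next
        case False
        then have "c i = \<zero>\<^bsub>novikov \<Gamma>\<^esub>" using i b j0 by (auto simp: c_def S_def)
        then show ?thesis using y0 by simp
      qed
    qed
    define \<pi>' where "\<pi>' = \<pi>(i0 := j0)"
    have K': "J - \<pi>' ` insert i0 P = K - {j0}" using i0 by (auto simp: \<pi>'_def K_def)
    show ?thesis
    proof (rule less.hyps[of "insert i0 P" y' x' \<pi>'])
      have "I - insert i0 P \<subset> I - P" using i0 by auto
      then show "card (I - insert i0 P) < card (I - P)" using finI by (simp add: psubset_card_mono)
      show "insert i0 P \<subseteq> I" using i0 P by auto
      show "inj_on \<pi>' (insert i0 P)"
        using less.prems(4) i0 j0(1) by (auto simp: \<pi>'_def K_def inj_on_def)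
      show "\<pi>' ` insert i0 P \<subseteq> J" using less.prems(5) i0 j0 by (auto simp: \<pi>'_def)
      show "\<forall>i\<in>insert i0 P. A (y' i) = x' (\<pi>' i)"
      proof
        fix i assume "i \<in> insert i0 P"
        then consider "i = i0" | "i \<in> P" "i \<noteq> i0" using i0 by blast
        then show "A (y' i) = x' (\<pi>' i)"
        proof cases
          case 2
          have "y i \<in> carrier C" "\<pi> i \<noteq> j0" using 2 P ycl j0 by (auto simp: K_def)
          then show ?thesis using 2 y0 less.prems(6) by (simp add: y'_def c_def \<pi>'_def x'_def)
        qed (simp add: y'_def \<pi>'_def x'_def)
      qed
      show "\<forall>i\<in>I - insert i0 P. \<exists>m\<in>J \<rightarrow> \<Lambda>. A (y' i) = lin_comb D m x' (J - \<pi>' ` insert i0 P)"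
      proof
        fix i assume i: "i \<in> I - insert i0 P"
        then have iP: "i \<in> I - P" and yi: "y i \<in> carrier C" using ycl by auto
        let ?m = "\<lambda>j. m i j \<oplus>\<^bsub>novikov \<Gamma>\<^esub> c i \<otimes>\<^bsub>novikov \<Gamma>\<^esub> m i0 j"
        have mJ: "?m \<in> J \<rightarrow> \<Lambda>" using mcl iP i0 c by auto
        have mK: "m i \<in> K \<rightarrow> \<Lambda>" "m i0 \<in> K \<rightarrow> \<Lambda>" using mcl iP i0 KJ by auto
        \<comment> \<open>Column \<open>j0\<close> is now cleared, and on the columns that remain
          \<open>x\<close> and \<open>x'\<close> agree.\<close>
        have m0: "?m j0 = \<zero>\<^bsub>novikov \<Gamma>\<^esub>"
          using mcl[OF iP j0(2)] mcl[OF i0(3) j0(2)] b iP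
          by (simp add: c_def C.R.m_assoc C.R.l_minus C.R.r_neg)
        have "A (y' i) = A (y i) \<oplus>\<^bsub>D\<^esub> c i \<odot>\<^bsub>D\<^esub> A (y i0)"
          using i yi y0 c by (simp add: y'_def)
        also have "\<dots> = lin_comb D (m i) x K \<oplus>\<^bsub>D\<^esub> lin_comb D (\<lambda>j. c i \<otimes>\<^bsub>novikov \<Gamma>\<^esub> m i0 j) x K"
          unfolding m(2)[OF iP] m(2)[OF i0(3)] D.lin_comb_smult[OF c mK(2) xK] ..
        also have "\<dots> = lin_comb D ?m x K"
          by (rule D.lin_comb_add[symmetric, OF mK(1) _ xK]) (use c mK in auto)
        also have "\<dots> = lin_comb D ?m x (K - {j0})"
          by (rule D.lin_comb_mono_neutral[OF finK])
            (use mJ xK KJ m0 j0(1) in \<open>auto simp: Pi_iff\<close>)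
        also have "\<dots> = lin_comb D ?m x' (K - {j0})"
          by (rule D.lin_comb_cong) (use mJ xK KJ D.orth_basis_closed[OF x'] in \<open>auto simp: x'_def\<close>)
        finally show "\<exists>m\<in>J \<rightarrow> \<Lambda>. A (y' i) = lin_comb D m x' (J - \<pi>' ` insert i0 P)"
          using mJ K' by metis
      qed
    qed (fact y' x')+
  qed
qed

text \<open>The elimination pairs two index types by an injection \<open>\<pi>\<close>, whereas
  \<open>svd_family\<close> wants one. In the sum type a paired \<open>x\<close> takes the
  \<open>Inl\<close> index of its partner, and the unpaired ones keep their own index under
  \<open>Inr\<close>.\<close>

theorem svd_family_exists:
  assumes y: "orth_basis \<Gamma> C lC (I :: 'i set) y" and x: "orth_basis \<Gamma> D lD (J :: 'j set) x"
  shows "\<exists>I y J x P. svd_family (I :: ('i + 'j) set) y J x P"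
proof -
  \<comment> \<open>The elimination starts with no pairs, so any function serves as the initial
    pairing.\<close>
  have "\<forall>i\<in>I - {}. \<exists>m\<in>J \<rightarrow> \<Lambda>. A (y i) = lin_comb D m x (J - undefined ` {})"
  proof
    fix i assume "i \<in> I - {}"
    then have "A (y i) \<in> carrier D" using C.orth_basis_mem[OF y] by auto
    then show "\<exists>m\<in>J \<rightarrow> \<Lambda>. A (y i) = lin_comb D m x (J - undefined ` {})"
      using D.orth_basis_spanE[OF x] by (metis Diff_empty image_empty)
  qed
  then have "\<exists>y x P \<pi>. orth_basis \<Gamma> C lC I y \<and> orth_basis \<Gamma> D lD J x \<and> P \<subseteq> I \<and> inj_on \<pi> P \<and> \<pi> ` P \<subseteq> J \<and>
    (\<forall>i\<in>P. A (y i) = x (\<pi> i)) \<and> (\<forall>i\<in>I - P. A (y i) = \<zero>\<^bsub>D\<^esub>)"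
    by (intro svd_elimination[OF y x, of "{}" undefined]) simp_all
  then obtain y x P \<pi> where y: "orth_basis \<Gamma> C lC I y" and x: "orth_basis \<Gamma> D lD J x" and P: "P \<subseteq> I"
    and \<pi>: "inj_on \<pi> P" "\<pi> ` P \<subseteq> J" and A: "\<forall>i\<in>P. A (y i) = x (\<pi> i)" "\<forall>i\<in>I - P. A (y i) = \<zero>\<^bsub>D\<^esub>"
    by (elim exE conjE) (rule that)
  define y' :: "'i + 'j \<Rightarrow> 'c" where "y' = case_sum y undefined"
  define x' :: "'i + 'j \<Rightarrow> 'd" where "x' = case_sum (x \<circ> \<pi>) x"
  have "orth_basis \<Gamma> C lC (Inl ` I) y'"
    by (rule C.orth_basis_reindex[OF y, of "projl"])
      (auto simp: y'_def bij_betw_def inj_on_def image_image)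
  moreover have "orth_basis \<Gamma> D lD (Inl ` P \<union> Inr ` (J - \<pi> ` P)) x'"
  proof (rule D.orth_basis_reindex[OF x, of "case_sum \<pi> id"])
    have "case_sum \<pi> id ` (Inl ` P \<union> Inr ` (J - \<pi> ` P)) = J"
      using \<pi>(2) by (auto simp: image_Un image_image)
    moreover have "inj_on (case_sum \<pi> id) (Inl ` P \<union> Inr ` (J - \<pi> ` P))"
      using \<pi>(1) by (intro inj_onI) (auto dest: inj_onD)
    ultimately show "bij_betw (case_sum \<pi> id) (Inl ` P \<union> Inr ` (J - \<pi> ` P)) J"
      by (simp add: bij_betw_def)
  qed (auto simp: x'_def)
  ultimately have "svd_family (Inl ` I) y' (Inl ` P \<union> Inr ` (J - \<pi> ` P)) x' (Inl ` P)"
    using P A by (auto simp: svd_family_def y'_def x'_def)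
  then show ?thesis by blast
qed

end

subsection \<open>Independence of the singular value decomposition\<close>

text \<open>One equation is solved for an unknown with nonzero coefficient and substituted into the
  others. The lemma is applied over the coefficient field, to leading coefficients.\<close>

lemma underdetermined_system:
  fixes M :: "'j \<Rightarrow> 'i \<Rightarrow> 'k::field"
  assumes "finite J" "finite I" "card J < card I"
  shows "\<exists>c. (\<exists>i\<in>I. c i \<noteq> 0) \<and> (\<forall>j\<in>J. (\<Sum>i\<in>I. M j i * c i) = 0)"
  using assms
proof (induction J arbitrary: I M)
  case empty
  then obtain i where "i \<in> I" by fastforce
  then show ?case by (intro exI[of _ "\<lambda>_. 1"]) auto
next
  case (insert r J)
  have cJ: "card J < card I" using insert by simp
  show ?case
  proof (cases "\<exists>p\<in>I. M r p \<noteq> 0")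
    case False
    obtain c where "\<exists>i\<in>I. c i \<noteq> 0" "\<forall>j\<in>J. (\<Sum>i\<in>I. M j i * c i) = 0"
      using insert.IH[OF insert.prems(1) cJ] by blast
    then show ?thesis using False by (intro exI[of _ c]) auto
  next
    case True
    then obtain p where p: "p \<in> I" "M r p \<noteq> 0" by blast
    let ?I = "I - {p}"
    have "card J < card ?I" using insert p by simp
    then obtain c where c: "\<exists>i\<in>?I. c i \<noteq> 0"
      "\<forall>j\<in>J. (\<Sum>i\<in>?I. (M j i - M j p * M r i / M r p) * c i) = 0"
      using insert.IH[of ?I "\<lambda>j i. M j i - M j p * M r i / M r p"] insert.prems by auto
    define z where "z = - (\<Sum>i\<in>?I. M r i * c i) / M r p"
    have sum: "(\<Sum>i\<in>I. M j i * (c(p := z)) i) = M j p * z + (\<Sum>i\<in>?I. M j i * c i)" for j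
      using insert.prems p by (subst sum.remove[of I p]) (auto intro!: sum.cong)
    have "(\<Sum>i\<in>I. M r i * (c(p := z)) i) = 0"
      unfolding sum using p by (simp add: z_def)
    moreover have "(\<Sum>i\<in>I. M j i * (c(p := z)) i) = 0" if "j \<in> J" for j
    proof -
      have "(\<Sum>i\<in>?I. (M j i - M j p * M r i / M r p) * c i) =
          (\<Sum>i\<in>?I. M j i * c i) - (\<Sum>i\<in>?I. M j p / M r p * (M r i * c i))"
        by (simp add: algebra_simps flip: sum_subtractf)
      also have "\<dots> = (\<Sum>i\<in>?I. M j i * c i) + M j p * z"
        unfolding z_def sum_distrib_left[symmetric] by simp
      finally show ?thesis using c(2) that sum[of j] by (simp add: add.commute)
    qed
    moreover have "\<exists>i\<in>I. (c(p := z)) i \<noteq> 0" using c(1) by auto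
    ultimately show ?thesis by (intro exI[of _ "c(p := z)"]) auto
  qed
qed

context novikov_linear_map
begin

lemma svd_familyD:
  assumes "svd_family I y J x P"
  shows "orth_basis \<Gamma> C lC I y" "orth_basis \<Gamma> D lD J x" "P \<subseteq> I" "P \<subseteq> J"
    "\<And>i. i \<in> P \<Longrightarrow> A (y i) = x i" "\<And>i. i \<in> I - P \<Longrightarrow> A (y i) = \<zero>\<^bsub>D\<^esub>"
  using assms by (auto simp: svd_family_def)

lemma svd_image:
  assumes sv: "svd_family I y J x P" and a: "a \<in> I \<rightarrow> \<Lambda>"
  shows "A (lin_comb C a y I) = lin_comb D a x P"
proof -
  note d = svd_familyD[OF sv]
  have fin: "finite I" and ycl: "y \<in> I \<rightarrow> carrier C" and xcl: "x \<in> P \<rightarrow> carrier D"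
    using C.orth_basis_finite[OF d(1)] C.orth_basis_closed[OF d(1)] D.orth_basis_closed[OF d(2)] d(4) by auto
  have "A (lin_comb C a y I) = lin_comb D a (\<lambda>i. A (y i)) I"
    by (rule hom_lin_comb[OF a ycl])
  also have "\<dots> = lin_comb D a (\<lambda>i. A (y i)) P"
    by (rule D.lin_comb_mono_neutral) (use fin d a ycl in \<open>auto simp: Pi_iff\<close>)
  also have "\<dots> = lin_comb D a x P"
    by (rule D.lin_comb_cong) (use d a xcl in auto)
  finally show ?thesis .
qed

definition bars :: "('i \<Rightarrow> 'c) \<Rightarrow> ('i \<Rightarrow> 'd) \<Rightarrow> 'i set \<Rightarrow> real \<Rightarrow> real set \<Rightarrow> 'i set" where
  "bars y x P a S = {i\<in>P. real_of_ereal (lD (x i)) - a \<in> \<Gamma> \<and>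
     real_of_ereal (lC (y i)) - real_of_ereal (lD (x i)) \<in> S}"

text \<open>With \<open>S\<close> the gaps up to \<open>L\<close>, this cardinality is the dimension over the coefficient field of
  \<open>A(C\<^sub>\<le>\<^sub>a\<^sub>+\<^sub>L) \<inter> D\<^sub>\<le>\<^sub>a\<close> modulo \<open>D\<^sub><\<^sub>a\<close>, read off from leading coefficients.\<close>

lemma card_bars_le:
  assumes sv: "svd_family (I :: 'i set) y J x P" and sv': "svd_family (I' :: 'j set) y' J' x' P'"
    and down: "\<And>s t. s \<in> S \<Longrightarrow> t \<le> s \<Longrightarrow> t \<in> S"
  shows "card (bars y x P a S) \<le> card (bars y' x' P' a S)"
proof (rule ccontr)
  note d = svd_familyD[OF sv] and d' = svd_familyD[OF sv']
  let ?N = "bars y x P a S" and ?N' = "bars y' x' P' a S"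
  assume "\<not> card ?N \<le> card ?N'"
  then have less: "card ?N' < card ?N" by simp
  have fin: "finite I" "finite J" "finite I'" "finite J'"
    using C.orth_basis_finite D.orth_basis_finite d(1,2) d'(1,2) by blast+
  have ycl: "y \<in> I \<rightarrow> carrier C" and y'cl: "y' \<in> I' \<rightarrow> carrier C" and xcl: "x \<in> J \<rightarrow> carrier D"
    and x'cl: "x' \<in> J' \<rightarrow> carrier D"
    using C.orth_basis_closed D.orth_basis_closed d(1,2) d'(1,2) by blast+
  have NP: "?N \<subseteq> P" "?N' \<subseteq> P'" by (auto simp: bars_def)
  have finP: "finite P" "finite P'" using fin d(3) d'(3) finite_subset by blast+
  have finN: "finite ?N" "finite ?N'" using NP finP finite_subset by blast+
  define u where "u i = real_of_ereal (lC (y i))" for i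
  define t where "t i = real_of_ereal (lD (x i))" for i
  define u' where "u' i = real_of_ereal (lC (y' i))" for i
  define t' where "t' i = real_of_ereal (lD (x' i))" for i
  have lCy: "lC (y i) = ereal (u i)" if "i \<in> I" for i using C.orth_basis_real[OF d(1) that] by (simp add: u_def)
  have lDx: "lD (x i) = ereal (t i)" if "i \<in> J" for i using D.orth_basis_real[OF d(2) that] by (simp add: t_def)
  have lCy': "lC (y' i) = ereal (u' i)" if "i \<in> I'" for i
    using C.orth_basis_real[OF d'(1) that] by (simp add: u'_def)
  have lDx': "lD (x' i) = ereal (t' i)" if "i \<in> J'" for i
    using D.orth_basis_real[OF d'(2) that] by (simp add: t'_def)
  have N: "t i - a \<in> \<Gamma>" "u i - t i \<in> S" "i \<in> P" "i \<in> I" "i \<in> J" if "i \<in> ?N" for i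
    using that d(3,4) by (auto simp: bars_def t_def u_def)
  have N'I: "i \<in> ?N'" if "t' i - a \<in> \<Gamma>" "u' i - t' i \<in> S" "i \<in> P'" for i
    using that by (auto simp: bars_def t'_def u'_def)
  \<comment> \<open>The monomial of degree \<open>t i - a\<close>, which moves \<open>x i\<close> to
    level \<open>a\<close> and \<open>y i\<close> to \<open>a\<close> plus its gap.\<close>
  define T :: "'k \<Rightarrow> 'i \<Rightarrow> real \<Rightarrow> 'k" where "T c i = (\<lambda>h. if h = t i - a then c else 0)" for c i
  have Tcl: "T c i \<in> \<Lambda>" if "i \<in> ?N" for c i unfolding T_def by (rule single_closed[OF N(1)[OF that]])
  have "\<forall>i\<in>?N. \<exists>m\<in>I' \<rightarrow> \<Lambda>. T 1 i \<odot>\<^bsub>C\<^esub> y i = lin_comb C m y' I'"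
  proof
    fix i assume i: "i \<in> ?N"
    then have "y i \<in> carrier C" using ycl N(4) by auto
    then have "T 1 i \<odot>\<^bsub>C\<^esub> y i \<in> carrier C" using Tcl[OF i, of 1] by simp
    then show "\<exists>m\<in>I' \<rightarrow> \<Lambda>. T 1 i \<odot>\<^bsub>C\<^esub> y i = lin_comb C m y' I'"
      using C.orth_basis_spanE[OF d'(1)] by metis
  qed
  from bchoice[OF this[unfolded Bex_def]]
  obtain m where m: "\<And>i. i \<in> ?N \<Longrightarrow> m i \<in> I' \<rightarrow> \<Lambda>"
    "\<And>i. i \<in> ?N \<Longrightarrow> T 1 i \<odot>\<^bsub>C\<^esub> y i = lin_comb C (m i) y' I'"
    by blast
  \<comment> \<open>A term of the second decomposition can reach level \<open>a\<close> in
    \<open>D\<close> only through its coefficient in degree \<open>t' j - a\<close>. There are fewer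
    equations than unknowns, so these coefficients can be made to vanish for all \<open>j\<close> in
    \<open>?N'\<close> at once.\<close>
  obtain c where c: "\<exists>i\<in>?N. c i \<noteq> 0" "\<forall>j\<in>?N'. (\<Sum>i\<in>?N. m i j (t' j - a) * c i) = 0"
    using underdetermined_system[OF finN(2,1) less, of "\<lambda>j i. m i j (t' j - a)"] by blast
  define e where "e i = (if i \<in> ?N then T (c i) i else \<zero>\<^bsub>novikov \<Gamma>\<^esub>)" for i
  have e: "e i \<in> \<Lambda>" for i using Tcl by (simp add: e_def)
  define v where "v = lin_comb C e y I"
  have v_N: "v = lin_comb C e y ?N"
    unfolding v_def
    by (rule C.lin_comb_mono_neutral) (use fin e N ycl in \<open>auto simp: Pi_iff e_def\<close>)
  define f where "f N j = (\<lambda>h. \<Sum>i\<in>N. c i * m i j h)" for N j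
  \<comment> \<open>The numbers \<open>c i\<close> act as monomials of degree zero, so the
    coefficient functions of the expansions combine degree by degree.\<close>
  have "lin_comb C (f N) y' I' = lin_comb C e y N \<and> f N \<in> I' \<rightarrow> \<Lambda>" if "finite N" "N \<subseteq> ?N" for N
    using that
  proof (induction N)
    case empty
    have "f {} = (\<lambda>j. \<zero>\<^bsub>novikov \<Gamma>\<^esub>)" by (simp add: f_def C.zero_nov fun_eq_iff)
    then show ?case using y'cl by (auto simp: Pi_iff intro!: C.lin_comb_zero)
  next
    case (insert i N)
    then have i: "i \<in> ?N" and IH: "lin_comb C (f N) y' I' = lin_comb C e y N" "f N \<in> I' \<rightarrow> \<Lambda>" by auto
    have yi: "y i \<in> carrier C" using ycl N(4)[OF i] by auto
    let ?k = "\<lambda>h. if h = 0 then c i else 0"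
    have k: "?k \<in> \<Lambda>" by (rule single_closed) (use C.subgroup in \<open>simp add: real_subgroup_def\<close>)
    have km: "(\<lambda>j. ?k \<otimes>\<^bsub>novikov \<Gamma>\<^esub> m i j) \<in> I' \<rightarrow> \<Lambda>" using k m(1)[OF i] by auto
    have f: "f (insert i N) = (\<lambda>j. ?k \<otimes>\<^bsub>novikov \<Gamma>\<^esub> m i j \<oplus>\<^bsub>novikov \<Gamma>\<^esub> f N j)"
      using insert by (simp add: f_def novikov_sel fun_eq_iff novikov_mult_single)
    have ei: "e i = ?k \<otimes>\<^bsub>novikov \<Gamma>\<^esub> T 1 i"
      using i by (auto simp: e_def T_def novikov_sel fun_eq_iff novikov_mult_single)
    have "lin_comb C (f (insert i N)) y' I' =
        lin_comb C (\<lambda>j. ?k \<otimes>\<^bsub>novikov \<Gamma>\<^esub> m i j) y' I' \<oplus>\<^bsub>C\<^esub> lin_comb C e y N"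
      unfolding f C.lin_comb_add[OF km IH(2) y'cl] IH(1) ..
    also have "lin_comb C (\<lambda>j. ?k \<otimes>\<^bsub>novikov \<Gamma>\<^esub> m i j) y' I' = ?k \<odot>\<^bsub>C\<^esub> (T 1 i \<odot>\<^bsub>C\<^esub> y i)"
      unfolding C.lin_comb_smult[OF k m(1)[OF i] y'cl] m(2)[OF i] ..
    also have "\<dots> = e i \<odot>\<^bsub>C\<^esub> y i"
      unfolding ei using k Tcl[OF i] yi by (simp add: C.smult_assoc1)
    also have "e i \<odot>\<^bsub>C\<^esub> y i \<oplus>\<^bsub>C\<^esub> lin_comb C e y N = lin_comb C e y (insert i N)"
    proof (rule C.lin_comb_insert[symmetric])
      show "y \<in> insert i N \<rightarrow> carrier C" using insert.prems N(4) ycl by auto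
    qed (use insert e in auto)
    finally have "lin_comb C (f (insert i N)) y' I' = lin_comb C e y (insert i N)" .
    moreover have "f (insert i N) \<in> I' \<rightarrow> \<Lambda>" unfolding f using km IH(2) by auto
    ultimately show ?case by blast
  qed
  from this[OF finN(1)] have v_f: "v = lin_comb C (f ?N) y' I'" and f: "f ?N \<in> I' \<rightarrow> \<Lambda>"
    using v_N by auto
  have f0: "f ?N j (t' j - a) = 0" if "j \<in> ?N'" for j
    using c(2) that by (simp add: f_def mult.commute)
  have Av: "A v = lin_comb D e x J"
  proof -
    have "A v = lin_comb D e x P" unfolding v_def by (rule svd_image[OF sv]) (use e in auto)
    also have "\<dots> = lin_comb D e x J"
      by (rule D.lin_comb_mono_neutral[symmetric])
        (use fin d(4) e xcl NP in \<open>auto simp: Pi_iff e_def\<close>)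
    finally show ?thesis .
  qed
  have nuT: "nu (e i) = ereal (t i - a)" if "i \<in> ?N" "c i \<noteq> 0" for i
    using nu_single[OF that(2), of "t i - a"] that(1) by (simp add: e_def T_def)
  have e0: "e i = \<zero>\<^bsub>novikov \<Gamma>\<^esub>" if "\<not> (i \<in> ?N \<and> c i \<noteq> 0)" for i
    using that by (auto simp: e_def T_def C.zero_nov fun_eq_iff)
  obtain i0 where i0: "i0 \<in> ?N" "c i0 \<noteq> 0" using c(1) by blast
  \<comment> \<open>Orthogonality of \<open>x\<close> forbids cancellation: one term at level
    \<open>a\<close> keeps \<open>A v\<close> at that level.\<close>
  have "lD (e i0 \<odot>\<^bsub>D\<^esub> x i0) = ereal a"
    using D.norm_smult[OF e, of "x i0" i0] xcl N(5)[OF i0(1)] nuT[OF i0] lDx by auto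
  then have ge: "ereal a \<le> lD (A v)"
    unfolding Av using D.orth_basis_le[OF d(2), of e i0] e N(5)[OF i0(1)] by auto
  have le: "lD (A v) \<le> ereal a"
    unfolding Av
  proof (rule D.norm_lin_comb_le[OF fin(2) _ xcl])
    fix i assume i: "i \<in> J"
    then have xi: "x i \<in> carrier D" using xcl by auto
    show "lD (e i \<odot>\<^bsub>D\<^esub> x i) \<le> ereal a"
    proof (cases "i \<in> ?N \<and> c i \<noteq> 0")
      case True
      then show ?thesis using D.norm_smult[OF e xi, of i] nuT[of i] lDx[OF i] by simp
    next
      case False
      then show ?thesis using e0[OF False] xi by simp
    qed
  qed (use e in auto)
  define s where "s = Max ((\<lambda>i. u i - t i) ` ?N)"
  have "s \<in> (\<lambda>i. u i - t i) ` ?N" unfolding s_def using finN i0 by (intro Max_in) auto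
  then have sS: "s \<in> S" using N(2) by auto
  have s_max: "u i - t i \<le> s" if "i \<in> ?N" for i
    unfolding s_def using finN that by (intro Max_ge) auto
  have lv: "lC v \<le> ereal (s + a)"
    unfolding v_def
  proof (rule C.norm_lin_comb_le[OF fin(1) _ ycl])
    fix i assume i: "i \<in> I"
    then have yi: "y i \<in> carrier C" using ycl by auto
    show "lC (e i \<odot>\<^bsub>C\<^esub> y i) \<le> ereal (s + a)"
    proof (cases "i \<in> ?N \<and> c i \<noteq> 0")
      case True
      then have "lC (e i \<odot>\<^bsub>C\<^esub> y i) = ereal (u i - (t i - a))"
        using C.norm_smult[OF e yi, of i] nuT[of i] lCy[OF i] by simp
      then show ?thesis using s_max[of i] True by simp
    next
      case False
      then show ?thesis using e0[OF False] yi by simp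
    qed
  qed (use e in auto)
  have Av': "A v = lin_comb D (f ?N) x' P'"
    unfolding v_f by (rule svd_image[OF sv' f])
  have fP': "f ?N \<in> P' \<rightarrow> \<Lambda>" using f d'(3) by auto
  \<comment> \<open>A term of exact level \<open>a\<close> would have \<open>t' j - a\<close> in
    \<open>\<Gamma>\<close>, and the bound on \<open>lC v\<close> would keep its gap at most
    \<open>s\<close>. Then \<open>j\<close> lies in \<open>?N'\<close>, where the responsible
    coefficient was made zero.\<close>
  have "lD (A v) < ereal a"
    unfolding Av'
  proof (rule D.norm_lin_comb_less[OF finP(2) fP'])
    show "x' \<in> P' \<rightarrow> carrier D" using x'cl d'(4) by auto
    fix j assume j: "j \<in> P'"
    then have jI: "j \<in> I'" and jJ: "j \<in> J'" using d'(3,4) by auto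
    have xj: "x' j \<in> carrier D" and yj: "y' j \<in> carrier C" and fj: "f ?N j \<in> \<Lambda>"
      using x'cl y'cl f jI jJ by auto
    let ?f = "\<lambda>i. if i \<in> P' then f ?N i else \<zero>\<^bsub>novikov \<Gamma>\<^esub>"
    have "lD (?f j \<odot>\<^bsub>D\<^esub> x' j) \<le> lD (lin_comb D ?f x' J')"
      by (rule D.orth_basis_le[OF d'(2) _ jJ]) (use fP' in \<open>auto simp: Pi_iff\<close>)
    then have "lD (f ?N j \<odot>\<^bsub>D\<^esub> x' j) \<le> ereal a"
      using j le D.lin_comb_extend[OF fin(4) d'(4) fP' x'cl] Av' by simp
    moreover have "lD (f ?N j \<odot>\<^bsub>D\<^esub> x' j) \<noteq> ereal a"
    proof
      assume "lD (f ?N j \<odot>\<^bsub>D\<^esub> x' j) = ereal a"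
      then have eq: "ereal (t' j) - nu (f ?N j) = ereal a" using D.norm_smult[OF fj xj] lDx'[OF jJ] by simp
      then have nuf: "nu (f ?N j) = ereal (t' j - a)" by (cases "nu (f ?N j)") auto
      then have "f ?N j \<noteq> (\<lambda>g. 0)" by auto
      then obtain r where "r \<in> \<Gamma>" "nu (f ?N j) = ereal r" "f ?N j r \<noteq> 0"
        using nu_nonzeroE[OF fj] by metis
      then have r: "t' j - a \<in> \<Gamma>" "f ?N j (t' j - a) \<noteq> 0" using nuf by auto
      have "lC (f ?N j \<odot>\<^bsub>C\<^esub> y' j) \<le> ereal (s + a)"
        using C.orth_basis_le[OF d'(1) f jI] lv v_f by simp
      then have "u' j - t' j \<le> s" using C.norm_smult[OF fj yj] lCy'[OF jI] nuf by simp
      then have "j \<in> ?N'" using N'I[OF r(1) down[OF sS] j] by simp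
      then show False using f0 r(2) by blast
    qed
    ultimately show "lD (f ?N j \<odot>\<^bsub>D\<^esub> x' j) < ereal a" by simp
  qed simp
  then show False using ge by simp
qed

lemma card_bars_eq:
  assumes "svd_family I y J x P" "svd_family I' y' J' x' P'" "\<And>s t. s \<in> S \<Longrightarrow> t \<le> s \<Longrightarrow> t \<in> S"
  shows "card (bars y x P a S) = card (bars y' x' P' a S)"
  using card_bars_le[OF assms(1,2,3)] card_bars_le[OF assms(2,1,3)] by (rule le_antisym)

end

context novikov_normed_space
begin

lemma novikov_linear_map_id: "novikov_linear_map \<Gamma> V l V l (\<lambda>v. v)"
proof -
  have "(\<lambda>v. v) \<in> LinearCombinations.module_hom (novikov \<Gamma>) V V"
    by (auto simp: LinearCombinations.module_hom_def)
  then show ?thesis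
    by (intro novikov_linear_map.intro linear_map.intro mod_hom.intro mod_hom_axioms.intro) unfold_locales
qed

lemma card_levels_eq:
  assumes w: "orth_basis \<Gamma> V l I w" and w': "orth_basis \<Gamma> V l I' w'"
  shows "card {i\<in>I. real_of_ereal (l (w i)) - a \<in> \<Gamma>} = card {i\<in>I'. real_of_ereal (l (w' i)) - a \<in> \<Gamma>}"
proof -
  note id = novikov_linear_map_id
  have "novikov_linear_map.svd_family \<Gamma> V l V l (\<lambda>v. v) I w I w I"
    "novikov_linear_map.svd_family \<Gamma> V l V l (\<lambda>v. v) I' w' I' w' I'"
    using assms by (auto simp: novikov_linear_map.svd_family_def[OF id])
  from novikov_linear_map.card_bars_eq[OF id this, of UNIV a] show ?thesis
    by (simp add: novikov_linear_map.bars_def[OF id])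
qed

end

section \<open>Barcodes of unordered decompositions\<close>

definition family_barcode ::
  "real set \<Rightarrow> ('c \<Rightarrow> ereal) \<Rightarrow> ('d \<Rightarrow> ereal) \<Rightarrow> ('i \<Rightarrow> 'c) \<Rightarrow> 'i set \<Rightarrow> ('i \<Rightarrow> 'd) \<Rightarrow> 'i set \<Rightarrow>
   (real set \<times> ereal) multiset" where
  "family_barcode \<Gamma> lC lD y J x P =
     image_mset (\<lambda>i. (real_coset \<Gamma> (real_of_ereal (lD (x i))), lC (y i) - lD (x i))) (mset_set P) +
     image_mset (\<lambda>i. (real_coset \<Gamma> (real_of_ereal (lD (x i))), \<infinity>)) (mset_set (J - P))"

lemma real_coset_eq_iff:
  assumes "real_subgroup \<Gamma>"
  shows "real_coset \<Gamma> s = real_coset \<Gamma> t \<longleftrightarrow> s - t \<in> \<Gamma>"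
proof
  assume "real_coset \<Gamma> s = real_coset \<Gamma> t"
  moreover have "s \<in> real_coset \<Gamma> s" using assms by (force simp: real_coset_def real_subgroup_def)
  ultimately show "s - t \<in> \<Gamma>" by (auto simp: real_coset_def)
next
  have sub: "real_coset \<Gamma> s \<subseteq> real_coset \<Gamma> t" if "s - t \<in> \<Gamma>" for s t
  proof
    fix z assume "z \<in> real_coset \<Gamma> s"
    then obtain g where g: "g \<in> \<Gamma>" "z = s + g" by (auto simp: real_coset_def)
    then have "(s - t) + g \<in> \<Gamma>" using that assms unfolding real_subgroup_def by blast
    then have "t + ((s - t) + g) \<in> real_coset \<Gamma> t" unfolding real_coset_def by (rule imageI)
    then show "z \<in> real_coset \<Gamma> t" using g by simp
  qed
  assume st: "s - t \<in> \<Gamma>"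
  then have "- (s - t) \<in> \<Gamma>" using assms unfolding real_subgroup_def by blast
  then show "real_coset \<Gamma> s = real_coset \<Gamma> t" using sub[OF st] sub[of t s] by simp
qed

context novikov_linear_map
begin

text \<open>Multiplicities become differences of counts over downward closed sets of gaps, the
  counts known to be invariant. Subtraction of naturals is exact here because the sets are nested.
  The last two conclusions dispose of the pairs in the ambient type that no bar can equal.\<close>

lemma count_family_barcode:
  assumes sv: "svd_family I y J x P"
  shows "count (family_barcode \<Gamma> lC lD y J x P) (real_coset \<Gamma> a, ereal L) =
      card (bars y x P a {..L}) - card (bars y x P a {..<L})"
    and "count (family_barcode \<Gamma> lC lD y J x P) (real_coset \<Gamma> a, \<infinity>) =
      card {i\<in>J. real_of_ereal (lD (x i)) - a \<in> \<Gamma>} - card (bars y x P a UNIV)"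
    and "count (family_barcode \<Gamma> lC lD y J x P) (c, -\<infinity>) = 0"
    and "c \<notin> range (real_coset \<Gamma>) \<Longrightarrow> count (family_barcode \<Gamma> lC lD y J x P) (c, l) = 0"
proof -
  note d = svd_familyD[OF sv]
  have finJ: "finite J" using D.orth_basis_finite[OF d(2)] .
  have finP: "finite P" using finJ d(4) finite_subset by blast
  have fin: "finite (bars y x P a S)" for a S using finP by (simp add: bars_def)
  have gap: "lC (y i) - lD (x i) = ereal (real_of_ereal (lC (y i)) - real_of_ereal (lD (x i)))" if "i \<in> P" for i
    using C.orth_basis_real[OF d(1), of i] D.orth_basis_real[OF d(2), of i] that d(3,4)
    by (metis ereal_minus(1) subsetD)
  note co = real_coset_eq_iff[OF C.subgroup]
  note ct = count_image_mset_eq_card_vimage[OF finP] count_image_mset_eq_card_vimage[OF finite_Diff[OF finJ]]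
  have finite_part: "card {i\<in>P. (real_coset \<Gamma> (real_of_ereal (lD (x i))), lC (y i) - lD (x i)) = (c, l)} = 0"
    if "\<bar>l\<bar> = \<infinity>" for c l
    using that gap by (auto simp: card_eq_0_iff)
  have infinite_part: "card {i\<in>J - P. (real_coset \<Gamma> (real_of_ereal (lD (x i))), \<infinity>) = (c, l)} = 0"
    if "l \<noteq> \<infinity>" for c l
    using that by (auto simp: card_eq_0_iff)
  have "bars y x P a {..L} - bars y x P a {..<L} =
      {i\<in>P. (real_coset \<Gamma> (real_of_ereal (lD (x i))), lC (y i) - lD (x i)) = (real_coset \<Gamma> a, ereal L)}"
    using gap co by (auto simp: bars_def)
  moreover have "bars y x P a {..<L} \<subseteq> bars y x P a {..L}" by (auto simp: bars_def)
  ultimately show "count (family_barcode \<Gamma> lC lD y J x P) (real_coset \<Gamma> a, ereal L) =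
      card (bars y x P a {..L}) - card (bars y x P a {..<L})"
    using card_Diff_subset[OF fin, of a "{..<L}" "bars y x P a {..L}"] infinite_part[of "ereal L"]
    by (simp add: family_barcode_def ct)
  have "{i\<in>J. real_of_ereal (lD (x i)) - a \<in> \<Gamma>} - bars y x P a UNIV =
      {i\<in>J - P. (real_coset \<Gamma> (real_of_ereal (lD (x i))), \<infinity>) = (real_coset \<Gamma> a, \<infinity> :: ereal)}"
    using co by (auto simp: bars_def)
  moreover have "bars y x P a UNIV \<subseteq> {i\<in>J. real_of_ereal (lD (x i)) - a \<in> \<Gamma>}"
    using d(4) by (auto simp: bars_def)
  ultimately show "count (family_barcode \<Gamma> lC lD y J x P) (real_coset \<Gamma> a, \<infinity>) =
      card {i\<in>J. real_of_ereal (lD (x i)) - a \<in> \<Gamma>} - card (bars y x P a UNIV)"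
    using card_Diff_subset[OF fin, of a UNIV "{i\<in>J. real_of_ereal (lD (x i)) - a \<in> \<Gamma>}"]
      finite_part[of \<infinity>]
    by (simp add: family_barcode_def ct)
  show "count (family_barcode \<Gamma> lC lD y J x P) (c, -\<infinity>) = 0"
    using finite_part[of "-\<infinity>" c] infinite_part[of "-\<infinity>" c] by (simp add: family_barcode_def ct)
  show "count (family_barcode \<Gamma> lC lD y J x P) (c, l) = 0" if "c \<notin> range (real_coset \<Gamma>)"
    using that by (auto simp: family_barcode_def count_eq_zero_iff)
qed

theorem family_barcode_unique:
  assumes sv: "svd_family I y J x P" and sv': "svd_family I' y' J' x' P'"
  shows "family_barcode \<Gamma> lC lD y J x P = family_barcode \<Gamma> lC lD y' J' x' P'"
proof (rule multiset_eqI)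
  fix b :: "real set \<times> ereal"
  obtain c L where b: "b = (c, L)" by (cases b)
  show "count (family_barcode \<Gamma> lC lD y J x P) b = count (family_barcode \<Gamma> lC lD y' J' x' P') b"
  proof (cases "c \<in> range (real_coset \<Gamma>)")
    case True
    then obtain a where a: "c = real_coset \<Gamma> a" by blast
    have bars: "card (bars y x P a {..l}) = card (bars y' x' P' a {..l})"
      "card (bars y x P a {..<l}) = card (bars y' x' P' a {..<l})"
      "card (bars y x P a UNIV) = card (bars y' x' P' a UNIV)" for l
      by (rule card_bars_eq[OF sv sv'], simp)+
    show ?thesis
      using D.card_levels_eq[OF svd_familyD(2)[OF sv] svd_familyD(2)[OF sv'], of a]
      by (cases L) (simp_all add: b a count_family_barcode[OF sv] count_family_barcode[OF sv'] bars)
  qed (simp add: b count_family_barcode(4)[OF sv] count_family_barcode(4)[OF sv'])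
qed

end

subsection \<open>Lists and families\<close>

context novikov_normed_space
begin

lemma orth_basis_coeff_unique:
  assumes w: "orth_basis \<Gamma> V l I w" and a: "a \<in> I \<rightarrow> \<Lambda>" and b: "b \<in> I \<rightarrow> \<Lambda>"
    and eq: "lin_comb V a w I = lin_comb V b w I" and i: "i \<in> I"
  shows "a i = b i"
proof -
  let ?m = "\<ominus>\<^bsub>novikov \<Gamma>\<^esub> \<one>\<^bsub>novikov \<Gamma>\<^esub> :: real \<Rightarrow> 'k"
  have cl: "w \<in> I \<rightarrow> carrier V" using orth_basis_closed[OF w] .
  have mb: "(\<lambda>i. ?m \<otimes>\<^bsub>novikov \<Gamma>\<^esub> b i) \<in> I \<rightarrow> \<Lambda>" using b by auto
  have "lin_comb V (\<lambda>i. a i \<oplus>\<^bsub>novikov \<Gamma>\<^esub> ?m \<otimes>\<^bsub>novikov \<Gamma>\<^esub> b i) w I =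
      lin_comb V b w I \<oplus>\<^bsub>V\<^esub> ?m \<odot>\<^bsub>V\<^esub> lin_comb V b w I"
    unfolding lin_comb_add[OF a mb cl] lin_comb_smult[OF R.a_inv_closed[OF R.one_closed] b cl] eq ..
  also have "\<dots> = \<zero>\<^bsub>V\<^esub>" using b cl by (simp add: smult_minus_1 M.r_neg)
  finally have "a i \<oplus>\<^bsub>novikov \<Gamma>\<^esub> ?m \<otimes>\<^bsub>novikov \<Gamma>\<^esub> b i = \<zero>\<^bsub>novikov \<Gamma>\<^esub>"
    by (rule orth_basis_coeff_zero[OF w _ _ i, rotated]) (use a mb in auto)
  moreover have "a i \<in> \<Lambda>" "b i \<in> \<Lambda>" using a b i by auto
  ultimately show ?thesis by (simp add: R.l_minus R.add.inv_solve_right' flip: R.minus_eq)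
qed

text \<open>The passage between the lists of the definitions and families. From the family side,
  distinctness and independence both come from uniqueness of coefficients, and the equation with the
  supremum splits into the ultrametric bound and the recorded inequality.\<close>

lemma orthogonal_basis_iff:
  "orthogonal_basis \<Gamma> V l ws \<longleftrightarrow> orth_basis \<Gamma> V l {..<length ws} ((!) ws)"
proof
  assume ob: "orthogonal_basis \<Gamma> V l ws"
  then have dist: "distinct ws" and basis: "basis (set ws)" and ol: "orthogonal_list \<Gamma> V l ws"
    by (auto simp: orthogonal_basis_def)
  have sub: "set ws \<subseteq> carrier V" using ol by (simp add: orthogonal_list_def)
  have cl: "(!) ws \<in> {..<length ws} \<rightarrow> carrier V" using sub by auto
  show "orth_basis \<Gamma> V l {..<length ws} ((!) ws)"
    unfolding orth_basis_def
  proof (intro conjI ballI)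
    show "ws ! i \<noteq> \<zero>\<^bsub>V\<^esub>" if "i \<in> {..<length ws}" for i
      using vs_zero_lin_dep[OF sub] basis that unfolding basis_def by (metis lessThan_iff nth_mem)
    fix a i assume a: "a \<in> {..<length ws} \<rightarrow> \<Lambda>" and i: "i \<in> {..<length ws}"
    have "l (lin_comb V a ((!) ws) {..<length ws}) = (SUP i\<in>{..<length ws}. l (a i \<odot>\<^bsub>V\<^esub> ws ! i))"
      using ol a unfolding orthogonal_list_def lin_comb_def by (auto simp: Pi_iff)
    then show "l (a i \<odot>\<^bsub>V\<^esub> ws ! i) \<le> l (lin_comb V a ((!) ws) {..<length ws})"
      using i by (auto intro: SUP_upper)
  next
    fix v assume "v \<in> carrier V"
    then have "v \<in> span (set ws)" using basis unfolding basis_def by simp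
    then obtain a where a: "a \<in> set ws \<rightarrow> \<Lambda>" "lincomb a (set ws) = v"
      using finite_in_span[OF _ sub] by auto
    have "lin_comb V (\<lambda>i. a (ws ! i)) ((!) ws) {..<length ws} = lin_comb V a (\<lambda>v. v) (set ws)"
      by (rule lin_comb_reindex_bij[OF bij_betw_nth[OF dist refl refl]]) (use a sub in auto)
    also have "\<dots> = v" using a(2) by (simp add: lin_comb_def lincomb_def)
    finally show "\<exists>a\<in>{..<length ws} \<rightarrow> \<Lambda>. v = lin_comb V a ((!) ws) {..<length ws}"
      using a(1) by (intro bexI[of _ "\<lambda>i. a (ws ! i)"]) auto
  qed (use cl in auto)
next
  assume w: "orth_basis \<Gamma> V l {..<length ws} ((!) ws)"
  have cl: "(!) ws \<in> {..<length ws} \<rightarrow> carrier V" using orth_basis_closed[OF w] .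
  then have sub: "set ws \<subseteq> carrier V" by (auto simp: in_set_conv_nth)
  have dist: "distinct ws"
    unfolding distinct_conv_nth
  proof (intro allI impI)
    fix i j assume ij: "i < length ws" "j < length ws" "i \<noteq> j"
    show "ws ! i \<noteq> ws ! j"
    proof
      assume eq: "ws ! i = ws ! j"
      \<comment> \<open>Equal entries in two positions would give one vector two coefficient
        families, differing at \<open>i\<close>.\<close>
      let ?a = "\<lambda>k. if k = i then \<one>\<^bsub>novikov \<Gamma>\<^esub> else \<zero>\<^bsub>novikov \<Gamma>\<^esub> :: real \<Rightarrow> 'k"
      let ?b = "\<lambda>k. if k = j then \<one>\<^bsub>novikov \<Gamma>\<^esub> else \<zero>\<^bsub>novikov \<Gamma>\<^esub> :: real \<Rightarrow> 'k"
      have "?a i = ?b i"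
        by (rule orth_basis_coeff_unique[OF w])
          (use ij cl eq lin_comb_single[of "{..<length ws}" i "(!) ws"]
            lin_comb_single[of "{..<length ws}" j "(!) ws"] in auto)
      then show False using ij by simp
    qed
  qed
  have lc: "lincomb a (set ws) = lin_comb V (\<lambda>i. a (ws ! i)) ((!) ws) {..<length ws}"
    if "a \<in> set ws \<rightarrow> \<Lambda>" for a
  proof -
    have "lin_comb V (\<lambda>i. a (ws ! i)) ((!) ws) {..<length ws} = lin_comb V a (\<lambda>v. v) (set ws)"
      by (rule lin_comb_reindex_bij[OF bij_betw_nth[OF dist refl refl]]) (use that sub in auto)
    then show ?thesis by (simp add: lin_comb_def lincomb_def)
  qed
  have "lin_indpt (set ws)"
  proof (rule finite_lin_indpt2[OF _ sub])
    fix a :: "'c \<Rightarrow> real \<Rightarrow> 'k" assume a: "a \<in> set ws \<rightarrow> \<Lambda>" "lincomb a (set ws) = \<zero>\<^bsub>V\<^esub>"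
    have "a (ws ! i) = \<zero>\<^bsub>novikov \<Gamma>\<^esub>" if "i < length ws" for i
      using orth_basis_coeff_zero[OF w, of "\<lambda>i. a (ws ! i)" i] a lc[OF a(1)] that by (auto simp: Pi_iff)
    then show "\<forall>v\<in>set ws. a v = \<zero>\<^bsub>novikov \<Gamma>\<^esub>" by (auto simp: in_set_conv_nth)
  qed simp
  moreover have "span (set ws) = carrier V"
  proof
    show "span (set ws) \<subseteq> carrier V" using finite_span[OF _ sub] lincomb_closed[OF sub] by auto
    show "carrier V \<subseteq> span (set ws)"
    proof
      fix v assume "v \<in> carrier V"
      then obtain a where a: "a \<in> {..<length ws} \<rightarrow> \<Lambda>" "v = lin_comb V a ((!) ws) {..<length ws}"
        by (rule orth_basis_spanE[OF w])
      \<comment> \<open>Moves coefficients from positions to vectors, which is unambiguous because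
        the entries are distinct.\<close>
      define b where "b v = a (inv_into {..<length ws} ((!) ws) v)" for v
      have bij: "bij_betw ((!) ws) {..<length ws} (set ws)" by (rule bij_betw_nth[OF dist refl refl])
      have b: "b \<in> set ws \<rightarrow> \<Lambda>"
        using a(1) bij_betwE[OF bij_betw_inv_into[OF bij]] unfolding b_def by blast
      have "b (ws ! i) = a i" if "i < length ws" for i
        using bij_betw_inv_into_left[OF bij] that by (simp add: b_def)
      then have "lincomb b (set ws) = v"
        unfolding lc[OF b] a(2) by (intro lin_comb_cong) (use a cl in auto)
      then show "v \<in> span (set ws)" using finite_span[OF _ sub] b by auto
    qed
  qed
  ultimately have "basis (set ws)" using sub by (simp add: basis_def)
  moreover have "orthogonal_list \<Gamma> V l ws"
    unfolding orthogonal_list_def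
  proof (intro conjI allI impI)
    fix a :: "nat \<Rightarrow> real \<Rightarrow> 'k" assume "\<forall>i<length ws. a i \<in> \<Lambda>"
    then have a: "a \<in> {..<length ws} \<rightarrow> \<Lambda>" by auto
    have "l (lin_comb V a ((!) ws) {..<length ws}) = (SUP i\<in>{..<length ws}. l (a i \<odot>\<^bsub>V\<^esub> ws ! i))"
    proof (rule antisym)
      show "l (lin_comb V a ((!) ws) {..<length ws}) \<le> (SUP i\<in>{..<length ws}. l (a i \<odot>\<^bsub>V\<^esub> ws ! i))"
        by (rule norm_lin_comb_le) (use a cl in \<open>auto intro: SUP_upper\<close>)
      show "(SUP i\<in>{..<length ws}. l (a i \<odot>\<^bsub>V\<^esub> ws ! i)) \<le> l (lin_comb V a ((!) ws) {..<length ws})"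
        by (rule SUP_least) (rule orth_basis_le[OF w a])
    qed
    then show "l (\<Oplus>\<^bsub>V\<^esub>i\<in>{..<length ws}. a i \<odot>\<^bsub>V\<^esub> ws ! i) = (SUP i\<in>{..<length ws}. l (a i \<odot>\<^bsub>V\<^esub> ws ! i))"
      by (simp add: lin_comb_def)
  qed (rule sub)
  ultimately show "orthogonal_basis \<Gamma> V l ws" using dist by (simp add: orthogonal_basis_def)
qed

lemma orthogonal_basis_map:
  assumes "orth_basis \<Gamma> V l I w" "distinct is" "set is = I"
  shows "orthogonal_basis \<Gamma> V l (map w is)"
proof -
  have "bij_betw ((!) is) {..<length (map w is)} I"
    using bij_betw_nth[OF assms(2) refl assms(3)[symmetric]] by simp
  then have "orth_basis \<Gamma> V l {..<length (map w is)} ((!) (map w is))"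
    by (rule orth_basis_reindex[OF assms(1)]) simp
  then show ?thesis by (simp only: orthogonal_basis_iff)
qed

lemma orthogonal_basis_dim:
  assumes "orthogonal_basis \<Gamma> V l ws"
  shows "dim = length ws" "fin_dim"
proof -
  have b: "basis (set ws)" and "distinct ws" using assms by (auto simp: orthogonal_basis_def)
  then show "dim = length ws" using dim_basis[OF _ b] by (simp add: distinct_card)
  show "fin_dim" using b unfolding basis_def fin_dim_def by blast
qed

end

section \<open>Kernels and images of decomposed maps\<close>

context novikov_linear_map
begin

lemma normed_ker: "novikov_normed_space \<Gamma> (C\<lparr>carrier := ker\<rparr>) lC"
  by (rule C.novikov_normed_subspace[OF kerT_is_subspace])

lemma normed_im: "novikov_normed_space \<Gamma> (D\<lparr>carrier := im\<rparr>) lD"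
  by (rule D.novikov_normed_subspace[OF imT_is_subspace])

text \<open>The image of a combination carries its \<open>P\<close>-coefficients over to the
  independent vectors \<open>x\<close>, so they vanish on the kernel.\<close>

lemma orth_basis_ker:
  assumes sv: "svd_family I y J x P"
  shows "orth_basis \<Gamma> (C\<lparr>carrier := ker\<rparr>) lC (I - P) y"
proof (rule C.orth_basis_subspace)
  note d = svd_familyD[OF sv]
  show "orth_basis \<Gamma> C lC I y" by (fact d)
  show "y \<in> I - P \<rightarrow> ker" using C.orth_basis_mem[OF d(1)] d(6) by (auto simp: ker_def)
  fix a i assume a: "a \<in> I \<rightarrow> \<Lambda>" and ker: "lin_comb C a y I \<in> ker" and i: "i \<in> I - (I - P)"
  have aP: "a \<in> P \<rightarrow> \<Lambda>" using a d(3) by auto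
  let ?a = "\<lambda>i. if i \<in> P then a i else \<zero>\<^bsub>novikov \<Gamma>\<^esub>"
  have "lin_comb D a x P = \<zero>\<^bsub>D\<^esub>" using ker svd_image[OF sv a] by (simp add: ker_def)
  then have "lin_comb D ?a x J = \<zero>\<^bsub>D\<^esub>"
    using D.lin_comb_extend[OF D.orth_basis_finite[OF d(2)] d(4) aP D.orth_basis_closed[OF d(2)]] by simp
  then have "?a i = \<zero>\<^bsub>novikov \<Gamma>\<^esub>"
    by (rule D.orth_basis_coeff_zero[OF d(2), rotated]) (use aP d(4) i in \<open>auto simp: Pi_iff\<close>)
  then show "a i = \<zero>\<^bsub>novikov \<Gamma>\<^esub>" using i by simp
qed (use kerT_is_subspace in auto)

lemma orth_basis_im:
  assumes sv: "svd_family I y J x P"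
  shows "orth_basis \<Gamma> (D\<lparr>carrier := im\<rparr>) lD P x"
proof (rule D.orth_basis_subspace)
  note d = svd_familyD[OF sv]
  show "orth_basis \<Gamma> D lD J x" by (fact d)
  show "x \<in> P \<rightarrow> im"
  proof
    fix i assume i: "i \<in> P"
    then have "y i \<in> carrier C" using C.orth_basis_mem[OF d(1)] d(3) by auto
    then show "x i \<in> im" unfolding d(5)[OF i, symmetric] im_def by (rule imageI)
  qed
  show "P \<subseteq> J" by (fact d)
  fix a i assume a: "a \<in> J \<rightarrow> \<Lambda>" and im: "lin_comb D a x J \<in> im" and i: "i \<in> J - P"
  obtain v where v: "v \<in> carrier C" "lin_comb D a x J = A v" using im by (auto simp: im_def)
  obtain b where b: "b \<in> I \<rightarrow> \<Lambda>" "v = lin_comb C b y I" by (rule C.orth_basis_spanE[OF d(1) v(1)])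
  have bP: "b \<in> P \<rightarrow> \<Lambda>" using b d(3) by auto
  let ?b = "\<lambda>i. if i \<in> P then b i else \<zero>\<^bsub>novikov \<Gamma>\<^esub>"
  have eq: "lin_comb D a x J = lin_comb D ?b x J"
    using v(2) svd_image[OF sv b(1)] b(2)
      D.lin_comb_extend[OF D.orth_basis_finite[OF d(2)] d(4) bP D.orth_basis_closed[OF d(2)]] by simp
  have "a i = ?b i"
    by (rule D.orth_basis_coeff_unique[OF d(2) a _ eq]) (use bP d(4) i in \<open>auto simp: Pi_iff\<close>)
  then show "a i = \<zero>\<^bsub>novikov \<Gamma>\<^esub>" using i by simp
qed (rule imT_is_subspace)

lemma is_svd_imp_svd_family:
  assumes svd: "is_svd \<Gamma> C lC D lD A ys xs" and r: "r = linear_rank \<Gamma> C D A"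
  shows "svd_family {..<length ys} ((!) ys) {..<length xs} ((!) xs) {..<r}"
    and "svd_barcode \<Gamma> lC lD r ys xs = family_barcode \<Gamma> lC lD ((!) ys) {..<length xs} ((!) xs) {..<r}"
proof -
  interpret K: novikov_normed_space \<Gamma> "C\<lparr>carrier := ker\<rparr>" lC by (rule normed_ker)
  interpret I: novikov_normed_space \<Gamma> "D\<lparr>carrier := im\<rparr>" lD by (rule normed_im)
  have ys: "orthogonal_basis \<Gamma> C lC ys" and xs: "orthogonal_basis \<Gamma> D lD xs"
    and kr: "orthogonal_basis \<Gamma> (C\<lparr>carrier := ker\<rparr>) lC (drop r ys)"
    and ir: "orthogonal_basis \<Gamma> (D\<lparr>carrier := im\<rparr>) lD (take r xs)"
    and A: "\<And>i. i < r \<Longrightarrow> A (ys ! i) = xs ! i"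
    using svd by (auto simp: is_svd_def Let_def r)
  have dim: "I.dim = r" by (simp add: r linear_rank_def)
  have rx: "r \<le> length xs" using I.orthogonal_basis_dim(1)[OF ir] dim by simp
  \<comment> \<open>Rank-nullity, with \<open>drop r ys\<close> as basis of the kernel. Subtraction
    being truncated, the equation says precisely that \<open>r\<close> is at most the length of
    \<open>ys\<close>.\<close>
  have "r + (length ys - r) = length ys"
    using rank_nullity[OF C.orthogonal_basis_dim(2)[OF ys]] C.orthogonal_basis_dim(1)[OF ys]
      K.orthogonal_basis_dim(1)[OF kr] dim by simp
  then have ry: "r \<le> length ys" by simp
  have "A (ys ! i) = \<zero>\<^bsub>D\<^esub>" if i: "i \<in> {..<length ys} - {..<r}" for i
  proof -
    have "drop r ys ! (i - r) \<in> set (drop r ys)" using i by (intro nth_mem) auto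
    moreover have "set (drop r ys) \<subseteq> ker" using kr by (simp add: orthogonal_basis_def orthogonal_list_def)
    moreover have "drop r ys ! (i - r) = ys ! i" using i ry by simp
    ultimately show ?thesis by (auto simp: ker_def)
  qed
  then show "svd_family {..<length ys} ((!) ys) {..<length xs} ((!) xs) {..<r}"
    using ys xs rx ry A by (auto simp: svd_family_def C.orthogonal_basis_iff D.orthogonal_basis_iff)
  let ?f = "\<lambda>i. (real_coset \<Gamma> (real_of_ereal (lD (xs ! i))), if i < r then lC (ys ! i) - lD (xs ! i) else \<infinity>)"
  have "{..<length xs} = {..<r} \<union> ({..<length xs} - {..<r})" using rx by auto
  then have "mset_set {..<length xs} = mset_set {..<r} + mset_set ({..<length xs} - {..<r})"
    by (metis Diff_disjoint finite_Diff finite_lessThan mset_set_Union)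
  then have "svd_barcode \<Gamma> lC lD r ys xs =
      image_mset ?f (mset_set {..<r}) + image_mset ?f (mset_set ({..<length xs} - {..<r}))"
    by (simp add: svd_barcode_def)
  also have "\<dots> = family_barcode \<Gamma> lC lD ((!) ys) {..<length xs} ((!) xs) {..<r}"
    unfolding family_barcode_def by (intro arg_cong2[where f = "(+)"] image_mset_cong) auto
  finally show "svd_barcode \<Gamma> lC lD r ys xs = family_barcode \<Gamma> lC lD ((!) ys) {..<length xs} ((!) xs) {..<r}" .
qed

lemma svd_family_imp_is_svd:
  assumes sv: "svd_family I y J x P"
  shows "\<exists>ys xs. is_svd \<Gamma> C lC D lD A ys xs"
proof -
  interpret K: novikov_normed_space \<Gamma> "C\<lparr>carrier := ker\<rparr>" lC by (rule normed_ker)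
  interpret I: novikov_normed_space \<Gamma> "D\<lparr>carrier := im\<rparr>" lD by (rule normed_im)
  note d = svd_familyD[OF sv]
  have fin: "finite I" "finite J" using C.orth_basis_finite[OF d(1)] D.orth_basis_finite[OF d(2)] .
  have finP: "finite P" using fin d(3) finite_subset by blast
  define gap where "gap i = real_of_ereal (lC (y i)) - real_of_ereal (lD (x i))" for i
  obtain ps0 where ps0: "set ps0 = P" "distinct ps0" using finite_distinct_list[OF finP] by blast
  \<comment> \<open>Sorting is ascending, so the negated gap as key puts the largest gap
    first.\<close>
  define ps where "ps = sort_key (\<lambda>i. - gap i) ps0"
  have ps: "set ps = P" "distinct ps" "sorted (map (\<lambda>i. - gap i) ps)"
    using ps0 by (simp_all add: ps_def)
  obtain ks where ks: "set ks = I - P" "distinct ks" using finite_distinct_list[of "I - P"] fin by blast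
  obtain js where js: "set js = J - P" "distinct js" using finite_distinct_list[of "J - P"] fin by blast
  define ys where "ys = map y (ps @ ks)"
  define xs where "xs = map x (ps @ js)"
  have ys: "orthogonal_basis \<Gamma> C lC ys"
    unfolding ys_def by (rule C.orthogonal_basis_map[OF d(1)]) (use ps ks d(3) in auto)
  have xs: "orthogonal_basis \<Gamma> D lD xs"
    unfolding xs_def by (rule D.orthogonal_basis_map[OF d(2)]) (use ps js d(4) in auto)
  have kr: "orthogonal_basis \<Gamma> (C\<lparr>carrier := ker\<rparr>) lC (map y ks)"
    by (rule K.orthogonal_basis_map[OF orth_basis_ker[OF sv] ks(2,1)])
  have ir: "orthogonal_basis \<Gamma> (D\<lparr>carrier := im\<rparr>) lD (map x ps)"
    by (rule I.orthogonal_basis_map[OF orth_basis_im[OF sv] ps(2,1)])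
  have r: "linear_rank \<Gamma> C D A = length ps"
    using I.orthogonal_basis_dim(1)[OF ir] by (simp add: linear_rank_def)
  have nth: "ys ! i = y (ps ! i)" "xs ! i = x (ps ! i)" "ps ! i \<in> P" if "i < length ps" for i
    using that ps(1) by (auto simp: ys_def xs_def nth_append)
  have gap: "lC (ys ! i) - lD (xs ! i) = ereal (gap (ps ! i))" if "i < length ps" for i
    using C.orth_basis_real[OF d(1), of "ps ! i"] D.orth_basis_real[OF d(2), of "ps ! i"]
      nth[OF that] d(3,4) unfolding gap_def by (metis ereal_minus(1) subsetD)
  have "lC (ys ! j) - lD (xs ! j) \<le> lC (ys ! i) - lD (xs ! i)" if "i \<le> j" "j < length ps" for i j
    using gap[of i] gap[of j] sorted_nth_mono[OF ps(3), of i j] that by simp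
  then have "is_svd \<Gamma> C lC D lD A ys xs"
    using ys xs kr ir nth d(5) by (simp add: is_svd_def Let_def r) (simp add: ys_def xs_def)
  then show ?thesis by blast
qed

end

text \<open>For the definite description, existence comes from listing the given family, and
  uniqueness from comparing every listed decomposition with it.\<close>

lemma verbose_barcode_eq:
  assumes lm: "novikov_linear_map \<Gamma> (chains X (k + 1)) (filt X (k + 1)) (cycles X k) (filt X k) (bdry X (k + 1))"
    and sv: "novikov_linear_map.svd_family \<Gamma> (chains X (k + 1)) (filt X (k + 1)) (cycles X k) (filt X k)
      (bdry X (k + 1)) I y J x P"
  shows "verbose_barcode \<Gamma> X k = family_barcode \<Gamma> (filt X (k + 1)) (filt X k) y J x P"
proof -
  interpret novikov_linear_map \<Gamma> "chains X (k + 1)" "filt X (k + 1)" "cycles X k" "filt X k" "bdry X (k + 1)"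
    by (rule lm)
  have eq: "svd_barcode \<Gamma> (filt X (k + 1)) (filt X k)
      (linear_rank \<Gamma> (chains X (k + 1)) (cycles X k) (bdry X (k + 1))) ys xs =
      family_barcode \<Gamma> (filt X (k + 1)) (filt X k) y J x P"
    if "is_svd \<Gamma> (chains X (k + 1)) (filt X (k + 1)) (cycles X k) (filt X k) (bdry X (k + 1)) ys xs" for ys xs
    using is_svd_imp_svd_family[OF that refl] family_barcode_unique[OF _ sv] by simp
  show ?thesis
    unfolding verbose_barcode_def
    using svd_family_imp_is_svd[OF sv] by (intro the_equality) (metis eq)+
qed

subsection \<open>Dual spaces\<close>

lemma regular_module_sel [simp]:
  "carrier (regular_module R) = carrier R" "zero (regular_module R) = zero R"
  "add (regular_module R) = add R" "smult (regular_module R) = mult R"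
  by (simp_all add: regular_module_def)

lemma (in cring) module_regular: "Module.module R (regular_module R)"
  by (rule module_criteria) (auto simp: a_ac m_assoc l_distr r_distr intro: is_cring r_neg bexI[of _ "\<ominus> _"])

text \<open>The scalars form a normed space themselves, so the ultrametric bounds for combinations
  also apply to the values of a functional.\<close>

lemma novikov_normed_regular:
  assumes \<Gamma>: "real_subgroup \<Gamma>"
  shows "novikov_normed_space \<Gamma> (regular_module (novikov \<Gamma> :: (real \<Rightarrow> 'k::field) ring)) (\<lambda>a. - nu a)"
proof -
  let ?R = "novikov \<Gamma> :: (real \<Rightarrow> 'k) ring"
  interpret field ?R by (rule field_novikov[OF \<Gamma>])
  have vs: "vectorspace ?R (regular_module ?R)"
    by (intro vectorspace.intro module_regular) unfold_locales
  have "nonarch_normed_space \<Gamma> (regular_module ?R) (\<lambda>a. - nu a)"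
    unfolding nonarch_normed_space_def regular_module_sel
  proof (intro conjI ballI vs)
    fix a b :: "real \<Rightarrow> 'k" assume a: "a \<in> carrier ?R" and b: "b \<in> carrier ?R"
    show "- nu a \<noteq> \<infinity>" by (metis nu_not_minf ereal_uminus_uminus uminus_ereal.simps(3))
    show "(- nu a = -\<infinity>) = (a = \<zero>\<^bsub>?R\<^esub>)" by (simp add: nu_eq_infinity_iff novikov_sel)
    show "- nu (a \<otimes>\<^bsub>?R\<^esub> b) = - nu b - nu a"
      using nu_mult[OF a b] nu_not_minf[of a] nu_not_minf[of b]
      by (cases "nu a"; cases "nu b") (auto simp: novikov_sel)
    have "min (nu a) (nu b) \<le> nu (a \<oplus>\<^bsub>?R\<^esub> b)"
      using nu_add_ge[OF a b] add.m_closed[OF a b] by (simp add: novikov_sel)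
    then show "- nu (a \<oplus>\<^bsub>?R\<^esub> b) \<le> max (- nu a) (- nu b)"
      by (auto simp: min_le_iff_disj le_max_iff_disj)
  qed
  then show ?thesis using vs \<Gamma> by (simp add: novikov_normed_space_def novikov_normed_space_axioms_def)
qed

section \<open>Norm and coordinates on the dual space\<close>

context novikov_normed_space
begin

abbreviation dual where "dual \<equiv> dual_space \<Gamma> V"
abbreviation scalars where "scalars \<equiv> regular_module (novikov \<Gamma> :: (real \<Rightarrow> 'k) ring)"

lemma dual_sel:
  "carrier dual = LinearCombinations.module_hom (novikov \<Gamma>) V scalars \<inter> extensional (carrier V)"
  "zero dual = (\<lambda>v\<in>carrier V. \<zero>\<^bsub>novikov \<Gamma>\<^esub>)"
  "add dual = (\<lambda>f g. \<lambda>v\<in>carrier V. f v \<oplus>\<^bsub>novikov \<Gamma>\<^esub> g v)"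
  "smult dual = (\<lambda>c f. \<lambda>v\<in>carrier V. c \<otimes>\<^bsub>novikov \<Gamma>\<^esub> f v)"
  by (simp_all add: dual_space_def R.func_space_def)

lemma dual_mod_hom:
  assumes "\<phi> \<in> carrier dual"
  shows "mod_hom (novikov \<Gamma>) V scalars \<phi>"
  using assms R.module_regular
  by (intro mod_hom.intro mod_hom_axioms.intro) (auto simp: dual_sel intro: module_axioms)

lemma dual_closed: "\<phi> \<in> carrier dual \<Longrightarrow> v \<in> carrier V \<Longrightarrow> \<phi> v \<in> \<Lambda>"
  by (auto simp: dual_sel LinearCombinations.module_hom_def)

lemma vectorspace_dual: "vectorspace (novikov \<Gamma>) dual"
proof -
  let ?F = "R.func_space (carrier V)"
  have mF: "Module.module (novikov \<Gamma>) ?F" by (rule R.func_space_is_module)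
  interpret F: Module.module "novikov \<Gamma>" ?F by (rule mF)
  have sm: "LinearCombinations.submodule (novikov \<Gamma>)
      (LinearCombinations.module_hom (novikov \<Gamma>) V scalars \<inter> extensional (carrier V)) ?F"
    by (rule LinearCombinations.submodule.intro[OF mF])
      (auto simp: R.func_space_def LinearCombinations.module_hom_def Pi_iff extensional_def
        R.a_ac R.m_ac R.r_distr R.l_distr)
  have "Module.module (novikov \<Gamma>) dual"
    unfolding dual_space_def by (rule F.submodule_is_module[OF sm])
  then show ?thesis by (rule vectorspace.intro[OF _ field_novikov[OF subgroup]])
qed

text \<open>Evaluation at \<open>v\<close> is a linear map on the dual, hence commutes with
  combinations.\<close>

lemma lin_comb_dual_apply:
  assumes a: "a \<in> I \<rightarrow> \<Lambda>" and d: "d \<in> I \<rightarrow> carrier dual" and v: "v \<in> carrier V"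
  shows "lin_comb dual a d I v = lin_comb scalars a (\<lambda>i. d i v) I"
proof -
  interpret dual: vectorspace "novikov \<Gamma>" dual by (rule vectorspace_dual)
  have "(\<lambda>\<phi>. \<phi> v) \<in> LinearCombinations.module_hom (novikov \<Gamma>) dual scalars"
    using v dual_closed by (auto simp: LinearCombinations.module_hom_def dual_sel(2-))
  then have "mod_hom (novikov \<Gamma>) dual scalars (\<lambda>\<phi>. \<phi> v)"
    using R.module_regular
    by (intro mod_hom.intro mod_hom_axioms.intro) (auto intro: dual.module_axioms)
  from mod_hom.hom_lin_comb[OF this a d] show ?thesis .
qed

lemma lin_comb_scalars_single:
  assumes "finite I" "j \<in> I" "a \<in> I \<rightarrow> \<Lambda>"
    "\<And>i. i \<in> I \<Longrightarrow> b i = (if i = j then \<one>\<^bsub>novikov \<Gamma>\<^esub> else \<zero>\<^bsub>novikov \<Gamma>\<^esub>)"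
  shows "lin_comb scalars a b I = a j"
proof -
  interpret S: novikov_normed_space \<Gamma> scalars "\<lambda>a. - nu a" by (rule novikov_normed_regular[OF subgroup])
  have aj: "a j \<in> \<Lambda>" using assms by auto
  have "lin_comb scalars a b I = lin_comb scalars a b {j}"
    by (rule S.lin_comb_mono_neutral) (use assms in \<open>auto simp: Pi_iff\<close>)
  then show ?thesis using aj assms(2,4) S.lin_comb_insert[of "{}" j a b] by simp
qed

lemma dual_eqI:
  assumes w: "orth_basis \<Gamma> V l I w" and \<phi>: "\<phi> \<in> carrier dual" and \<psi>: "\<psi> \<in> carrier dual"
    and eq: "\<And>i. i \<in> I \<Longrightarrow> \<phi> (w i) = \<psi> (w i)"
  shows "\<phi> = \<psi>"
proof (rule extensionalityI[of _ "carrier V"])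
  show "\<phi> \<in> extensional (carrier V)" "\<psi> \<in> extensional (carrier V)" using \<phi> \<psi> by (auto simp: dual_sel)
  fix v assume "v \<in> carrier V"
  then obtain a where a: "a \<in> I \<rightarrow> \<Lambda>" "v = lin_comb V a w I" by (rule orth_basis_spanE[OF w])
  interpret S: novikov_normed_space \<Gamma> scalars "\<lambda>a. - nu a" by (rule novikov_normed_regular[OF subgroup])
  have cl: "w \<in> I \<rightarrow> carrier V" by (rule orth_basis_closed[OF w])
  have "lin_comb scalars a (\<lambda>i. \<phi> (w i)) I = lin_comb scalars a (\<lambda>i. \<psi> (w i)) I"
    by (rule S.lin_comb_cong) (use eq a cl dual_closed[OF \<psi>] in auto)
  then show "\<phi> v = \<psi> v"
    unfolding a(2) using mod_hom.hom_lin_comb[OF dual_mod_hom[OF \<phi>] a(1) cl]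
      mod_hom.hom_lin_comb[OF dual_mod_hom[OF \<psi>] a(1) cl] by simp
qed

text \<open>Reduces the supremum over all nonzero vectors to a finite one. For \<open>v\<close> with
  coefficients \<open>a\<close>, the ultrametric inequality bounds \<open>\<phi> v\<close> by the
  values on the terms \<open>a i \<odot> w i\<close>, and orthogonality bounds the norms of these
  terms by \<open>l v\<close>.\<close>

lemma dual_filt_eq:
  assumes w: "orth_basis \<Gamma> V l I w" and \<phi>: "\<phi> \<in> carrier dual"
  shows "dual_filt V l \<phi> = (SUP i\<in>I. - l (w i) - nu (\<phi> (w i)))"
proof (rule antisym)
  have cl: "w \<in> I \<rightarrow> carrier V" by (rule orth_basis_closed[OF w])
  interpret S: novikov_normed_space \<Gamma> scalars "\<lambda>a. - nu a" by (rule novikov_normed_regular[OF subgroup])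
  show "(SUP i\<in>I. - l (w i) - nu (\<phi> (w i))) \<le> dual_filt V l \<phi>"
    unfolding dual_filt_def
    by (rule SUP_mono) (use orth_basis_mem[OF w] orth_basis_nonzero[OF w] in blast)
  let ?t = "SUP i\<in>I. - l (w i) - nu (\<phi> (w i))"
  show "dual_filt V l \<phi> \<le> ?t"
    unfolding dual_filt_def
  proof (rule SUP_least)
    fix v assume "v \<in> carrier V - {\<zero>\<^bsub>V\<^esub>}"
    then have v: "v \<in> carrier V" "v \<noteq> \<zero>\<^bsub>V\<^esub>" by auto
    obtain r where r: "l v = ereal r" using norm_realE[OF v] .
    obtain a where a: "a \<in> I \<rightarrow> \<Lambda>" "v = lin_comb V a w I" by (rule orth_basis_spanE[OF w v(1)])
    have "- nu (lin_comb scalars a (\<lambda>i. \<phi> (w i)) I) \<le> ?t + ereal r"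
    proof (rule S.norm_lin_comb_le[OF orth_basis_finite[OF w] a(1)])
      show "(\<lambda>i. \<phi> (w i)) \<in> I \<rightarrow> carrier scalars" using cl dual_closed[OF \<phi>] by auto
      fix i assume i: "i \<in> I"
      then have c: "w i \<in> carrier V" "a i \<in> \<Lambda>" "\<phi> (w i) \<in> \<Lambda>" using cl a dual_closed[OF \<phi>] by auto
      obtain s where s: "l (w i) = ereal s" using norm_realE[OF c(1) orth_basis_nonzero[OF w i]] .
      have "ereal s - nu (a i) \<le> ereal r"
        using orth_basis_le[OF w a(1) i] norm_smult[OF c(2,1)] s r a(2) by simp
      moreover have "- ereal s - nu (\<phi> (w i)) \<le> ?t"
        using i s by (intro SUP_upper2[of i]) auto
      ultimately have "- (nu (a i) + nu (\<phi> (w i))) \<le> ?t + ereal r"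
        using nu_not_minf[of "a i"] nu_not_minf[of "\<phi> (w i)"]
        by (cases "nu (a i)"; cases "nu (\<phi> (w i))"; cases ?t) auto
      then show "- nu (a i \<odot>\<^bsub>scalars\<^esub> \<phi> (w i)) \<le> ?t + ereal r"
        using nu_mult[OF c(2,3)] by (simp add: novikov_sel)
    qed
    then have "- nu (\<phi> v) \<le> ?t + ereal r"
      unfolding a(2) using mod_hom.hom_lin_comb[OF dual_mod_hom[OF \<phi>] a(1) cl] by simp
    then show "- l v - nu (\<phi> v) \<le> ?t"
      using r by (cases "nu (\<phi> v)"; cases ?t) auto
  qed
qed

lemma novikov_normed_dual:
  assumes w: "orth_basis \<Gamma> V l I w"
  shows "novikov_normed_space \<Gamma> dual (dual_filt V l)"
proof -
  interpret dual: vectorspace "novikov \<Gamma>" dual by (rule vectorspace_dual)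
  have mem: "w i \<in> carrier V" if "i \<in> I" for i using orth_basis_mem[OF w that] .
  have real: "\<exists>r. l (w i) = ereal r" if "i \<in> I" for i using orth_basis_real[OF w that] by blast
  have ninf: "- l (w i) - nu a \<noteq> \<infinity>" if "i \<in> I" for i and a :: "real \<Rightarrow> 'k"
    using real[OF that] nu_not_minf[of a] by (cases "nu a") auto
  note filt = dual_filt_eq[OF w]
  have fin: "dual_filt V l \<phi> \<noteq> \<infinity>" if \<phi>: "\<phi> \<in> carrier dual" for \<phi>
  proof (cases "I = {}")
    case False
    have "(SUP i\<in>I. - l (w i) - nu (\<phi> (w i))) \<in> (\<lambda>i. - l (w i) - nu (\<phi> (w i))) ` I"
      using False orth_basis_finite[OF w] by (simp add: cSup_eq_Max Max_in)
    then obtain i where "i \<in> I" "dual_filt V l \<phi> = - l (w i) - nu (\<phi> (w i))" using filt[OF \<phi>] by auto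
    then show ?thesis using ninf[of i "\<phi> (w i)"] by simp
  qed (simp add: filt[OF \<phi>] bot_ereal_def)
  have "nonarch_normed_space \<Gamma> dual (dual_filt V l)"
    unfolding nonarch_normed_space_def
  proof (intro conjI ballI vectorspace_dual fin)
    fix \<phi> assume \<phi>: "\<phi> \<in> carrier dual"
    have "(\<forall>i\<in>I. - l (w i) - nu (\<phi> (w i)) = -\<infinity>) \<longleftrightarrow> (\<forall>i\<in>I. \<phi> (w i) = \<zero>\<^bsub>novikov \<Gamma>\<^esub>)"
    proof (rule ball_cong[OF refl])
      fix i assume "i \<in> I"
      then obtain r where "l (w i) = ereal r" using real by blast
      then show "(- l (w i) - nu (\<phi> (w i)) = -\<infinity>) = (\<phi> (w i) = \<zero>\<^bsub>novikov \<Gamma>\<^esub>)"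
        using nu_eq_infinity_iff[of "\<phi> (w i)"] by (cases "nu (\<phi> (w i))") (auto simp: novikov_sel)
    qed
    also have "\<dots> \<longleftrightarrow> \<phi> = \<zero>\<^bsub>dual\<^esub>"
      using dual_eqI[OF w \<phi> dual.M.zero_closed] mem by (auto simp: dual_sel(2))
    finally show "(dual_filt V l \<phi> = -\<infinity>) = (\<phi> = \<zero>\<^bsub>dual\<^esub>)"
      unfolding filt[OF \<phi>] by (simp add: SUP_bot_conv flip: bot_ereal_def)
    fix \<psi> assume \<psi>: "\<psi> \<in> carrier dual"
    have sum: "\<phi> \<oplus>\<^bsub>dual\<^esub> \<psi> \<in> carrier dual" using \<phi> \<psi> by simp
    show "dual_filt V l (\<phi> \<oplus>\<^bsub>dual\<^esub> \<psi>) \<le> max (dual_filt V l \<phi>) (dual_filt V l \<psi>)"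
      unfolding filt[OF sum]
    proof (rule SUP_least)
      fix i assume i: "i \<in> I"
      have cl: "\<phi> (w i) \<in> \<Lambda>" "\<psi> (w i) \<in> \<Lambda>" using dual_closed \<phi> \<psi> mem[OF i] by auto
      have le: "- l (w i) - nu (\<phi> (w i)) \<le> dual_filt V l \<phi>" "- l (w i) - nu (\<psi> (w i)) \<le> dual_filt V l \<psi>"
        unfolding filt[OF \<phi>] filt[OF \<psi>] using i by (auto intro: SUP_upper)
      have "min (nu (\<phi> (w i))) (nu (\<psi> (w i))) \<le> nu (\<phi> (w i) \<oplus>\<^bsub>novikov \<Gamma>\<^esub> \<psi> (w i))"
        using nu_add_ge[OF cl] R.add.m_closed[OF cl] by (simp add: novikov_sel)
      then have "- l (w i) - nu (\<phi> (w i) \<oplus>\<^bsub>novikov \<Gamma>\<^esub> \<psi> (w i)) \<le>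
          max (- l (w i) - nu (\<phi> (w i))) (- l (w i) - nu (\<psi> (w i)))"
        by (auto simp: min_le_iff_disj le_max_iff_disj intro: ereal_minus_mono)
      also have "\<dots> \<le> max (dual_filt V l \<phi>) (dual_filt V l \<psi>)" using le by (rule max.mono)
      finally show "- l (w i) - nu ((\<phi> \<oplus>\<^bsub>dual\<^esub> \<psi>) (w i)) \<le> max (dual_filt V l \<phi>) (dual_filt V l \<psi>)"
        using mem[OF i] by (simp add: dual_sel(3))
    qed
  next
    fix a \<phi> assume a: "a \<in> \<Lambda>" and \<phi>: "\<phi> \<in> carrier dual"
    have a\<phi>: "a \<odot>\<^bsub>dual\<^esub> \<phi> \<in> carrier dual" using a \<phi> by simp
    have eq: "- l (w i) - nu ((a \<odot>\<^bsub>dual\<^esub> \<phi>) (w i)) = - l (w i) - nu (\<phi> (w i)) + - nu a" if i: "i \<in> I" for i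
      using real[OF i] mem[OF i] nu_mult[OF a dual_closed[OF \<phi> mem[OF i]]]
        nu_not_minf[of a] nu_not_minf[of "\<phi> (w i)"]
      by (cases "nu a"; cases "nu (\<phi> (w i))") (auto simp: dual_sel(4) novikov_sel)
    \<comment> \<open>Taking \<open>- nu a\<close> out of the supremum requires a nonempty index set
      and a summand other than \<open>-\<infinity>\<close>. In the two exceptional cases both sides
      are \<open>-\<infinity>\<close>.\<close>
    show "dual_filt V l (a \<odot>\<^bsub>dual\<^esub> \<phi>) = dual_filt V l \<phi> - nu a"
    proof (cases "nu a = \<infinity> \<or> I = {}")
      case True
      have "dual_filt V l (a \<odot>\<^bsub>dual\<^esub> \<phi>) = -\<infinity>"
      proof (cases "I = {}")
        case False
        then have "nu a = \<infinity>" using True by simp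
        then have "- l (w i) - nu ((a \<odot>\<^bsub>dual\<^esub> \<phi>) (w i)) = bot" if "i \<in> I" for i
          unfolding eq[OF that] using ninf[OF that, of "\<phi> (w i)"] by (auto simp: bot_ereal_def)
        then show ?thesis unfolding filt[OF a\<phi>] by (simp add: SUP_bot_conv flip: bot_ereal_def)
      qed (simp add: filt[OF a\<phi>] bot_ereal_def)
      moreover have "dual_filt V l \<phi> - nu a = -\<infinity>"
        using True fin[OF \<phi>] nu_not_minf[of a]
        by (cases "nu a"; cases "dual_filt V l \<phi>") (auto simp: filt[OF \<phi>] bot_ereal_def)
      ultimately show ?thesis by simp
    next
      case False
      then have "- nu a \<noteq> -\<infinity>" "I \<noteq> {}" by (auto simp: ereal_uminus_eq_reorder)
      have "dual_filt V l (a \<odot>\<^bsub>dual\<^esub> \<phi>) = (SUP i\<in>I. (- l (w i) - nu (\<phi> (w i))) + - nu a)"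
        unfolding filt[OF a\<phi>] using eq by (intro SUP_cong) auto
      also have "\<dots> = dual_filt V l \<phi> + - nu a"
        unfolding filt[OF \<phi>] by (rule SUP_ereal_add_left) fact+
      finally show ?thesis by (simp add: minus_ereal_def)
    qed
  qed
  then show ?thesis
    using vectorspace_dual subgroup by (simp add: novikov_normed_space_def novikov_normed_space_axioms_def)
qed

text \<open>The coordinate functionals. A coefficient family is determined on \<open>I\<close> only,
  so one is chosen, and its value at an index in \<open>I\<close> is independent of the choice. The
  restriction to the carrier makes the functional extensional.\<close>

definition dual_vec :: "'i set \<Rightarrow> ('i \<Rightarrow> 'c) \<Rightarrow> 'i \<Rightarrow> 'c \<Rightarrow> real \<Rightarrow> 'k" where
  "dual_vec I w i = (\<lambda>v\<in>carrier V. (SOME a. a \<in> I \<rightarrow> \<Lambda> \<and> v = lin_comb V a w I) i)"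

lemma dual_vec_lin_comb:
  assumes w: "orth_basis \<Gamma> V l I w" and a: "a \<in> I \<rightarrow> \<Lambda>" and i: "i \<in> I"
  shows "dual_vec I w i (lin_comb V a w I) = a i"
proof -
  let ?P = "\<lambda>b. b \<in> I \<rightarrow> \<Lambda> \<and> lin_comb V a w I = lin_comb V b w I"
  define b where "b = (SOME b. ?P b)"
  have b: "?P b" unfolding b_def by (rule someI[of ?P a]) (use a in simp)
  have "b i = a i"
    by (rule orth_basis_coeff_unique[OF w conjunct1[OF b] a conjunct2[OF b, symmetric] i])
  moreover have "lin_comb V a w I \<in> carrier V" using a orth_basis_closed[OF w] by blast
  ultimately show ?thesis by (simp add: dual_vec_def b_def)
qed

lemma dual_vec_apply:
  assumes w: "orth_basis \<Gamma> V l I w" and i: "i \<in> I" and j: "j \<in> I"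
  shows "dual_vec I w i (w j) = (if i = j then \<one>\<^bsub>novikov \<Gamma>\<^esub> else \<zero>\<^bsub>novikov \<Gamma>\<^esub>)"
  using dual_vec_lin_comb[OF w _ i, of "\<lambda>k. if k = j then \<one>\<^bsub>novikov \<Gamma>\<^esub> else \<zero>\<^bsub>novikov \<Gamma>\<^esub>"]
    lin_comb_single[OF orth_basis_finite[OF w] j orth_basis_closed[OF w]] by simp

lemma dual_vec_closed:
  assumes w: "orth_basis \<Gamma> V l I w" and i: "i \<in> I"
  shows "dual_vec I w i \<in> carrier dual"
proof -
  have cl: "w \<in> I \<rightarrow> carrier V" by (rule orth_basis_closed[OF w])
  have "dual_vec I w i \<in> LinearCombinations.module_hom (novikov \<Gamma>) V scalars"
    unfolding LinearCombinations.module_hom_def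
  proof (intro CollectI conjI allI impI funcsetI)
    fix v assume "v \<in> carrier V"
    then obtain a where a: "a \<in> I \<rightarrow> \<Lambda>" "v = lin_comb V a w I" by (rule orth_basis_spanE[OF w])
    then show "dual_vec I w i v \<in> carrier scalars" using dual_vec_lin_comb[OF w a(1) i] i by auto
  next
    fix u v assume "u \<in> carrier V \<and> v \<in> carrier V"
    then obtain a b where a: "a \<in> I \<rightarrow> \<Lambda>" "u = lin_comb V a w I" and b: "b \<in> I \<rightarrow> \<Lambda>" "v = lin_comb V b w I"
      using orth_basis_spanE[OF w] by metis
    have "(\<lambda>i. a i \<oplus>\<^bsub>novikov \<Gamma>\<^esub> b i) \<in> I \<rightarrow> \<Lambda>" using a b by auto
    from dual_vec_lin_comb[OF w this i]
    show "dual_vec I w i (u \<oplus>\<^bsub>V\<^esub> v) = dual_vec I w i u \<oplus>\<^bsub>scalars\<^esub> dual_vec I w i v"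
      using lin_comb_add[OF a(1) b(1) cl] dual_vec_lin_comb[OF w a(1) i] dual_vec_lin_comb[OF w b(1) i] a(2) b(2)
      by simp
  next
    fix c v assume c: "c \<in> \<Lambda> \<and> v \<in> carrier V"
    then obtain a where a: "a \<in> I \<rightarrow> \<Lambda>" "v = lin_comb V a w I" using orth_basis_spanE[OF w] by metis
    have "(\<lambda>i. c \<otimes>\<^bsub>novikov \<Gamma>\<^esub> a i) \<in> I \<rightarrow> \<Lambda>" using a c by auto
    from dual_vec_lin_comb[OF w this i]
    show "dual_vec I w i (c \<odot>\<^bsub>V\<^esub> v) = c \<odot>\<^bsub>scalars\<^esub> dual_vec I w i v"
      using lin_comb_smult[OF _ a(1) cl, of c] c dual_vec_lin_comb[OF w a(1) i] a(2) by simp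
  qed
  then show ?thesis by (simp add: dual_sel dual_vec_def)
qed

lemma lin_comb_dual_vec_apply:
  assumes w: "orth_basis \<Gamma> V l I w" and a: "a \<in> I \<rightarrow> \<Lambda>" and j: "j \<in> I"
  shows "lin_comb dual a (dual_vec I w) I (w j) = a j"
proof -
  have "lin_comb dual a (dual_vec I w) I (w j) = lin_comb scalars a (\<lambda>i. dual_vec I w i (w j)) I"
    by (rule lin_comb_dual_apply) (use a dual_vec_closed[OF w] orth_basis_mem[OF w j] in auto)
  also have "\<dots> = a j"
    by (rule lin_comb_scalars_single[OF orth_basis_finite[OF w] j a]) (use dual_vec_apply[OF w _ j] in auto)
  finally show ?thesis .
qed

text \<open>A single term agrees with the whole combination at \<open>w i\<close> and vanishes at
  the other basis vectors, so the two finite suprema compare entry by entry. The coefficients of a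
  functional are its values on the basis.\<close>

lemma orth_basis_dual:
  assumes w: "orth_basis \<Gamma> V l I w"
  shows "orth_basis \<Gamma> dual (dual_filt V l) I (dual_vec I w)"
  unfolding orth_basis_def
proof (intro conjI ballI)
  interpret dual: vectorspace "novikov \<Gamma>" dual by (rule vectorspace_dual)
  show d: "dual_vec I w \<in> I \<rightarrow> carrier dual" using dual_vec_closed[OF w] by auto
  show "dual_vec I w i \<noteq> \<zero>\<^bsub>dual\<^esub>" if "i \<in> I" for i
    using dual_vec_apply[OF w that that] orth_basis_mem[OF w that] by (auto simp: dual_sel(2))
  show "dual_filt V l (a i \<odot>\<^bsub>dual\<^esub> dual_vec I w i) \<le> dual_filt V l (lin_comb dual a (dual_vec I w) I)"
    if a: "a \<in> I \<rightarrow> \<Lambda>" and i: "i \<in> I" for a i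
  proof -
    have cl: "a i \<odot>\<^bsub>dual\<^esub> dual_vec I w i \<in> carrier dual" "lin_comb dual a (dual_vec I w) I \<in> carrier dual"
      using a i d by auto
    have "- l (w j) - nu ((a i \<odot>\<^bsub>dual\<^esub> dual_vec I w i) (w j)) \<le>
        - l (w j) - nu (lin_comb dual a (dual_vec I w) I (w j))" if j: "j \<in> I" for j
    proof (rule ereal_minus_mono[OF order_refl])
      have "(a i \<odot>\<^bsub>dual\<^esub> dual_vec I w i) (w j) = (if i = j then a i else \<zero>\<^bsub>novikov \<Gamma>\<^esub>)"
        using a i dual_vec_apply[OF w i j] orth_basis_mem[OF w j] by (auto simp: dual_sel(4) Pi_iff)
      then show "nu (lin_comb dual a (dual_vec I w) I (w j)) \<le> nu ((a i \<odot>\<^bsub>dual\<^esub> dual_vec I w i) (w j))"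
        using lin_comb_dual_vec_apply[OF w a j] by (auto simp: zero_nov)
    qed
    then show ?thesis unfolding dual_filt_eq[OF w cl(1)] dual_filt_eq[OF w cl(2)] by (intro SUP_mono) blast
  qed
  fix \<phi> assume \<phi>: "\<phi> \<in> carrier dual"
  have a: "(\<lambda>i. \<phi> (w i)) \<in> I \<rightarrow> \<Lambda>" using dual_closed[OF \<phi>] orth_basis_mem[OF w] by auto
  have "\<phi> = lin_comb dual (\<lambda>i. \<phi> (w i)) (dual_vec I w) I"
    by (rule dual_eqI[OF w \<phi>]) (use lin_comb_dual_vec_apply[OF w a] a d in auto)
  then show "\<exists>a\<in>I \<rightarrow> \<Lambda>. \<phi> = lin_comb dual a (dual_vec I w) I" using a by blast
qed (use orth_basis_finite[OF w] in auto)

lemma dual_filt_dual_vec: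
  assumes w: "orth_basis \<Gamma> V l I w" and i: "i \<in> I"
  shows "dual_filt V l (dual_vec I w i) = - l (w i)"
  unfolding dual_filt_eq[OF w dual_vec_closed[OF assms]]
proof (rule antisym)
  show "(SUP j\<in>I. - l (w j) - nu (dual_vec I w i (w j))) \<le> - l (w i)"
  proof (rule SUP_least)
    fix j assume j: "j \<in> I"
    obtain r where "l (w j) = ereal r" using orth_basis_real[OF w j] by blast
    then show "- l (w j) - nu (dual_vec I w i (w j)) \<le> - l (w i)"
      using dual_vec_apply[OF w i j] by (auto simp: zero_nov)
  qed
  show "- l (w i) \<le> (SUP j\<in>I. - l (w j) - nu (dual_vec I w i (w j)))"
    by (rule SUP_upper2[OF i]) (use dual_vec_apply[OF w i i] in simp)
qed

end

section \<open>Adjoints and their decompositions\<close>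

context novikov_linear_map
begin

abbreviation adjoint :: "('d \<Rightarrow> real \<Rightarrow> 'k) \<Rightarrow> 'c \<Rightarrow> real \<Rightarrow> 'k" where
  "adjoint \<equiv> \<lambda>\<phi>. \<lambda>v\<in>carrier C. \<phi> (A v)"

lemma linear_map_adjoint: "linear_map (novikov \<Gamma>) D.dual C.dual adjoint"
proof -
  interpret DD: vectorspace "novikov \<Gamma>" D.dual by (rule D.vectorspace_dual)
  interpret CD: vectorspace "novikov \<Gamma>" C.dual by (rule C.vectorspace_dual)
  have "adjoint \<in> LinearCombinations.module_hom (novikov \<Gamma>) D.dual C.dual"
    by (auto simp: LinearCombinations.module_hom_def C.dual_sel D.dual_sel Pi_iff fun_eq_iff)
  then show ?thesis by (intro linear_map.intro mod_hom.intro mod_hom_axioms.intro) unfold_locales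
qed

end

text \<open>A segment from \<open>E\<close> through \<open>C\<close> to \<open>D\<close>, with bases
  assembled from three decompositions. Coordinate functionals outside \<open>Inr\<close> applied to
  \<open>P1\<close> vanish on the image of \<open>B\<close>, since \<open>x1\<close> over
  \<open>P1\<close> spans it; conversely a functional in \<open>Z\<close> vanishes on
  \<open>x1 p\<close> for \<open>p \<in> P1\<close>, so it has no coordinates there. This gives the
  basis of \<open>Z\<close>. Pulling back along \<open>A\<close> turns the coordinate of
  \<open>x2 p\<close> into that of \<open>y2 p\<close>, as both take the same values on the basis of
  \<open>C\<close>, and annihilates the coordinates not indexed by \<open>P2\<close>.\<close>

lemma dual_svd_family:
  fixes C :: "(real \<Rightarrow> 'k::field, 'c) module" and D :: "(real \<Rightarrow> 'k, 'd) module" and E :: "(real \<Rightarrow> 'k, 'e) module"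
  assumes A: "novikov_linear_map \<Gamma> C lC D lD A" and B: "novikov_linear_map \<Gamma> E lE C lC B"
    and wC: "orth_basis \<Gamma> C lC (P2 <+> J1) (case_sum y2 x1)"
    and wD: "orth_basis \<Gamma> D lD (J2 <+> P3) (case_sum x2 y3)"
    and P2: "P2 \<subseteq> J2" "\<And>p. p \<in> P2 \<Longrightarrow> A (y2 p) = x2 p" and x1: "\<And>j. j \<in> J1 \<Longrightarrow> A (x1 j) = \<zero>\<^bsub>D\<^esub>"
    and P1: "P1 \<subseteq> J1" "\<And>p. p \<in> P1 \<Longrightarrow> x1 p \<in> B ` carrier E"
    and im: "\<And>e. e \<in> carrier E \<Longrightarrow> \<exists>b\<in>P1 \<rightarrow> carrier (novikov \<Gamma>). B e = lin_comb C b x1 P1"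
  defines "dA \<equiv> \<lambda>\<phi>. \<lambda>v\<in>carrier C. \<phi> (A v)" and "dB \<equiv> \<lambda>\<phi>. \<lambda>v\<in>carrier E. \<phi> (B v)"
  defines "Z \<equiv> dual_space \<Gamma> C\<lparr>carrier := mod_hom.ker (dual_space \<Gamma> C) (dual_space \<Gamma> E) dB\<rparr>"
  defines "vC \<equiv> novikov_normed_space.dual_vec \<Gamma> C (P2 <+> J1) (case_sum y2 x1)"
    and "vD \<equiv> novikov_normed_space.dual_vec \<Gamma> D (J2 <+> P3) (case_sum x2 y3)"
  shows "novikov_linear_map \<Gamma> (dual_space \<Gamma> D) (dual_filt D lD) Z (dual_filt C lC) dA"
    and "novikov_linear_map.svd_family \<Gamma> (dual_space \<Gamma> D) (dual_filt D lD) Z (dual_filt C lC) dA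
      (J2 <+> P3) vD (Inl ` P2 \<union> Inr ` (J1 - P1)) vC (Inl ` P2)"
proof -
  interpret A: novikov_linear_map \<Gamma> C lC D lD A by (rule A)
  interpret B: novikov_linear_map \<Gamma> E lE C lC B by (rule B)
  note [simp del] = A.f_add A.f_smult B.f_add B.f_smult
  let ?C = "dual_space \<Gamma> C" and ?D = "dual_space \<Gamma> D" and ?E = "dual_space \<Gamma> E"
  let ?\<Lambda> = "carrier (novikov \<Gamma>) :: (real \<Rightarrow> 'k) set"
  let ?wC = "case_sum y2 x1" and ?wD = "case_sum x2 y3"
  let ?I = "P2 <+> J1" and ?J = "J2 <+> P3"
  have nC: "novikov_normed_space \<Gamma> ?C (dual_filt C lC)" by (rule A.C.novikov_normed_dual[OF wC])
  have nD: "novikov_normed_space \<Gamma> ?D (dual_filt D lD)" by (rule A.D.novikov_normed_dual[OF wD])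
  have lB: "linear_map (novikov \<Gamma>) ?C ?E dB" unfolding dB_def by (rule B.linear_map_adjoint)
  have lA: "linear_map (novikov \<Gamma>) ?D ?C dA" unfolding dA_def by (rule A.linear_map_adjoint)
  have hB: "mod_hom (novikov \<Gamma>) ?C ?E dB" using lB by (simp add: linear_map_def)
  have hA: "dA \<in> LinearCombinations.module_hom (novikov \<Gamma>) ?D ?C"
    using lA by (simp add: linear_map_def mod_hom_def mod_hom_axioms_def)
  define K where "K = mod_hom.ker ?C ?E dB"
  have K: "\<phi> \<in> K \<longleftrightarrow> \<phi> \<in> carrier ?C \<and> (\<forall>e\<in>carrier E. \<phi> (B e) = \<zero>\<^bsub>novikov \<Gamma>\<^esub>)" for \<phi>
  proof -
    have "dB \<phi> = \<zero>\<^bsub>?E\<^esub> \<longleftrightarrow> (\<forall>e\<in>carrier E. \<phi> (B e) = \<zero>\<^bsub>novikov \<Gamma>\<^esub>)"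
      by (auto simp: dB_def B.C.dual_sel(2) restrict_def fun_eq_iff)
    then show ?thesis by (simp add: K_def mod_hom.ker_def[OF hB])
  qed
  have Z: "Z = ?C\<lparr>carrier := K\<rparr>" by (simp add: Z_def K_def)
  have sK: "VectorSpace.subspace (novikov \<Gamma>) K ?C" unfolding K_def by (rule linear_map.kerT_is_subspace[OF lB])
  have nZ: "novikov_normed_space \<Gamma> Z (dual_filt C lC)"
    unfolding Z by (rule novikov_normed_space.novikov_normed_subspace[OF nC sK])
  have x1C: "x1 \<in> P1 \<rightarrow> carrier C" using A.C.orth_basis_mem[OF wC, of "Inr _"] P1(1) by auto
  have AB: "A (B e) = \<zero>\<^bsub>D\<^esub>" if e: "e \<in> carrier E" for e
  proof -
    obtain b where b: "b \<in> P1 \<rightarrow> ?\<Lambda>" "B e = lin_comb C b x1 P1" using im[OF e] by blast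
    show ?thesis
      unfolding b(2) A.hom_lin_comb[OF b(1) x1C]
      by (rule A.D.lin_comb_zero) (use b(1) x1 P1(1) in \<open>auto simp: Pi_iff subset_iff\<close>)
  qed
  have dA_K: "dA \<phi> \<in> K" if \<phi>: "\<phi> \<in> carrier ?D" for \<phi>
    unfolding K
  proof (intro conjI ballI)
    show "dA \<phi> \<in> carrier ?C" using hA \<phi> by (auto simp: LinearCombinations.module_hom_def)
    fix e assume e: "e \<in> carrier E"
    have "\<phi> \<zero>\<^bsub>D\<^esub> = \<zero>\<^bsub>novikov \<Gamma>\<^esub>" using mod_hom.f0_is_0[OF A.D.dual_mod_hom[OF \<phi>]] by simp
    then show "dA \<phi> (B e) = \<zero>\<^bsub>novikov \<Gamma>\<^esub>" using AB[OF e] e by (simp add: dA_def)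
  qed
  show lm: "novikov_linear_map \<Gamma> ?D (dual_filt D lD) Z (dual_filt C lC) dA"
  proof -
    have "dA \<in> LinearCombinations.module_hom (novikov \<Gamma>) ?D Z"
      using hA dA_K by (auto simp: LinearCombinations.module_hom_def Z)
    then show ?thesis
      using nD nZ
      by (intro novikov_linear_map.intro linear_map.intro mod_hom.intro mod_hom_axioms.intro)
        (auto simp: novikov_normed_space_def vectorspace_def)
  qed
  have oC: "orth_basis \<Gamma> ?C (dual_filt C lC) ?I vC" unfolding vC_def by (rule A.C.orth_basis_dual[OF wC])
  have oD: "orth_basis \<Gamma> ?D (dual_filt D lD) ?J vD" unfolding vD_def by (rule A.D.orth_basis_dual[OF wD])
  have vC: "vC i \<in> carrier ?C" if "i \<in> ?I" for i
    unfolding vC_def by (rule A.C.dual_vec_closed[OF wC that])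
  have vD: "vD i \<in> carrier ?D" if "i \<in> ?J" for i
    unfolding vD_def by (rule A.D.dual_vec_closed[OF wD that])
  have vC_w: "vC i (?wC j) = (if i = j then \<one>\<^bsub>novikov \<Gamma>\<^esub> else \<zero>\<^bsub>novikov \<Gamma>\<^esub>)" if "i \<in> ?I" "j \<in> ?I" for i j
    unfolding vC_def by (rule A.C.dual_vec_apply[OF wC that])
  have vD_w: "vD i (?wD j) = (if i = j then \<one>\<^bsub>novikov \<Gamma>\<^esub> else \<zero>\<^bsub>novikov \<Gamma>\<^esub>)" if "i \<in> ?J" "j \<in> ?J" for i j
    unfolding vD_def by (rule A.D.dual_vec_apply[OF wD that])
  have vD_x2: "vD i (x2 p) = (if i = Inl p then \<one>\<^bsub>novikov \<Gamma>\<^esub> else \<zero>\<^bsub>novikov \<Gamma>\<^esub>)" if "i \<in> ?J" "p \<in> P2" for i p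
    using vD_w[OF that(1), of "Inl p"] that(2) P2(1) by (simp add: InlI subsetD)
  let ?Q = "Inl ` P2 \<union> Inr ` (J1 - P1)"
  have oZ: "orth_basis \<Gamma> Z (dual_filt C lC) ?Q vC"
    unfolding Z
  proof (rule novikov_normed_space.orth_basis_subspace[OF nC oC sK])
    show "?Q \<subseteq> ?I" by auto
    show "vC \<in> ?Q \<rightarrow> K"
    proof (rule funcsetI)
      fix i assume i: "i \<in> ?Q"
      then have iI: "i \<in> ?I" by auto
      have "vC i (B e) = \<zero>\<^bsub>novikov \<Gamma>\<^esub>" if e: "e \<in> carrier E" for e
      proof -
        interpret S: novikov_normed_space \<Gamma> "regular_module (novikov \<Gamma>) :: (real \<Rightarrow> 'k, _) module" "\<lambda>a. - nu a"
          by (rule novikov_normed_regular[OF A.C.subgroup])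
        obtain b where b: "b \<in> P1 \<rightarrow> ?\<Lambda>" "B e = lin_comb C b x1 P1" using im[OF e] by blast
        have "vC i (x1 p) = \<zero>\<^bsub>novikov \<Gamma>\<^esub>" if "p \<in> P1" for p
        proof -
          have "Inr p \<in> ?I" "i \<noteq> Inr p" using that P1(1) i by auto
          then show ?thesis using vC_w[OF iI, of "Inr p"] by simp
        qed
        then show ?thesis
          unfolding b(2) mod_hom.hom_lin_comb[OF A.C.dual_mod_hom[OF vC[OF iI]] b(1) x1C]
          using b(1) by (intro S.lin_comb_zero[simplified]) (auto simp: Pi_iff)
      qed
      then show "vC i \<in> K" using vC[OF iI] by (simp add: K)
    qed
    fix a i assume a: "a \<in> ?I \<rightarrow> ?\<Lambda>" and aK: "lin_comb ?C a vC ?I \<in> K" and i: "i \<in> ?I - ?Q"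
    obtain p where p: "i = Inr p" "p \<in> P1" using i by auto
    obtain e where e: "e \<in> carrier E" "x1 p = B e" using P1(2)[OF p(2)] by blast
    \<comment> \<open>A coefficient is the value on the corresponding basis vector, here the
      boundary \<open>x1 p\<close>, which functionals in \<open>K\<close> annihilate.\<close>
    have "a i = lin_comb ?C a vC ?I (?wC i)"
      unfolding vC_def by (rule A.C.lin_comb_dual_vec_apply[OF wC a, symmetric]) (use i in auto)
    also have "\<dots> = \<zero>\<^bsub>novikov \<Gamma>\<^esub>" using aK e by (simp add: K p(1))
    finally show "a i = \<zero>\<^bsub>novikov \<Gamma>\<^esub>" .
  qed
  have dA_w: "dA (vD i) (?wC q) = (case q of Inl p \<Rightarrow> vD i (?wD (Inl p)) | Inr _ \<Rightarrow> \<zero>\<^bsub>novikov \<Gamma>\<^esub>)"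
    if i: "i \<in> ?J" and q: "q \<in> ?I" for i q
  proof -
    have "?wC q \<in> carrier C" using A.C.orth_basis_mem[OF wC q] .
    moreover have "vD i \<zero>\<^bsub>D\<^esub> = \<zero>\<^bsub>novikov \<Gamma>\<^esub>" using mod_hom.f0_is_0[OF A.D.dual_mod_hom[OF vD[OF i]]] by simp
    ultimately show ?thesis using q P2(2) x1 by (auto simp: dA_def)
  qed
  have "dA (vD i) = vC i" if "i \<in> Inl ` P2" for i
  proof (rule A.C.dual_eqI[OF wC])
    have i: "i \<in> ?J" "i \<in> ?I" using that P2 by auto
    show "dA (vD i) \<in> carrier ?C" using dA_K[OF vD[OF i(1)]] by (simp add: K)
    show "vC i \<in> carrier ?C" by (rule vC[OF i(2)])
    fix q assume q: "q \<in> ?I"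
    show "dA (vD i) (?wC q) = vC i (?wC q)"
      unfolding dA_w[OF i(1) q] vC_w[OF i(2) q]
      using q that vD_x2[OF i(1)] by (auto split: sum.split)
  qed
  moreover have "dA (vD i) = \<zero>\<^bsub>Z\<^esub>" if "i \<in> ?J - Inl ` P2" for i
  proof -
    have i: "i \<in> ?J" using that by simp
    interpret CD: vectorspace "novikov \<Gamma>" ?C by (rule A.C.vectorspace_dual)
    have "dA (vD i) = \<zero>\<^bsub>?C\<^esub>"
    proof (rule A.C.dual_eqI[OF wC])
      show "dA (vD i) \<in> carrier ?C" using dA_K[OF vD[OF i]] by (simp add: K)
      fix q assume q: "q \<in> ?I"
      have "vD i (?wD (Inl p)) = \<zero>\<^bsub>novikov \<Gamma>\<^esub>" if "q = Inl p" for p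
        using vD_x2[OF i, of p] that q \<open>i \<in> ?J - Inl ` P2\<close> by auto
      then show "dA (vD i) (?wC q) = \<zero>\<^bsub>?C\<^esub> (?wC q)"
        unfolding dA_w[OF i q] using A.C.orth_basis_mem[OF wC q] by (auto simp: A.C.dual_sel(2) split: sum.split)
    qed simp
    then show ?thesis by (simp add: Z)
  qed
  ultimately show "novikov_linear_map.svd_family \<Gamma> ?D (dual_filt D lD) Z (dual_filt C lC) dA ?J vD ?Q vC (Inl ` P2)"
    using oD oZ P2(1) by (auto simp: novikov_linear_map.svd_family_def[OF lm])
qed

subsection \<open>Floer-type complexes\<close>

locale floer_complex =
  fixes \<Gamma> :: "real set" and X :: "('k::field, 'c) filtered_complex"
  assumes subgroup: "real_subgroup \<Gamma>" and floer: "floer_type_complex \<Gamma> X"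
begin

lemma normed_chains: "novikov_normed_space \<Gamma> (chains X n) (filt X n)"
proof -
  have "nonarch_normed_space \<Gamma> (chains X n) (filt X n)"
    using floer by (auto simp: floer_type_complex_def orthogonalizable_def)
  then show ?thesis
    using subgroup
    by (simp add: novikov_normed_space_def novikov_normed_space_axioms_def nonarch_normed_space_def)
qed

lemma chains_basis: "\<exists>I w. orth_basis \<Gamma> (chains X n) (filt X n) (I :: nat set) w"
proof -
  obtain ws where "orthogonal_basis \<Gamma> (chains X n) (filt X n) ws"
    using floer unfolding floer_type_complex_def orthogonalizable_def by blast
  then show ?thesis using novikov_normed_space.orthogonal_basis_iff[OF normed_chains] by blast
qed

text \<open>The degree shift is a hypothesis so that degrees written with \<open>+ 1\<close> and
  with \<open>- 1\<close> both match.\<close>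

lemma boundary_map:
  assumes "m = n + 1"
  shows "novikov_linear_map \<Gamma> (chains X m) (filt X m) (chains X n) (filt X n) (bdry X m)"
proof -
  have "linear_map (novikov \<Gamma>) (chains X m) (chains X (m - 1)) (bdry X m)"
    using floer by (auto simp: floer_type_complex_def)
  then show ?thesis using assms normed_chains by (simp add: novikov_linear_map_def)
qed

text \<open>A description in which no codomain is fixed: the differential into all chains and the
  one into cycles have this same kernel.\<close>

definition kernel :: "int \<Rightarrow> 'c set" where
  "kernel n = {v \<in> carrier (chains X n). bdry X n v = \<zero>\<^bsub>chains X (n - 1)\<^esub>}"

lemma ker_eq:
  assumes "m = n + 1"
  shows "mod_hom.ker (chains X m) (chains X n) (bdry X m) = kernel m"
proof -
  interpret novikov_linear_map \<Gamma> "chains X m" "filt X m" "chains X n" "filt X n" "bdry X m"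
    by (rule boundary_map[OF assms])
  show ?thesis unfolding ker_def kernel_def using assms by simp
qed

lemma cycles_eq: "cycles X n = chains X n\<lparr>carrier := kernel n\<rparr>"
  unfolding cycles_def by (subst ker_eq) simp_all

lemma subspace_kernel: "VectorSpace.subspace (novikov \<Gamma>) (kernel n) (chains X n)"
proof -
  interpret novikov_linear_map \<Gamma> "chains X n" "filt X n" "chains X (n - 1)" "filt X (n - 1)" "bdry X n"
    by (rule boundary_map) simp
  show ?thesis using kerT_is_subspace by (subst ker_eq[of n "n - 1", symmetric]) simp_all
qed

lemma normed_cycles: "novikov_normed_space \<Gamma> (cycles X n) (filt X n)"
  unfolding cycles_eq by (rule novikov_normed_space.novikov_normed_subspace[OF normed_chains subspace_kernel])

lemma boundary_cycles_map:
  assumes m: "m = n + 1"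
  shows "novikov_linear_map \<Gamma> (chains X m) (filt X m) (cycles X n) (filt X n) (bdry X m)"
proof -
  interpret novikov_linear_map \<Gamma> "chains X m" "filt X m" "chains X n" "filt X n" "bdry X m"
    by (rule boundary_map[OF m])
  have "bdry X (m - 1) (bdry X m v) = \<zero>\<^bsub>chains X (m - 2)\<^esub>" if "v \<in> carrier (chains X m)" for v
    using floer that by (simp add: floer_type_complex_def)
  then have "bdry X m \<in> carrier (chains X m) \<rightarrow> kernel n"
    using f_im by (auto simp: kernel_def m)
  then have "bdry X m \<in> LinearCombinations.module_hom (novikov \<Gamma>) (chains X m) (cycles X n)"
    using f_hom by (auto simp: LinearCombinations.module_hom_def cycles_eq)
  then show ?thesis
    using normed_chains[of m] normed_cycles[of n]
    by (intro novikov_linear_map.intro linear_map.intro mod_hom.intro mod_hom_axioms.intro)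
      (auto simp: novikov_normed_space_def vectorspace_def)
qed

lemma ker_cycles_eq:
  assumes m: "m = n + 1"
  shows "mod_hom.ker (chains X m) (cycles X n) (bdry X m) = kernel m"
proof -
  interpret novikov_linear_map \<Gamma> "chains X m" "filt X m" "cycles X n" "filt X n" "bdry X m"
    by (rule boundary_cycles_map[OF m])
  show ?thesis unfolding ker_def kernel_def using m by (simp add: cycles_eq)
qed

abbreviation svd :: "int \<Rightarrow> 'i set \<Rightarrow> ('i \<Rightarrow> 'c) \<Rightarrow> 'i set \<Rightarrow> ('i \<Rightarrow> 'c) \<Rightarrow> 'i set \<Rightarrow> bool" where
  "svd m \<equiv> novikov_linear_map.svd_family \<Gamma> (chains X m) (filt X m) (cycles X (m - 1)) (filt X (m - 1)) (bdry X m)"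

text \<open>Elimination presupposes an orthogonal basis of the codomain, here the cycles. A first
  elimination, for the differential leaving degree \<open>m - 1\<close>, supplies it, indexed by
  \<open>nat + nat\<close>; the second one adds the index type of the chains, which explains the
  triple sum.\<close>

lemma svd_exists: "\<exists>I y J x P. svd m (I :: (nat + nat + nat) set) y J x P"
proof -
  obtain I w where w: "orth_basis \<Gamma> (chains X m) (filt X m) (I :: nat set) w" using chains_basis by blast
  obtain J z where z: "orth_basis \<Gamma> (chains X (m - 1)) (filt X (m - 1)) (J :: nat set) z"
    using chains_basis by blast
  obtain J' z' where z': "orth_basis \<Gamma> (chains X (m - 2)) (filt X (m - 2)) (J' :: nat set) z'"
    using chains_basis by blast
  interpret b: novikov_linear_map \<Gamma> "chains X (m - 1)" "filt X (m - 1)" "chains X (m - 2)" "filt X (m - 2)" "bdry X (m - 1)"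
    by (rule boundary_map) simp
  obtain I' y J'' x P where "b.svd_family (I' :: (nat + nat) set) y J'' x P"
    using b.svd_family_exists[OF z z'] by blast
  then have "orth_basis \<Gamma> (cycles X (m - 1)) (filt X (m - 1)) (I' - P) y"
    using b.orth_basis_ker ker_eq[of "m - 1" "m - 2"] by (simp add: cycles_eq)
  then show ?thesis
    by (rule novikov_linear_map.svd_family_exists[OF boundary_cycles_map w, rotated]) simp
qed

lemma chains_basis_svd:
  assumes s: "svd m I y J x P" and s': "svd (m + 1) I' y' J' x' P'"
  shows "orth_basis \<Gamma> (chains X m) (filt X m) (P <+> J') (case_sum y x')"
proof (rule novikov_normed_space.orth_basis_exchange[OF normed_chains _ subspace_kernel])
  interpret b: novikov_linear_map \<Gamma> "chains X m" "filt X m" "cycles X (m - 1)" "filt X (m - 1)" "bdry X m"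
    by (rule boundary_cycles_map) simp
  interpret b': novikov_linear_map \<Gamma> "chains X (m + 1)" "filt X (m + 1)" "cycles X m" "filt X m" "bdry X (m + 1)"
    by (rule boundary_cycles_map) simp
  show "orth_basis \<Gamma> (chains X m) (filt X m) I y" "P \<subseteq> I" using b.svd_familyD[OF s] by auto
  show "orth_basis \<Gamma> (chains X m\<lparr>carrier := kernel m\<rparr>) (filt X m) (I - P) y"
    using b.orth_basis_ker[OF s] ker_cycles_eq[of m "m - 1"] by simp
  show "orth_basis \<Gamma> (chains X m\<lparr>carrier := kernel m\<rparr>) (filt X m) J' x'"
    using s' b'.svd_familyD(2)[of I' y' J' x' P'] by (simp add: cycles_eq)
qed

lemma verbose_barcode_svd:
  assumes "svd (n + 1) I y J x P"
  shows "verbose_barcode \<Gamma> X n = family_barcode \<Gamma> (filt X (n + 1)) (filt X n) y J x P"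
  using assms by (intro verbose_barcode_eq[OF boundary_cycles_map]) simp_all

end

section \<open>Bars of the dual complex\<close>

lemma filter_image_mset_all:
  "(\<And>x. x \<in># M \<Longrightarrow> Q (f x)) \<Longrightarrow> filter_mset Q (image_mset f M) = image_mset f M"
  by (induction M) auto

lemma filter_image_mset_none:
  "(\<And>x. x \<in># M \<Longrightarrow> \<not> Q (f x)) \<Longrightarrow> filter_mset Q (image_mset f M) = {#}"
  by (induction M) auto

lemma image_uminus_real_coset:
  assumes "real_subgroup \<Gamma>"
  shows "(\<lambda>a. - a - s) ` real_coset \<Gamma> t = real_coset \<Gamma> (- t - s)"
proof -
  have "\<Gamma> = uminus ` \<Gamma>"
  proof
    show "uminus ` \<Gamma> \<subseteq> \<Gamma>" using assms by (auto simp: real_subgroup_def)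
    then show "\<Gamma> \<subseteq> uminus ` \<Gamma>" by (auto intro!: image_eqI[where x = "- _"])
  qed
  then have "real_coset \<Gamma> (- t - s) = (\<lambda>g. - t - s + g) ` uminus ` \<Gamma>"
    by (simp add: real_coset_def)
  then show ?thesis by (simp add: real_coset_def image_image algebra_simps)
qed

theorem proposition6p7:
  fixes \<Gamma> :: "real set" and X :: "('k::field, 'c) filtered_complex" and k :: int
  assumes "real_subgroup \<Gamma>"
    and "floer_type_complex \<Gamma> X"
  shows "verbose_barcode \<Gamma> (dual_complex \<Gamma> X) k =
           image_mset dual_infinite_bar {# b \<in># verbose_barcode \<Gamma> X (- k). snd b = \<infinity> #} +
           image_mset dual_finite_bar {# b \<in># verbose_barcode \<Gamma> X (- k - 1). snd b < \<infinity> #}"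
proof -
  interpret floer_complex \<Gamma> X by unfold_locales (fact assms)+
  define j where "j = - k"
  define Y where "Y = dual_complex \<Gamma> X"
  let ?C = "chains X j" and ?lC = "filt X j" and ?D = "chains X (j - 1)" and ?lD = "filt X (j - 1)"
  obtain I1 y1 J1 x1 P1 where s1: "svd (j + 1) (I1 :: (nat + nat + nat) set) y1 J1 x1 P1"
    using svd_exists by blast
  obtain I2 y2 J2 x2 P2 where s2: "svd j (I2 :: (nat + nat + nat) set) y2 J2 x2 P2"
    using svd_exists by blast
  obtain I3 y3 J3 x3 P3 where s3: "svd (j - 1) (I3 :: (nat + nat + nat) set) y3 J3 x3 P3"
    using svd_exists by blast
  interpret b1: novikov_linear_map \<Gamma> "chains X (j + 1)" "filt X (j + 1)" "cycles X j" ?lC "bdry X (j + 1)"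
    by (rule boundary_cycles_map) simp
  interpret b2: novikov_linear_map \<Gamma> ?C ?lC "cycles X (j - 1)" ?lD "bdry X j"
    by (rule boundary_cycles_map) simp
  have f1: "b1.svd_family I1 y1 J1 x1 P1" using s1 by simp
  note d1 = b1.svd_familyD[OF f1] and d2 = b2.svd_familyD[OF s2]
  have finJ1: "finite J1" and finP1: "finite P1" and finP2: "finite P2"
    using b1.D.orth_basis_finite[OF d1(2)] b2.D.orth_basis_finite[OF d2(2)] d1(4) d2(4) finite_subset
    by blast+
  have wC: "orth_basis \<Gamma> ?C ?lC (P2 <+> J1) (case_sum y2 x1)"
    by (rule chains_basis_svd[OF s2 s1])
  have "orth_basis \<Gamma> ?D ?lD (P3 <+> J2) (case_sum y3 x2)"
    by (rule chains_basis_svd[OF s3]) (use s2 in simp)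
  \<comment> \<open>With \<open>J2\<close> in the left summand, \<open>Inl p\<close> for
    \<open>p \<in> P2\<close> names \<open>y2 p\<close> in one basis and \<open>x2 p\<close> in the
    other, as the pairing of their dual vectors requires.\<close>
  then have wD: "orth_basis \<Gamma> ?D ?lD (J2 <+> P3) (case_sum x2 y3)"
  proof (rule novikov_normed_space.orth_basis_reindex[OF normed_chains, where h = "case_sum Inr Inl"])
    show "bij_betw (case_sum Inr Inl) (J2 <+> P3) (P3 <+> J2)"
      by (rule bij_betw_byWitness[where f' = "case_sum Inr Inl"]) auto
  qed auto
  define vC where "vC = novikov_normed_space.dual_vec \<Gamma> ?C (P2 <+> J1) (case_sum y2 x1)"
  define vD where "vD = novikov_normed_space.dual_vec \<Gamma> ?D (J2 <+> P3) (case_sum x2 y3)"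
  let ?Q = "Inl ` P2 \<union> Inr ` (J1 - P1)"
  \<comment> \<open>Since \<open>- (k + 1) + 1 = j\<close>, the differential leaving dual degree
    \<open>k + 1\<close> is the adjoint of \<open>bdry X j\<close>. This shift puts the finite bars
    in degree \<open>j - 1\<close> and the infinite ones in degree \<open>j\<close>.\<close>
  have chY: "chains Y (k + 1) = dual_space \<Gamma> ?D" "filt Y (k + 1) = dual_filt ?D ?lD"
    "chains Y k = dual_space \<Gamma> ?C" "filt Y k = dual_filt ?C ?lC"
    "chains Y (k - 1) = dual_space \<Gamma> (chains X (j + 1))"
    "bdry Y (k + 1) = (\<lambda>\<phi>. \<lambda>v\<in>carrier ?C. \<phi> (bdry X j v))"
    "bdry Y k = (\<lambda>\<phi>. \<lambda>v\<in>carrier (chains X (j + 1)). \<phi> (bdry X (j + 1) v))"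
    by (simp_all add: Y_def dual_complex_def j_def)
  have lm: "novikov_linear_map \<Gamma> (chains Y (k + 1)) (filt Y (k + 1)) (cycles Y k) (filt Y k) (bdry Y (k + 1))"
    and sv: "novikov_linear_map.svd_family \<Gamma> (chains Y (k + 1)) (filt Y (k + 1)) (cycles Y k) (filt Y k)
      (bdry Y (k + 1)) (J2 <+> P3) vD ?Q vC (Inl ` P2)"
  proof -
    have A: "novikov_linear_map \<Gamma> ?C ?lC ?D ?lD (bdry X j)" by (rule boundary_map) simp
    have B: "novikov_linear_map \<Gamma> (chains X (j + 1)) (filt X (j + 1)) ?C ?lC (bdry X (j + 1))"
      by (rule boundary_map) simp
    have x1ker: "x1 i \<in> kernel j" if "i \<in> J1" for i
      using b1.D.orth_basis_mem[OF d1(2) that] by (simp add: cycles_eq)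
    have x1: "bdry X j (x1 i) = \<zero>\<^bsub>?D\<^esub>" if "i \<in> J1" for i using x1ker[OF that] by (simp add: kernel_def)
    have P1: "x1 p \<in> bdry X (j + 1) ` carrier (chains X (j + 1))" if "p \<in> P1" for p
      using d1(5)[OF that] b1.C.orth_basis_mem[OF d1(1)] d1(3) that by (metis image_eqI subsetD)
    have im: "\<exists>b\<in>P1 \<rightarrow> carrier (novikov \<Gamma>). bdry X (j + 1) e = lin_comb ?C b x1 P1"
      if e: "e \<in> carrier (chains X (j + 1))" for e
    proof -
      obtain b where b: "b \<in> I1 \<rightarrow> carrier (novikov \<Gamma>)" "e = lin_comb (chains X (j + 1)) b y1 I1"
        by (rule b1.C.orth_basis_spanE[OF d1(1) e])
      have bP: "b \<in> P1 \<rightarrow> carrier (novikov \<Gamma>)" using b(1) d1(3) by auto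
      have "bdry X (j + 1) e = lin_comb (cycles X j) b x1 P1"
        unfolding b(2) by (rule b1.svd_image[OF f1 b(1)])
      also have "\<dots> = lin_comb ?C b x1 P1"
        unfolding cycles_eq
        by (rule b2.C.lin_comb_submodule[OF _ bP])
          (use subspace_kernel x1ker d1(4) in \<open>auto simp: VectorSpace.subspace_def\<close>)
      finally show ?thesis using bP by blast
    qed
    show "novikov_linear_map \<Gamma> (chains Y (k + 1)) (filt Y (k + 1)) (cycles Y k) (filt Y k) (bdry Y (k + 1))"
      unfolding cycles_def chY
      by (rule dual_svd_family(1)[OF A B wC wD d2(4,5) x1 d1(4) P1 im])
    show "novikov_linear_map.svd_family \<Gamma> (chains Y (k + 1)) (filt Y (k + 1)) (cycles Y k) (filt Y k)
      (bdry Y (k + 1)) (J2 <+> P3) vD ?Q vC (Inl ` P2)"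
      unfolding cycles_def chY vC_def vD_def
      by (rule dual_svd_family(2)[OF A B wC wD d2(4,5) x1 d1(4) P1 im])
  qed
  have vC: "filt Y k (vC i) = - ?lC (case_sum y2 x1 i)" if "i \<in> P2 <+> J1" for i
    unfolding chY vC_def by (rule novikov_normed_space.dual_filt_dual_vec[OF normed_chains wC that])
  have vD: "filt Y (k + 1) (vD i) = - ?lD (case_sum x2 y3 i)" if "i \<in> J2 <+> P3" for i
    unfolding chY vD_def by (rule novikov_normed_space.dual_filt_dual_vec[OF normed_chains wD that])
  have real1: "\<exists>r. ?lC (x1 i) = ereal r" if "i \<in> J1" for i
    using b1.D.orth_basis_real[OF d1(2) that] by blast
  have real1': "\<exists>r. filt X (j + 1) (y1 i) = ereal r" if "i \<in> I1" for i
    using b1.C.orth_basis_real[OF d1(1) that] by blast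
  have real2: "\<exists>r s. ?lC (y2 p) = ereal r \<and> ?lD (x2 p) = ereal s" if "p \<in> P2" for p
    using b2.C.orth_basis_real[OF d2(1), of p] b2.D.orth_basis_real[OF d2(2), of p] that d2(3,4) by blast
  have Q: "?Q - Inl ` P2 = Inr ` (J1 - P1)" by auto
  let ?inf = "image_mset (\<lambda>i. (real_coset \<Gamma> (- real_of_ereal (?lC (x1 i))), \<infinity>)) (mset_set (J1 - P1))"
  let ?fin = "image_mset (\<lambda>p. (real_coset \<Gamma> (- real_of_ereal (?lC (y2 p))), ?lC (y2 p) - ?lD (x2 p))) (mset_set P2)"
  have "verbose_barcode \<Gamma> Y k = family_barcode \<Gamma> (filt Y (k + 1)) (filt Y k) vD ?Q vC (Inl ` P2)"
    by (rule verbose_barcode_eq[OF lm sv])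
  also have "\<dots> = ?fin + ?inf"
  proof -
    \<comment> \<open>Both norms change sign while source and target trade places, so the gap is
      unchanged.\<close>
    have "filt Y (k + 1) (vD (Inl p)) - filt Y k (vC (Inl p)) = ?lC (y2 p) - ?lD (x2 p)" if p: "p \<in> P2" for p
    proof -
      have "Inl p \<in> P2 <+> J1" "Inl p \<in> J2 <+> P3" using p d2(4) by auto
      then show ?thesis using vC[of "Inl p"] vD[of "Inl p"] real2[OF p] by auto
    qed
    moreover have "filt Y k (vC (Inl p)) = - ?lC (y2 p)" if "p \<in> P2" for p
      using vC[OF InlI[OF that]] by simp
    moreover have "filt Y k (vC (Inr i)) = - ?lC (x1 i)" if "i \<in> J1" for i
      using vC[OF InrI[OF that]] by simp
    ultimately show ?thesis
      unfolding family_barcode_def Q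
      using finP2 finJ1
      by (auto simp: image_mset.compositionality comp_def inj_on_def simp flip: image_mset_mset_set
        intro!: arg_cong2[where f = "(+)"] image_mset_cong)
  qed
  also have "?inf = image_mset dual_infinite_bar {# b \<in># verbose_barcode \<Gamma> X j. snd b = \<infinity> #}"
  proof -
    \<comment> \<open>All paired bars are finite, so selecting the value \<open>\<infinity>\<close>
      keeps precisely the unpaired cycles.\<close>
    have "filt X (j + 1) (y1 i) - ?lC (x1 i) \<noteq> \<infinity>" if "i \<in> P1" for i
    proof -
      have "i \<in> I1" "i \<in> J1" using that d1(3,4) by auto
      then show ?thesis using real1[of i] real1'[of i] by auto
    qed
    then have "{# b \<in># verbose_barcode \<Gamma> X j. snd b = \<infinity> #} =
        image_mset (\<lambda>i. (real_coset \<Gamma> (real_of_ereal (?lC (x1 i))), \<infinity>)) (mset_set (J1 - P1))"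
      unfolding verbose_barcode_svd[OF s1] family_barcode_def filter_union_mset
      using finP1 by (subst filter_image_mset_none, simp, subst filter_image_mset_all) simp_all
    then show ?thesis
      using image_uminus_real_coset[OF assms(1), of 0]
      by (simp add: image_mset.compositionality comp_def dual_infinite_bar_def)
  qed
  also have "?fin = image_mset dual_finite_bar {# b \<in># verbose_barcode \<Gamma> X (j - 1). snd b < \<infinity> #}"
  proof -
    have gap: "?lC (y2 p) - ?lD (x2 p) < \<infinity>" if "p \<in> P2" for p using real2[OF that] by auto
    have s2': "svd (j - 1 + 1) I2 y2 J2 x2 P2" using s2 by simp
    have "{# b \<in># verbose_barcode \<Gamma> X (j - 1). snd b < \<infinity> #} =
        image_mset (\<lambda>p. (real_coset \<Gamma> (real_of_ereal (?lD (x2 p))), ?lC (y2 p) - ?lD (x2 p))) (mset_set P2)"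
      unfolding verbose_barcode_svd[OF s2'] family_barcode_def filter_union_mset
      using finP2 gap by (subst filter_image_mset_all, simp, subst filter_image_mset_none) simp_all
    \<comment> \<open>With \<open>a\<close> the norm of \<open>x2 p\<close> and \<open>L\<close> the
      gap, \<open>- a - L\<close> is minus the norm of \<open>y2 p\<close>, the dual norm of its
      coordinate functional.\<close>
    moreover have "- real_of_ereal (?lD (x2 p)) - real_of_ereal (?lC (y2 p) - ?lD (x2 p)) =
        - real_of_ereal (?lC (y2 p))" if "p \<in> P2" for p
      using real2[OF that] by auto
    ultimately show ?thesis
      using finP2
      by (auto simp: image_mset.compositionality comp_def dual_finite_bar_def image_uminus_real_coset[OF assms(1)]
        intro!: image_mset_cong)
  qed
  finally show ?thesis by (simp add: Y_def j_def add.commute)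
qed

end
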